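(* Let $f:\mathcal E\to\mathcal F$ and $f':\mathcal E'\to\mathcal F$ be two relative toposes over $\mathcal F$. There is an equivalence of categories $$\mathbf{OpfibTerm}(S_{f'},S_f)\simeq\mathbf{Wmor}/\mathcal F([f],[f']).$$
   Context: Topos means Grothendieck topos; a relative topos over $\mathcal F$ is a geometric morphism with codomain $\mathcal F$. A weak morphism of toposes $a:\mathcal E\to\mathcal E'$ is just an adjoint pair $a^*\dashv a_*$ with $a^*:\mathcal E'\to\mathcal E$ (the left adjoint $a^*$ is not required to preserve finite limits). $\mathbf{Wmor}/\mathcal F([f],[f'])$ is the category of weak morphisms of toposes from $[f]$ to $[f']$ over $\mathcal F$: weak morphisms $a:\mathcal E\to\mathcal E'$ together with a natural isomorphism $\phi:a^*f'^*\simeq f^*$. A morphism $(a,\phi)\to(b,\psi)$ is a natural transformation $\theta:a^*\Rightarrow b^*$ with $\psi\circ(\theta f'^* )=\phi$. For $f:\mathcal E\to\mathcal F$, $S_f$ denotes its canonical stack, with fibers $\mathcal E/f^*(F)$ for $F\in\mathcal F$, regarded as an opfibration over $\mathcal F$ in which an arrow $g:F\to F'$ of $\mathcal F$ acts by the functor $\Sigma_g:\mathcal E/f^*F\to\mathcal E/f^*F'$ of postcomposition with $f^*(g)$. $\mathbf{OpfibTerm}(S_{f'},S_f)$ is the category of terminal-preserving morphisms of opfibrations: families of adjoint pairs $(a_F)^*\dashv(a_F)_*$, with $(a_F)^*:\mathcal E'/f'^*(F)\to\mathcal E/f^*(F)$ for $F\in\mathcal F$, such that the left adjoints $(a_F)^*$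 form a morphism of opfibrations over $\mathcal F$ (commute, up to coherent isomorphism, with the functors $\Sigma_g$) and each $(a_F)^*$ preserves the terminal object. Morphisms are the vertical natural transformations between the functors of total categories given by the left adjoints. *)

theory Defs
  imports "HOL-Library.FuncSet" "HOL-Library.Countable_Set" "HOL-Library.Equipollence"
begin

record ('o, 'm) cat =
  Obj :: "'o set"
  Arr :: "'m set"
  Dom :: "'m \<Rightarrow> 'o"
  Cod :: "'m \<Rightarrow> 'o"
  Idt :: "'o \<Rightarrow> 'm"
  Cmp :: "'m \<Rightarrow> 'm \<Rightarrow> 'm"

text \<open>\<open>Cmp C g f\<close> is the composite ``\<open>g\<close> after \<open>f\<close>''.\<close>

definition hom :: "('o, 'm) cat \<Rightarrow> 'o \<Rightarrow> 'o \<Rightarrow> 'm set" where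
  "hom C x y = {f \<in> Arr C. Dom C f = x \<and> Cod C f = y}"

locale category =
  fixes C :: "('o, 'm) cat"
  assumes Dom_in: "f \<in> Arr C \<Longrightarrow> Dom C f \<in> Obj C"
    and Cod_in: "f \<in> Arr C \<Longrightarrow> Cod C f \<in> Obj C"
    and Idt_in: "x \<in> Obj C \<Longrightarrow> Idt C x \<in> hom C x x"
    and Cmp_in: "f \<in> hom C x y \<Longrightarrow> g \<in> hom C y z \<Longrightarrow> Cmp C g f \<in> hom C x z"
    and Cmp_Idt_right: "f \<in> hom C x y \<Longrightarrow> Cmp C f (Idt C x) = f"
    and Cmp_Idt_left: "f \<in> hom C x y \<Longrightarrow> Cmp C (Idt C y) f = f"
    and Cmp_assoc: "f \<in> hom C w x \<Longrightarrow> g \<in> hom C x y \<Longrightarrow> h \<in> hom C y z \<Longrightarrow>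
      Cmp C h (Cmp C g f) = Cmp C (Cmp C h g) f"

definition op_cat :: "('o, 'm) cat \<Rightarrow> ('o, 'm) cat" where
  "op_cat C = \<lparr>Obj = Obj C, Arr = Arr C, Dom = Cod C, Cod = Dom C, Idt = Idt C,
     Cmp = (\<lambda>g f. Cmp C f g)\<rparr>"

definition iso_arr :: "('o, 'm) cat \<Rightarrow> 'm \<Rightarrow> bool" where
  "iso_arr C f \<longleftrightarrow> f \<in> Arr C \<and>
     (\<exists>g \<in> hom C (Cod C f) (Dom C f).
        Cmp C g f = Idt C (Dom C f) \<and> Cmp C f g = Idt C (Cod C f))"

definition terminal :: "('o, 'm) cat \<Rightarrow> 'o \<Rightarrow> bool" where
  "terminal C t \<longleftrightarrow> t \<in> Obj C \<and> (\<forall>x \<in> Obj C. \<exists>!f. f \<in> hom C x t)"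

record ('o1, 'm1, 'o2, 'm2) ftor =
  omap :: "'o1 \<Rightarrow> 'o2"
  amap :: "'m1 \<Rightarrow> 'm2"

text \<open>
  Functors and natural transformations are required to be extensional, i.e. to take the value
  \<^term>\<open>undefined\<close> outside their domain, so that HOL equality is the intended equality.
\<close>

definition is_functor ::
  "('o1, 'm1) cat \<Rightarrow> ('o2, 'm2) cat \<Rightarrow> ('o1, 'm1, 'o2, 'm2) ftor \<Rightarrow> bool" where
  "is_functor C D T \<longleftrightarrow> category C \<and> category D \<and>
     omap T \<in> Obj C \<rightarrow>\<^sub>E Obj D \<and> amap T \<in> Arr C \<rightarrow>\<^sub>E Arr D \<and>
     (\<forall>f \<in> Arr C. Dom D (amap T f) = omap T (Dom C f) \<and> Cod D (amap T f) = omap T (Cod C f)) \<and>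
     (\<forall>x \<in> Obj C. amap T (Idt C x) = Idt D (omap T x)) \<and>
     (\<forall>f \<in> Arr C. \<forall>g \<in> Arr C. Cod C f = Dom C g \<longrightarrow>
        amap T (Cmp C g f) = Cmp D (amap T g) (amap T f))"

definition id_functor :: "('o, 'm) cat \<Rightarrow> ('o, 'm, 'o, 'm) ftor" where
  "id_functor C = \<lparr>omap = (\<lambda>x \<in> Obj C. x), amap = (\<lambda>f \<in> Arr C. f)\<rparr>"

text \<open>\<open>comp_functor C G F\<close> is ``\<open>G\<close> after \<open>F\<close>'', where \<open>C\<close> is the domain category of \<open>F\<close>.\<close>

definition comp_functor ::
  "('o1, 'm1) cat \<Rightarrow> ('o2, 'm2, 'o3, 'm3) ftor \<Rightarrow> ('o1, 'm1, 'o2, 'm2) ftor \<Rightarrow>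
   ('o1, 'm1, 'o3, 'm3) ftor" where
  "comp_functor C G F =
     \<lparr>omap = compose (Obj C) (omap G) (omap F), amap = compose (Arr C) (amap G) (amap F)\<rparr>"

definition nat_trans ::
  "('o1, 'm1) cat \<Rightarrow> ('o2, 'm2) cat \<Rightarrow> ('o1, 'm1, 'o2, 'm2) ftor \<Rightarrow>
   ('o1, 'm1, 'o2, 'm2) ftor \<Rightarrow> ('o1 \<Rightarrow> 'm2) \<Rightarrow> bool" where
  "nat_trans C D S T \<tau> \<longleftrightarrow> is_functor C D S \<and> is_functor C D T \<and>
     \<tau> \<in> extensional (Obj C) \<and> (\<forall>x \<in> Obj C. \<tau> x \<in> hom D (omap S x) (omap T x)) \<and>
     (\<forall>f \<in> Arr C. Cmp D (\<tau> (Cod C f)) (amap S f) = Cmp D (amap T f) (\<tau> (Dom C f)))"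

definition nat_iso ::
  "('o1, 'm1) cat \<Rightarrow> ('o2, 'm2) cat \<Rightarrow> ('o1, 'm1, 'o2, 'm2) ftor \<Rightarrow>
   ('o1, 'm1, 'o2, 'm2) ftor \<Rightarrow> ('o1 \<Rightarrow> 'm2) \<Rightarrow> bool" where
  "nat_iso C D S T \<tau> \<longleftrightarrow> nat_trans C D S T \<tau> \<and> (\<forall>x \<in> Obj C. iso_arr D (\<tau> x))"

definition equivalent_categories :: "('o1, 'm1) cat \<Rightarrow> ('o2, 'm2) cat \<Rightarrow> bool" where
  "equivalent_categories C D \<longleftrightarrow> category C \<and> category D \<and>
     (\<exists>S T \<eta> \<epsilon>. is_functor C D S \<and> is_functor D C T \<and>
        nat_iso C C (id_functor C) (comp_functor C T S) \<eta> \<and>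
        nat_iso D D (comp_functor D S T) (id_functor D) \<epsilon>)"

text \<open>
  Many categories below have as objects some structures \<open>k \<in> K\<close> with an underlying functor
  \<open>U k : X \<rightarrow> Y\<close>, and as arrows \<open>k \<rightarrow> l\<close> those natural transformations \<open>\<tau> : U k \<Rightarrow> U l\<close> which satisfy
  a condition \<open>P k \<tau> l\<close>; composition is vertical composition.
\<close>

definition transformation_cat ::
  "('o1, 'm1) cat \<Rightarrow> ('o2, 'm2) cat \<Rightarrow> 'k set \<Rightarrow> ('k \<Rightarrow> ('o1, 'm1, 'o2, 'm2) ftor) \<Rightarrow>
   ('k \<Rightarrow> ('o1 \<Rightarrow> 'm2) \<Rightarrow> 'k \<Rightarrow> bool) \<Rightarrow> ('k, 'k \<times> ('o1 \<Rightarrow> 'm2) \<times> 'k) cat" where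
  "transformation_cat X Y K U P =
     \<lparr>Obj = K,
      Arr = {(k, \<tau>, l). k \<in> K \<and> l \<in> K \<and> nat_trans X Y (U k) (U l) \<tau> \<and> P k \<tau> l},
      Dom = (\<lambda>(k, \<tau>, l). k),
      Cod = (\<lambda>(k, \<tau>, l). l),
      Idt = (\<lambda>k. (k, \<lambda>x \<in> Obj X. Idt Y (omap (U k) x), k)),
      Cmp = (\<lambda>(l', \<tau>', m) (k, \<tau>, l). (k, \<lambda>x \<in> Obj X. Cmp Y (\<tau>' x) (\<tau> x), m))\<rparr>"

text \<open>An adjoint pair \<open>lft \<stileturn> rgt\<close> with \<open>lft : C \<rightarrow> D\<close> and \<open>rgt : D \<rightarrow> C\<close>.\<close>

record ('o1, 'm1, 'o2, 'm2) adj =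
  lft :: "('o1, 'm1, 'o2, 'm2) ftor"
  rgt :: "('o2, 'm2, 'o1, 'm1) ftor"
  unit :: "'o1 \<Rightarrow> 'm1"
  counit :: "'o2 \<Rightarrow> 'm2"

definition adjunction ::
  "('o1, 'm1) cat \<Rightarrow> ('o2, 'm2) cat \<Rightarrow> ('o1, 'm1, 'o2, 'm2) adj \<Rightarrow> bool" where
  "adjunction C D a \<longleftrightarrow>
     is_functor C D (lft a) \<and> is_functor D C (rgt a) \<and>
     nat_trans C C (id_functor C) (comp_functor C (rgt a) (lft a)) (unit a) \<and>
     nat_trans D D (comp_functor D (lft a) (rgt a)) (id_functor D) (counit a) \<and>
     (\<forall>x \<in> Obj C. Cmp D (counit a (omap (lft a) x)) (amap (lft a) (unit a x))
                  = Idt D (omap (lft a) x)) \<and>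
     (\<forall>y \<in> Obj D. Cmp C (amap (rgt a) (counit a y)) (unit a (omap (rgt a) y))
                  = Idt C (omap (rgt a) y))"

definition cone ::
  "('i, 'j) cat \<Rightarrow> ('o, 'm) cat \<Rightarrow> ('i, 'j, 'o, 'm) ftor \<Rightarrow> 'o \<Rightarrow> ('i \<Rightarrow> 'm) \<Rightarrow> bool" where
  "cone I C G c \<pi> \<longleftrightarrow> is_functor I C G \<and> c \<in> Obj C \<and>
     (\<forall>i \<in> Obj I. \<pi> i \<in> hom C c (omap G i)) \<and>
     (\<forall>u \<in> Arr I. Cmp C (amap G u) (\<pi> (Dom I u)) = \<pi> (Cod I u))"

definition limit_cone ::
  "('i, 'j) cat \<Rightarrow> ('o, 'm) cat \<Rightarrow> ('i, 'j, 'o, 'm) ftor \<Rightarrow> 'o \<Rightarrow> ('i \<Rightarrow> 'm) \<Rightarrow> bool" where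
  "limit_cone I C G c \<pi> \<longleftrightarrow> cone I C G c \<pi> \<and>
     (\<forall>d \<rho>. cone I C G d \<rho> \<longrightarrow>
        (\<exists>!h. h \<in> hom C d c \<and> (\<forall>i \<in> Obj I. Cmp C (\<pi> i) h = \<rho> i)))"

text \<open>
  Every finite category is isomorphic to one whose objects and arrows are natural numbers, so
  these are the only diagram shapes that have to be considered.
\<close>

definition preserves_finite_limits ::
  "('o1, 'm1) cat \<Rightarrow> ('o2, 'm2) cat \<Rightarrow> ('o1, 'm1, 'o2, 'm2) ftor \<Rightarrow> bool" where
  "preserves_finite_limits C D T \<longleftrightarrow>
     (\<forall>(I :: (nat, nat) cat) G c \<pi>. finite (Obj I) \<and> finite (Arr I) \<and> limit_cone I C G c \<pi> \<longrightarrow>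
        limit_cone I D (comp_functor I T G) (omap T c) (\<lambda>i. amap T (\<pi> i)))"

definition preserves_terminal ::
  "('o1, 'm1) cat \<Rightarrow> ('o2, 'm2) cat \<Rightarrow> ('o1, 'm1, 'o2, 'm2) ftor \<Rightarrow> bool" where
  "preserves_terminal C D T \<longleftrightarrow> (\<forall>t. terminal C t \<longrightarrow> terminal D (omap T t))"

text \<open>
  HOL has no proper classes, so smallness is relative to a universe.  The universe is given by a
  type \<open>'u\<close> whose cardinality is strongly inaccessible; a set of elements of \<open>'u\<close> is small if its
  cardinality is strictly less than that of \<open>'u\<close>.  Every set of cardinality less than that
  of \<open>'u\<close> is in bijection with a small set in this sense.
\<close>

definition small :: "'u set \<Rightarrow> bool" where
  "small A \<longleftrightarrow> A \<prec> (UNIV :: 'u set)"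

definition inaccessible_universe :: "'u itself \<Rightarrow> bool" where
  "inaccessible_universe _ \<longleftrightarrow>
     uncountable (UNIV :: 'u set) \<and>
     (\<forall>A :: 'u set. small A \<longrightarrow> Pow A \<prec> (UNIV :: 'u set)) \<and>
     (\<forall>(I :: 'u set) (A :: 'u \<Rightarrow> 'u set). small I \<longrightarrow> (\<forall>i \<in> I. small (A i)) \<longrightarrow>
        small (\<Union>i \<in> I. A i))"

definition set_cat :: "('u set, 'u set \<times> ('u \<Rightarrow> 'u) \<times> 'u set) cat" where
  "set_cat =
     \<lparr>Obj = {A. small A},
      Arr = {(A, f, B). small A \<and> small B \<and> f \<in> A \<rightarrow>\<^sub>E B},
      Dom = (\<lambda>(A, f, B). A),
      Cod = (\<lambda>(A, f, B). B),
      Idt = (\<lambda>A. (A, \<lambda>x \<in> A. x, A)),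
      Cmp = (\<lambda>(B', g, D) (A, f, B). (A, compose A g f, D))\<rparr>"

definition sieve :: "('o, 'm) cat \<Rightarrow> 'o \<Rightarrow> 'm set \<Rightarrow> bool" where
  "sieve C c S \<longleftrightarrow> S \<subseteq> {f \<in> Arr C. Cod C f = c} \<and>
     (\<forall>f \<in> S. \<forall>g \<in> Arr C. Cod C g = Dom C f \<longrightarrow> Cmp C f g \<in> S)"

definition sieve_pullback :: "('o, 'm) cat \<Rightarrow> 'm \<Rightarrow> 'm set \<Rightarrow> 'm set" where
  "sieve_pullback C h S = {g \<in> Arr C. Cod C g = Dom C h \<and> Cmp C h g \<in> S}"

definition grothendieck_topology :: "('o, 'm) cat \<Rightarrow> ('o \<Rightarrow> 'm set set) \<Rightarrow> bool" where
  "grothendieck_topology C J \<longleftrightarrow>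
     (\<forall>c \<in> Obj C. \<forall>S \<in> J c. sieve C c S) \<and>
     (\<forall>c \<in> Obj C. {f \<in> Arr C. Cod C f = c} \<in> J c) \<and>
     (\<forall>h \<in> Arr C. \<forall>S \<in> J (Cod C h). sieve_pullback C h S \<in> J (Dom C h)) \<and>
     (\<forall>c \<in> Obj C. \<forall>S \<in> J c. \<forall>R. sieve C c R \<longrightarrow>
        (\<forall>h \<in> S. sieve_pullback C h R \<in> J (Dom C h)) \<longrightarrow> R \<in> J c)"

definition small_site :: "('u, 'u) cat \<Rightarrow> ('u \<Rightarrow> 'u set set) \<Rightarrow> bool" where
  "small_site C J \<longleftrightarrow> category C \<and> small (Obj C) \<and> small (Arr C) \<and> grothendieck_topology C J"

type_synonym 'u presheaf = "('u, 'u, 'u set, 'u set \<times> ('u \<Rightarrow> 'u) \<times> 'u set) ftor"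

definition restr :: "'u presheaf \<Rightarrow> 'u \<Rightarrow> 'u \<Rightarrow> 'u" where
  "restr P f s = fst (snd (amap P f)) s"

definition sheaf :: "('u, 'u) cat \<Rightarrow> ('u \<Rightarrow> 'u set set) \<Rightarrow> 'u presheaf \<Rightarrow> bool" where
  "sheaf C J P \<longleftrightarrow> is_functor (op_cat C) set_cat P \<and>
     (\<forall>c \<in> Obj C. \<forall>S \<in> J c. \<forall>m :: 'u \<Rightarrow> 'u.
        (\<forall>f \<in> S. m f \<in> omap P (Dom C f)) \<and>
        (\<forall>f \<in> S. \<forall>g \<in> Arr C. Cod C g = Dom C f \<longrightarrow> restr P g (m f) = m (Cmp C f g)) \<longrightarrow>
        (\<exists>!s. s \<in> omap P c \<and> (\<forall>f \<in> S. restr P f s = m f)))"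

definition sheaf_cat ::
  "('u, 'u) cat \<Rightarrow> ('u \<Rightarrow> 'u set set) \<Rightarrow>
   ('u presheaf, 'u presheaf \<times> ('u \<Rightarrow> 'u set \<times> ('u \<Rightarrow> 'u) \<times> 'u set) \<times> 'u presheaf) cat" where
  "sheaf_cat C J =
     transformation_cat (op_cat C) set_cat {P. sheaf C J P} (\<lambda>P. P) (\<lambda>P \<tau> Q. True)"

definition grothendieck_topos :: "'u itself \<Rightarrow> ('o, 'm) cat \<Rightarrow> bool" where
  "grothendieck_topos _ E \<longleftrightarrow>
     (\<exists>(C :: ('u, 'u) cat) J. small_site C J \<and> equivalent_categories E (sheaf_cat C J))"

text \<open>
  A (weak or geometric) morphism \<open>E \<rightarrow> F\<close> is directed like its right adjoint: its left adjoint,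
  the inverse image, goes from \<open>F\<close> to \<open>E\<close>.
\<close>

definition weak_morphism ::
  "('oe, 'me) cat \<Rightarrow> ('of, 'mf) cat \<Rightarrow> ('of, 'mf, 'oe, 'me) adj \<Rightarrow> bool" where
  "weak_morphism E F a \<longleftrightarrow> adjunction F E a"

definition geometric_morphism ::
  "('oe, 'me) cat \<Rightarrow> ('of, 'mf) cat \<Rightarrow> ('of, 'mf, 'oe, 'me) adj \<Rightarrow> bool" where
  "geometric_morphism E F f \<longleftrightarrow> adjunction F E f \<and> preserves_finite_limits F E (lft f)"

text \<open>
  \<open>Wmor_over E E' F f f'\<close>: objects are pairs \<open>(a, \<phi>)\<close> of a weak morphism \<open>a : E \<rightarrow> E'\<close> and a natural
  isomorphism \<open>\<phi>\<close> from \<open>lft a \<circ> lft f'\<close> to \<open>lft f\<close>.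
\<close>

definition Wmor_over ::
  "('oe, 'me) cat \<Rightarrow> ('oe', 'me') cat \<Rightarrow> ('of, 'mf) cat \<Rightarrow>
   ('of, 'mf, 'oe, 'me) adj \<Rightarrow> ('of, 'mf, 'oe', 'me') adj \<Rightarrow>
   (('oe', 'me', 'oe, 'me) adj \<times> ('of \<Rightarrow> 'me),
    (('oe', 'me', 'oe, 'me) adj \<times> ('of \<Rightarrow> 'me)) \<times> ('oe' \<Rightarrow> 'me) \<times>
    (('oe', 'me', 'oe, 'me) adj \<times> ('of \<Rightarrow> 'me))) cat" where
  "Wmor_over E E' F f f' = transformation_cat E' E
     {(a, \<phi>). weak_morphism E E' a \<and> nat_iso F E (comp_functor F (lft a) (lft f')) (lft f) \<phi>}
     (\<lambda>(a, \<phi>). lft a)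
     (\<lambda>(a, \<phi>) \<theta> (b, \<psi>). \<forall>x \<in> Obj F. Cmp E (\<psi> x) (\<theta> (omap (lft f') x)) = \<phi> x)"

text \<open>
  The objects of the slice over \<open>c\<close> are the arrows \<open>x\<close> with codomain \<open>c\<close>; an arrow \<open>x \<rightarrow> y\<close> is a
  triple \<open>(x, u, y)\<close> with \<open>y \<circ> u = x\<close>.
\<close>

definition slice :: "('o, 'm) cat \<Rightarrow> 'o \<Rightarrow> ('m, 'm \<times> 'm \<times> 'm) cat" where
  "slice C c =
     \<lparr>Obj = {x \<in> Arr C. Cod C x = c},
      Arr = {(x, u, y). x \<in> Arr C \<and> Cod C x = c \<and> y \<in> Arr C \<and> Cod C y = c \<and>
                        u \<in> hom C (Dom C x) (Dom C y) \<and> Cmp C y u = x},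
      Dom = (\<lambda>(x, u, y). x),
      Cod = (\<lambda>(x, u, y). y),
      Idt = (\<lambda>x. (x, Idt C (Dom C x), x)),
      Cmp = (\<lambda>(y', v, z) (x, u, y). (x, Cmp C v u, z))\<rparr>"

definition postcomp :: "('o, 'm) cat \<Rightarrow> 'm \<Rightarrow> ('m, 'm \<times> 'm \<times> 'm, 'm, 'm \<times> 'm \<times> 'm) ftor" where
  "postcomp C h =
     \<lparr>omap = (\<lambda>x \<in> Obj (slice C (Dom C h)). Cmp C h x),
      amap = (\<lambda>(x, u, y) \<in> Arr (slice C (Dom C h)). (Cmp C h x, u, Cmp C h y))\<rparr>"

text \<open>
  A (split) opfibration over a base is given by its fibers and its pushforward functors along the
  arrows of the base.
\<close>

record ('ob, 'mb, 'o, 'm) opfib =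
  Fib :: "'ob \<Rightarrow> ('o, 'm) cat"
  Push :: "'mb \<Rightarrow> ('o, 'm, 'o, 'm) ftor"

definition canonical_stack ::
  "('oe, 'me) cat \<Rightarrow> ('of, 'mf, 'oe, 'me) adj \<Rightarrow> ('of, 'mf, 'me, 'me \<times> 'me \<times> 'me) opfib" where
  "canonical_stack E f =
     \<lparr>Fib = (\<lambda>x. slice E (omap (lft f) x)), Push = (\<lambda>g. postcomp E (amap (lft f) g))\<rparr>"

text \<open>
  The total category (Grothendieck construction): an arrow \<open>(b, x) \<rightarrow> (b', x')\<close> is a pair \<open>(g, v)\<close> of
  \<open>g : b \<rightarrow> b'\<close> in the base and \<open>v : Push g x \<rightarrow> x'\<close> in the fiber over \<open>b'\<close>.
\<close>

definition total_cat ::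
  "('ob, 'mb) cat \<Rightarrow> ('ob, 'mb, 'o, 'm) opfib \<Rightarrow>
   ('ob \<times> 'o, ('ob \<times> 'o) \<times> ('mb \<times> 'm) \<times> ('ob \<times> 'o)) cat" where
  "total_cat B S =
     \<lparr>Obj = (SIGMA b : Obj B. Obj (Fib S b)),
      Arr = {((b, x), (g, v), (b', x')). g \<in> hom B b b' \<and> x \<in> Obj (Fib S b) \<and>
               x' \<in> Obj (Fib S b') \<and> v \<in> hom (Fib S b') (omap (Push S g) x) x'},
      Dom = (\<lambda>(p, gv, q). p),
      Cod = (\<lambda>(p, gv, q). q),
      Idt = (\<lambda>(b, x). ((b, x), (Idt B b, Idt (Fib S b) x), (b, x))),
      Cmp = (\<lambda>(q', (h, w), r) (p, (g, v), q).
               (p, (Cmp B h g, Cmp (Fib S (fst r)) w (amap (Push S h) v)), r))\<rparr>"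

text \<open>
  A family of adjoint pairs indexed by the objects of the base, and comparison isomorphisms
  \<open>coh g x : Push S g (lft (adjs b) x) \<rightarrow> lft (adjs b') (Push S' g x)\<close> for \<open>g : b \<rightarrow> b'\<close>.
\<close>

record ('ob, 'mb, 'o1, 'm1, 'o2, 'm2) opfib_mor =
  adjs :: "'ob \<Rightarrow> ('o1, 'm1, 'o2, 'm2) adj"
  coh :: "'mb \<Rightarrow> 'o1 \<Rightarrow> 'm2"

definition opfib_term_morphism ::
  "('ob, 'mb) cat \<Rightarrow> ('ob, 'mb, 'o1, 'm1) opfib \<Rightarrow> ('ob, 'mb, 'o2, 'm2) opfib \<Rightarrow>
   ('ob, 'mb, 'o1, 'm1, 'o2, 'm2) opfib_mor \<Rightarrow> bool" where
  "opfib_term_morphism B S' S A \<longleftrightarrow>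
     adjs A \<in> extensional (Obj B) \<and> coh A \<in> extensional (Arr B) \<and>
     (\<forall>b \<in> Obj B. adjunction (Fib S' b) (Fib S b) (adjs A b) \<and>
        preserves_terminal (Fib S' b) (Fib S b) (lft (adjs A b))) \<and>
     (\<forall>b b'. \<forall>g \<in> hom B b b'.
        nat_iso (Fib S' b) (Fib S b')
          (comp_functor (Fib S' b) (Push S g) (lft (adjs A b)))
          (comp_functor (Fib S' b) (lft (adjs A b')) (Push S' g))
          (coh A g)) \<and>
     (\<forall>b \<in> Obj B. \<forall>x \<in> Obj (Fib S' b).
        coh A (Idt B b) x = Idt (Fib S b) (omap (lft (adjs A b)) x)) \<and>
     (\<forall>b b' b''. \<forall>g \<in> hom B b b'. \<forall>h \<in> hom B b' b''. \<forall>x \<in> Obj (Fib S' b).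
        coh A (Cmp B h g) x =
          Cmp (Fib S b'') (coh A h (omap (Push S' g) x)) (amap (Push S h) (coh A g x)))"

definition total_functor ::
  "('ob, 'mb) cat \<Rightarrow> ('ob, 'mb, 'o1, 'm1) opfib \<Rightarrow> ('ob, 'mb, 'o2, 'm2) opfib \<Rightarrow>
   ('ob, 'mb, 'o1, 'm1, 'o2, 'm2) opfib_mor \<Rightarrow>
   ('ob \<times> 'o1, ('ob \<times> 'o1) \<times> ('mb \<times> 'm1) \<times> ('ob \<times> 'o1),
    'ob \<times> 'o2, ('ob \<times> 'o2) \<times> ('mb \<times> 'm2) \<times> ('ob \<times> 'o2)) ftor" where
  "total_functor B S' S A =
     \<lparr>omap = (\<lambda>(b, x) \<in> Obj (total_cat B S'). (b, omap (lft (adjs A b)) x)),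
      amap = (\<lambda>((b, x), (g, v), (b', x')) \<in> Arr (total_cat B S').
        ((b, omap (lft (adjs A b)) x),
         (g, Cmp (Fib S b') (amap (lft (adjs A b')) v) (coh A g x)),
         (b', omap (lft (adjs A b')) x')))\<rparr>"

definition vertical ::
  "('ob, 'mb) cat \<Rightarrow> ('ob, 'mb, 'o, 'm) opfib \<Rightarrow>
   ('ob \<times> 'o) \<times> ('mb \<times> 'm) \<times> ('ob \<times> 'o) \<Rightarrow> bool" where
  "vertical B S t \<longleftrightarrow> t \<in> Arr (total_cat B S) \<and>
     (case t of ((b, x), (g, v), q) \<Rightarrow> g = Idt B b)"

definition OpfibTerm ::
  "('ob, 'mb) cat \<Rightarrow> ('ob, 'mb, 'o1, 'm1) opfib \<Rightarrow> ('ob, 'mb, 'o2, 'm2) opfib \<Rightarrow>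
   (('ob, 'mb, 'o1, 'm1, 'o2, 'm2) opfib_mor,
    ('ob, 'mb, 'o1, 'm1, 'o2, 'm2) opfib_mor \<times>
    ('ob \<times> 'o1 \<Rightarrow> ('ob \<times> 'o2) \<times> ('mb \<times> 'm2) \<times> ('ob \<times> 'o2)) \<times>
    ('ob, 'mb, 'o1, 'm1, 'o2, 'm2) opfib_mor) cat" where
  "OpfibTerm B S' S = transformation_cat (total_cat B S') (total_cat B S)
     {A. opfib_term_morphism B S' S A}
     (total_functor B S' S)
     (\<lambda>A \<theta> A'. \<forall>p \<in> Obj (total_cat B S'). vertical B S (\<theta> p))"

end

theory Submission
  imports Defs
begin

text \<open>
  Write \<open>a\<^sup>*\<close>, \<open>f\<^sup>*\<close>, \<open>f'\<^sup>*\<close> for left adjoints.  A weak morphism \<open>(a, \<phi>)\<close> over \<open>F\<close> gives functors between the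
  fibers of the canonical stacks: \<open>x : X \<rightarrow> f'\<^sup>* b\<close> is sent to \<open>\<phi> b \<circ> a\<^sup>* x : a\<^sup>* X \<rightarrow> f\<^sup>* b\<close>.  They commute with
  postcomposition by naturality of \<open>\<phi>\<close>, and preserve terminal objects of slices, that is isomorphisms,
  because \<open>\<phi>\<close> is invertible.  Each of them has a right adjoint, obtained by pulling back \<open>a\<^sub>* y\<close> along the
  transpose of \<open>\<phi> b\<close>; this is where the topos \<open>E'\<close> enters, through its pullbacks
  (\<open>slice_lift_adjunction\<close>).  The assignment is a functor \<open>stack_functor\<close> from weak morphisms to
  terminal-preserving morphisms of opfibrations, and it is an equivalence for the following reasons.

  Every \<open>x : X \<rightarrow> f'\<^sup>* b\<close> has a cocartesian arrow, with underlying arrow the identity of \<open>X\<close>, to \<open>X \<rightarrow> f'\<^sup>* 1\<close>,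
  where \<open>1\<close> is terminal in \<open>F\<close>.  As \<open>f'\<^sup>* 1\<close> is terminal, the fiber over \<open>1\<close> is \<open>E'\<close> itself.  A vertical
  transformation is therefore determined by its components over \<open>1\<close>, which form a transformation
  \<open>\<theta>\<close> from \<open>a\<^sup>*\<close> to \<open>c\<^sup>*\<close>; that the component at the identity of \<open>f'\<^sup>* b\<close> is an arrow over \<open>f\<^sup>* b\<close> is the compatibility of
  \<open>\<theta>\<close> with the structure isomorphisms (\<open>fully_faithful_stack_functor\<close>).

  Conversely let \<open>A\<close> be a morphism of opfibrations.  Its functor over \<open>1\<close> is a left adjoint \<open>a\<^sup>*\<close> from \<open>E'\<close>
  to \<open>E\<close>, and the comparison cell of \<open>A\<close> along \<open>b \<rightarrow> 1\<close> at \<open>x\<close> is an isomorphism \<open>\<kappa> b x\<close> from the domain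
  of \<open>A x\<close> to \<open>a\<^sup>* X\<close>.  With \<open>\<phi> b = A (id) \<circ> (\<kappa> b id)\<^sup>-\<^sup>1\<close>, naturality of the cells gives
  \<open>A x = \<phi> b \<circ> a\<^sup>* x \<circ> \<kappa> b x\<close> (\<open>fo_factor\<close>), so that the arrows \<open>\<kappa> b x\<close> form an isomorphism from \<open>A\<close> to the
  image of \<open>(a, \<phi>)\<close> (\<open>opfib_term_morphism_iso_stack_mor\<close>).

  The terminal object of \<open>F\<close>, which \<open>f\<^sup>*\<close> and \<open>f'\<^sup>*\<close> preserve, and the pullbacks of \<open>E'\<close> are constructed in
  categories of sheaves on a small site and transported along equivalences.
\<close>

section \<open>Arrows, functors and isomorphisms\<close>

abbreviation Cmp_infix :: "'m \<Rightarrow> ('o, 'm) cat \<Rightarrow> 'm \<Rightarrow> 'm"  ("(_ \<cdot>\<^bsub>_\<^esub> _)" [71, 0, 70] 70)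
  where "g \<cdot>\<^bsub>C\<^esub> f \<equiv> Cmp C g f"

lemma hom_Arr: "f \<in> hom C x y \<Longrightarrow> f \<in> Arr C"
  and hom_Dom: "f \<in> hom C x y \<Longrightarrow> Dom C f = x"
  and hom_Cod: "f \<in> hom C x y \<Longrightarrow> Cod C f = y"
  by (simp_all add: hom_def)

lemma Arr_hom: "f \<in> Arr C \<Longrightarrow> f \<in> hom C (Dom C f) (Cod C f)"
  by (simp add: hom_def)

context category
begin

lemma hom_obj_dom: "f \<in> hom C x y \<Longrightarrow> x \<in> Obj C"
  using Dom_in by (auto simp: hom_def)

lemma hom_obj_cod: "f \<in> hom C x y \<Longrightarrow> y \<in> Obj C"
  using Cod_in by (auto simp: hom_def)

end

definition inv_arr :: "('o, 'm) cat \<Rightarrow> 'm \<Rightarrow> 'm" where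
  "inv_arr C u = (SOME g. g \<in> hom C (Cod C u) (Dom C u) \<and>
     g \<cdot>\<^bsub>C\<^esub> u = Idt C (Dom C u) \<and> u \<cdot>\<^bsub>C\<^esub> g = Idt C (Cod C u))"

lemma inv_arr:
  assumes "iso_arr C u" "u \<in> hom C x y"
  shows inv_arr_hom: "inv_arr C u \<in> hom C y x"
    and inv_arr_left: "inv_arr C u \<cdot>\<^bsub>C\<^esub> u = Idt C x"
    and inv_arr_right: "u \<cdot>\<^bsub>C\<^esub> inv_arr C u = Idt C y"
proof -
  have "\<exists>g. g \<in> hom C (Cod C u) (Dom C u) \<and>
     g \<cdot>\<^bsub>C\<^esub> u = Idt C (Dom C u) \<and> u \<cdot>\<^bsub>C\<^esub> g = Idt C (Cod C u)"
    using assms(1) unfolding iso_arr_def by blast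
  from someI_ex[OF this, folded inv_arr_def] assms(2)
  show "inv_arr C u \<in> hom C y x" "inv_arr C u \<cdot>\<^bsub>C\<^esub> u = Idt C x"
    "u \<cdot>\<^bsub>C\<^esub> inv_arr C u = Idt C y"
    by (simp_all add: hom_Dom hom_Cod)
qed

lemma iso_arrI:
  assumes "u \<in> hom C x y" "g \<in> hom C y x" "g \<cdot>\<^bsub>C\<^esub> u = Idt C x" "u \<cdot>\<^bsub>C\<^esub> g = Idt C y"
  shows "iso_arr C u"
  using assms unfolding iso_arr_def hom_Dom[OF assms(1)] hom_Cod[OF assms(1)]
  by (blast dest: hom_Arr)

context category
begin

lemma iso_inv_arr: "iso_arr C u \<Longrightarrow> u \<in> hom C x y \<Longrightarrow> iso_arr C (inv_arr C u)"
  by (rule iso_arrI[OF inv_arr_hom _ inv_arr_right inv_arr_left])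

lemma iso_Idt: "x \<in> Obj C \<Longrightarrow> iso_arr C (Idt C x)"
  by (rule iso_arrI[OF Idt_in Idt_in Cmp_Idt_left[OF Idt_in] Cmp_Idt_left[OF Idt_in]])

lemma cancel_inv_left:
  assumes "iso_arr C u" "u \<in> hom C y z" "h \<in> hom C x y"
  shows "inv_arr C u \<cdot>\<^bsub>C\<^esub> (u \<cdot>\<^bsub>C\<^esub> h) = h"
  using inv_arr[OF assms(1,2)] by (simp add: Cmp_assoc[OF assms(3,2)] Cmp_Idt_left[OF assms(3)])

lemma cancel_inv_left':
  assumes "iso_arr C u" "u \<in> hom C y z" "h \<in> hom C x z"
  shows "u \<cdot>\<^bsub>C\<^esub> (inv_arr C u \<cdot>\<^bsub>C\<^esub> h) = h"
  using inv_arr[OF assms(1,2)]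
  by (simp add: Cmp_assoc[OF assms(3) inv_arr_hom[OF assms(1,2)] assms(2)] Cmp_Idt_left[OF assms(3)])

lemma cancel_inv_right:
  assumes "iso_arr C u" "u \<in> hom C x y" "h \<in> hom C y z"
  shows "(h \<cdot>\<^bsub>C\<^esub> u) \<cdot>\<^bsub>C\<^esub> inv_arr C u = h"
  using inv_arr[OF assms(1,2)]
  by (simp add: Cmp_assoc[OF inv_arr_hom[OF assms(1,2)] assms(2,3), symmetric] Cmp_Idt_right[OF assms(3)])

lemma cancel_inv_right':
  assumes "iso_arr C u" "u \<in> hom C x y" "h \<in> hom C x z"
  shows "(h \<cdot>\<^bsub>C\<^esub> inv_arr C u) \<cdot>\<^bsub>C\<^esub> u = h"
  using inv_arr[OF assms(1,2)]
  by (simp add: Cmp_assoc[OF assms(2) inv_arr_hom[OF assms(1,2)] assms(3), symmetric] Cmp_Idt_right[OF assms(3)])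

lemma iso_epic:
  assumes "iso_arr C u" "u \<in> hom C x y" "h \<in> hom C y z" "k \<in> hom C y z"
    and "h \<cdot>\<^bsub>C\<^esub> u = k \<cdot>\<^bsub>C\<^esub> u"
  shows "h = k"
  using cancel_inv_right[OF assms(1,2,3)] cancel_inv_right[OF assms(1,2,4)] unfolding assms(5)
  by (rule trans[OF sym])

lemma iso_Cmp:
  assumes u: "iso_arr C u" "u \<in> hom C x y" and v: "iso_arr C v" "v \<in> hom C y z"
  shows "iso_arr C (v \<cdot>\<^bsub>C\<^esub> u)"
proof (rule iso_arrI)
  note iu = inv_arr_hom[OF u] and iv = inv_arr_hom[OF v]
  note vu = Cmp_in[OF u(2) v(2)] and uv = Cmp_in[OF iv iu]
  show "v \<cdot>\<^bsub>C\<^esub> u \<in> hom C x z" "inv_arr C u \<cdot>\<^bsub>C\<^esub> inv_arr C v \<in> hom C z x"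
    using vu uv .
  show "(inv_arr C u \<cdot>\<^bsub>C\<^esub> inv_arr C v) \<cdot>\<^bsub>C\<^esub> (v \<cdot>\<^bsub>C\<^esub> u) = Idt C x"
    by (simp add: Cmp_assoc[OF vu iv iu, symmetric] cancel_inv_left[OF v u(2)] inv_arr_left[OF u])
  show "(v \<cdot>\<^bsub>C\<^esub> u) \<cdot>\<^bsub>C\<^esub> (inv_arr C u \<cdot>\<^bsub>C\<^esub> inv_arr C v) = Idt C z"
    by (simp add: Cmp_assoc[OF uv u(2) v(2), symmetric] cancel_inv_left'[OF u iv] inv_arr_right[OF v])
qed

end

lemma terminal_obj: "terminal C t \<Longrightarrow> t \<in> Obj C"
  by (simp add: terminal_def)

lemma terminal_ex: "terminal C t \<Longrightarrow> x \<in> Obj C \<Longrightarrow> \<exists>u. u \<in> hom C x t"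
  unfolding terminal_def by blast

lemma (in category) terminal_eq:
  "terminal C t \<Longrightarrow> u \<in> hom C x t \<Longrightarrow> v \<in> hom C x t \<Longrightarrow> u = v"
  unfolding terminal_def using hom_obj_dom by blast

lemma
  assumes "is_functor C D T"
  shows functor_dom_cat: "category C" and functor_cod_cat: "category D"
    and functor_obj: "x \<in> Obj C \<Longrightarrow> omap T x \<in> Obj D"
    and functor_hom: "u \<in> hom C x y \<Longrightarrow> amap T u \<in> hom D (omap T x) (omap T y)"
    and functor_Idt: "x \<in> Obj C \<Longrightarrow> amap T (Idt C x) = Idt D (omap T x)"
    and functor_Cmp: "u \<in> hom C x y \<Longrightarrow> v \<in> hom C y z \<Longrightarrow>
      amap T (v \<cdot>\<^bsub>C\<^esub> u) = amap T v \<cdot>\<^bsub>D\<^esub> amap T u"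
  using assms unfolding is_functor_def hom_def by (simp_all add: PiE_def Pi_def)

lemma is_functorI:
  assumes "category C" "category D"
    and "omap T \<in> extensional (Obj C)" "amap T \<in> extensional (Arr C)"
    and "\<And>x. x \<in> Obj C \<Longrightarrow> omap T x \<in> Obj D"
    and "\<And>u x y. u \<in> hom C x y \<Longrightarrow> amap T u \<in> hom D (omap T x) (omap T y)"
    and "\<And>x. x \<in> Obj C \<Longrightarrow> amap T (Idt C x) = Idt D (omap T x)"
    and "\<And>u v x y z. u \<in> hom C x y \<Longrightarrow> v \<in> hom C y z \<Longrightarrow>
      amap T (v \<cdot>\<^bsub>C\<^esub> u) = amap T v \<cdot>\<^bsub>D\<^esub> amap T u"
  shows "is_functor C D T"
  unfolding is_functor_def
proof (intro conjI ballI impI)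
  show "omap T \<in> Obj C \<rightarrow>\<^sub>E Obj D" "amap T \<in> Arr C \<rightarrow>\<^sub>E Arr D"
    using assms(3-5) assms(6)[OF Arr_hom] by (auto simp: hom_def PiE_def)
next
  fix u assume "u \<in> Arr C"
  from assms(6)[OF Arr_hom[OF this]]
  show "Dom D (amap T u) = omap T (Dom C u)" "Cod D (amap T u) = omap T (Cod C u)"
    by (simp_all add: hom_def)
next
  fix u v assume "u \<in> Arr C" "v \<in> Arr C" "Cod C u = Dom C v"
  then show "amap T (v \<cdot>\<^bsub>C\<^esub> u) = amap T v \<cdot>\<^bsub>D\<^esub> amap T u"
    using assms(8)[of u "Dom C u" "Dom C v" v "Cod C v"] by (simp add: hom_def)
qed (use assms in auto)

lemma functor_iso:
  assumes T: "is_functor C D T" and u: "iso_arr C u" "u \<in> hom C x y"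
  shows "iso_arr D (amap T u)"
proof (rule iso_arrI)
  interpret C: category C using functor_dom_cat[OF T] .
  note h = inv_arr[OF u]
  show "amap T u \<in> hom D (omap T x) (omap T y)"
    "amap T (inv_arr C u) \<in> hom D (omap T y) (omap T x)"
    using functor_hom[OF T] u h by auto
  show "amap T (inv_arr C u) \<cdot>\<^bsub>D\<^esub> amap T u = Idt D (omap T x)"
    "amap T u \<cdot>\<^bsub>D\<^esub> amap T (inv_arr C u) = Idt D (omap T y)"
    using functor_Cmp[OF T u(2) h(1)] functor_Cmp[OF T h(1) u(2)]
    by (simp_all add: h functor_Idt[OF T] C.hom_obj_dom[OF u(2)] C.hom_obj_cod[OF u(2)])
qed

lemma omap_id_functor [simp]: "x \<in> Obj C \<Longrightarrow> omap (id_functor C) x = x"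
  and amap_id_functor [simp]: "u \<in> Arr C \<Longrightarrow> amap (id_functor C) u = u"
  by (simp_all add: id_functor_def)

lemma omap_comp_functor [simp]: "x \<in> Obj C \<Longrightarrow> omap (comp_functor C G F) x = omap G (omap F x)"
  and amap_comp_functor [simp]: "u \<in> Arr C \<Longrightarrow> amap (comp_functor C G F) u = amap G (amap F u)"
  by (simp_all add: comp_functor_def compose_eq)

lemma is_functor_id: "category C \<Longrightarrow> is_functor C C (id_functor C)"
proof (rule is_functorI)
  assume "category C"
  then interpret C: category C .
  show "category C" "category C" by (rule C.category_axioms)+
  show "amap (id_functor C) u \<in> hom C (omap (id_functor C) x) (omap (id_functor C) y)"
    if "u \<in> hom C x y" for u x y
    using that by (simp add: hom_Arr[OF that] C.hom_obj_dom[OF that] C.hom_obj_cod[OF that])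
  show "amap (id_functor C) (Idt C x) = Idt C (omap (id_functor C) x)" if "x \<in> Obj C" for x
    using that by (simp add: hom_Arr[OF C.Idt_in[OF that]])
  show "amap (id_functor C) (v \<cdot>\<^bsub>C\<^esub> u) = amap (id_functor C) v \<cdot>\<^bsub>C\<^esub> amap (id_functor C) u"
    if "u \<in> hom C x y" "v \<in> hom C y z" for u v x y z
    by (simp add: hom_Arr[OF that(1)] hom_Arr[OF that(2)] hom_Arr[OF C.Cmp_in[OF that]])
qed (simp_all add: id_functor_def)

lemma is_functor_comp:
  assumes F: "is_functor C D F" and G: "is_functor D E G"
  shows "is_functor C E (comp_functor C G F)"
proof (rule is_functorI)
  interpret C: category C using functor_dom_cat[OF F] .
  show "category C" "category E"
    using functor_dom_cat[OF F] functor_cod_cat[OF G] .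
  show "omap (comp_functor C G F) \<in> extensional (Obj C)"
    "amap (comp_functor C G F) \<in> extensional (Arr C)"
    by (simp_all add: comp_functor_def)
  show "x \<in> Obj C \<Longrightarrow> omap (comp_functor C G F) x \<in> Obj E" for x
    by (simp add: functor_obj[OF F] functor_obj[OF G])
  show "amap (comp_functor C G F) u
      \<in> hom E (omap (comp_functor C G F) x) (omap (comp_functor C G F) y)"
    if "u \<in> hom C x y" for u x y
    using functor_hom[OF G functor_hom[OF F that]] that
    by (simp add: hom_Arr C.hom_obj_dom C.hom_obj_cod)
  show "amap (comp_functor C G F) (Idt C x) = Idt E (omap (comp_functor C G F) x)"
    if "x \<in> Obj C" for x
    using that by (simp add: hom_Arr[OF C.Idt_in] functor_Idt[OF F] functor_Idt[OF G] functor_obj[OF F])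
  show "amap (comp_functor C G F) (v \<cdot>\<^bsub>C\<^esub> u) =
      amap (comp_functor C G F) v \<cdot>\<^bsub>E\<^esub> amap (comp_functor C G F) u"
    if "u \<in> hom C x y" "v \<in> hom C y z" for u v x y z
    using that by (simp add: hom_Arr[OF C.Cmp_in[OF that]] hom_Arr functor_Cmp[OF F]
        functor_Cmp[OF G functor_hom[OF F] functor_hom[OF F]])
qed

lemma
  assumes "nat_trans C D S T \<tau>"
  shows nat_trans_dom: "is_functor C D S" and nat_trans_cod: "is_functor C D T"
    and nat_trans_ext: "\<tau> \<in> extensional (Obj C)"
    and nat_trans_hom: "x \<in> Obj C \<Longrightarrow> \<tau> x \<in> hom D (omap S x) (omap T x)"
    and nat_trans_natural: "u \<in> hom C x y \<Longrightarrow> \<tau> y \<cdot>\<^bsub>D\<^esub> amap S u = amap T u \<cdot>\<^bsub>D\<^esub> \<tau> x"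
  using assms unfolding nat_trans_def hom_def by auto

lemma nat_transI:
  assumes "is_functor C D S" "is_functor C D T" "\<tau> \<in> extensional (Obj C)"
    and "\<And>x. x \<in> Obj C \<Longrightarrow> \<tau> x \<in> hom D (omap S x) (omap T x)"
    and "\<And>u x y. u \<in> hom C x y \<Longrightarrow> \<tau> y \<cdot>\<^bsub>D\<^esub> amap S u = amap T u \<cdot>\<^bsub>D\<^esub> \<tau> x"
  shows "nat_trans C D S T \<tau>"
  using assms(1-4) assms(5)[OF Arr_hom] unfolding nat_trans_def by simp

lemma nat_iso_trans: "nat_iso C D S T \<tau> \<Longrightarrow> nat_trans C D S T \<tau>"
  and nat_iso_iso: "nat_iso C D S T \<tau> \<Longrightarrow> x \<in> Obj C \<Longrightarrow> iso_arr D (\<tau> x)"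
  by (simp_all add: nat_iso_def)

lemma nat_trans_Idt:
  assumes "is_functor C D S"
  shows "nat_trans C D S S (\<lambda>x \<in> Obj C. Idt D (omap S x))"
proof -
  interpret C: category C using functor_dom_cat[OF assms] .
  interpret D: category D using functor_cod_cat[OF assms] .
  show ?thesis
    by (rule nat_transI) (use assms in \<open>auto simp: D.Idt_in functor_obj[OF assms]
        C.hom_obj_dom C.hom_obj_cod D.Cmp_Idt_left[OF functor_hom[OF assms]]
        D.Cmp_Idt_right[OF functor_hom[OF assms]]\<close>)
qed

lemma nat_trans_Cmp:
  assumes s: "nat_trans C D S T \<sigma>" and t: "nat_trans C D T U \<tau>"
  shows "nat_trans C D S U (\<lambda>x \<in> Obj C. \<tau> x \<cdot>\<^bsub>D\<^esub> \<sigma> x)"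
proof (rule nat_transI)
  interpret C: category C using functor_dom_cat[OF nat_trans_dom[OF s]] .
  interpret D: category D using functor_cod_cat[OF nat_trans_dom[OF s]] .
  show "is_functor C D S" "is_functor C D U" using nat_trans_dom[OF s] nat_trans_cod[OF t] .
  show "(\<lambda>x \<in> Obj C. \<tau> x \<cdot>\<^bsub>D\<^esub> \<sigma> x) x \<in> hom D (omap S x) (omap U x)" if "x \<in> Obj C" for x
    using that D.Cmp_in[OF nat_trans_hom[OF s] nat_trans_hom[OF t]] by simp
  fix u x y assume u: "u \<in> hom C x y"
  note x = C.hom_obj_dom[OF u] note y = C.hom_obj_cod[OF u]
  note h = nat_trans_hom[OF s x] nat_trans_hom[OF s y] nat_trans_hom[OF t x] nat_trans_hom[OF t y]
    functor_hom[OF nat_trans_dom[OF s] u] functor_hom[OF nat_trans_dom[OF t] u]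
    functor_hom[OF nat_trans_cod[OF t] u]
  have "(\<tau> y \<cdot>\<^bsub>D\<^esub> \<sigma> y) \<cdot>\<^bsub>D\<^esub> amap S u = \<tau> y \<cdot>\<^bsub>D\<^esub> (amap T u \<cdot>\<^bsub>D\<^esub> \<sigma> x)"
    using h by (simp add: D.Cmp_assoc[symmetric] nat_trans_natural[OF s u])
  also have "\<dots> = amap U u \<cdot>\<^bsub>D\<^esub> (\<tau> x \<cdot>\<^bsub>D\<^esub> \<sigma> x)"
    using h by (simp add: D.Cmp_assoc nat_trans_natural[OF t u])
  finally show "(\<lambda>x \<in> Obj C. \<tau> x \<cdot>\<^bsub>D\<^esub> \<sigma> x) y \<cdot>\<^bsub>D\<^esub> amap S u =
      amap U u \<cdot>\<^bsub>D\<^esub> (\<lambda>x \<in> Obj C. \<tau> x \<cdot>\<^bsub>D\<^esub> \<sigma> x) x"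
    using x y by simp
qed simp

lemma nat_trans_inverse:
  assumes "nat_trans C D S T \<tau>" and iso: "\<And>x. x \<in> Obj C \<Longrightarrow> iso_arr D (\<tau> x)"
  shows "nat_trans C D T S (\<lambda>x \<in> Obj C. inv_arr D (\<tau> x))"
proof (rule nat_transI)
  interpret C: category C using functor_dom_cat[OF nat_trans_dom[OF assms(1)]] .
  interpret D: category D using functor_cod_cat[OF nat_trans_dom[OF assms(1)]] .
  note t = assms(1)
  show "is_functor C D T" "is_functor C D S" using nat_trans_dom[OF t] nat_trans_cod[OF t] by auto
  show "(\<lambda>x \<in> Obj C. inv_arr D (\<tau> x)) x \<in> hom D (omap T x) (omap S x)" if "x \<in> Obj C" for x
    using that inv_arr_hom[OF iso[OF that] nat_trans_hom[OF t that]] by simp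
  fix u x y assume u: "u \<in> hom C x y"
  note x = C.hom_obj_dom[OF u] note y = C.hom_obj_cod[OF u]
  note h = nat_trans_hom[OF t x] nat_trans_hom[OF t y]
    functor_hom[OF nat_trans_dom[OF t] u] functor_hom[OF nat_trans_cod[OF t] u]
    inv_arr[OF iso[OF x] nat_trans_hom[OF t x]] inv_arr[OF iso[OF y] nat_trans_hom[OF t y]]
  have "inv_arr D (\<tau> y) \<cdot>\<^bsub>D\<^esub> amap T u =
      inv_arr D (\<tau> y) \<cdot>\<^bsub>D\<^esub> ((amap T u \<cdot>\<^bsub>D\<^esub> \<tau> x) \<cdot>\<^bsub>D\<^esub> inv_arr D (\<tau> x))"
    using D.cancel_inv_right[OF iso[OF x] h(1) h(4)] by simp
  also have "\<dots> = amap S u \<cdot>\<^bsub>D\<^esub> inv_arr D (\<tau> x)"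
    unfolding nat_trans_natural[OF t u, symmetric]
    by (simp add: D.Cmp_assoc[OF h(5,3,2), symmetric]
        D.cancel_inv_left[OF iso[OF y] h(2) D.Cmp_in[OF h(5,3)]])
  finally show "(\<lambda>x \<in> Obj C. inv_arr D (\<tau> x)) y \<cdot>\<^bsub>D\<^esub> amap T u =
      amap S u \<cdot>\<^bsub>D\<^esub> (\<lambda>x \<in> Obj C. inv_arr D (\<tau> x)) x"
    using x y by simp
qed simp

section \<open>Categories of transformations\<close>

lemma Arr_transformation_cat:
  "(k, \<tau>, l) \<in> Arr (transformation_cat X Y K U P) \<longleftrightarrow>
     k \<in> K \<and> l \<in> K \<and> nat_trans X Y (U k) (U l) \<tau> \<and> P k \<tau> l"
  by (simp add: transformation_cat_def)

lemma hom_transformation_cat: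
  "t \<in> hom (transformation_cat X Y K U P) k l \<longleftrightarrow>
     (\<exists>\<tau>. t = (k, \<tau>, l) \<and> k \<in> K \<and> l \<in> K \<and> nat_trans X Y (U k) (U l) \<tau> \<and> P k \<tau> l)"
  by (auto simp: transformation_cat_def hom_def)

lemma transformation_cat_simps [simp]:
  "Obj (transformation_cat X Y K U P) = K"
  "Dom (transformation_cat X Y K U P) (k, \<tau>, l) = k"
  "Cod (transformation_cat X Y K U P) (k, \<tau>, l) = l"
  "Idt (transformation_cat X Y K U P) k = (k, \<lambda>x \<in> Obj X. Idt Y (omap (U k) x), k)"
  "(l', \<tau>', m) \<cdot>\<^bsub>transformation_cat X Y K U P\<^esub> (k, \<tau>, l) = (k, \<lambda>x \<in> Obj X. \<tau>' x \<cdot>\<^bsub>Y\<^esub> \<tau> x, m)"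
  by (simp_all add: transformation_cat_def)

lemma category_transformation_cat:
  assumes U: "\<And>k. k \<in> K \<Longrightarrow> is_functor X Y (U k)"
    and PI: "\<And>k. k \<in> K \<Longrightarrow> P k (\<lambda>x \<in> Obj X. Idt Y (omap (U k) x)) k"
    and PC: "\<And>k l m \<sigma> \<tau>. k \<in> K \<Longrightarrow> l \<in> K \<Longrightarrow> m \<in> K \<Longrightarrow> nat_trans X Y (U k) (U l) \<sigma> \<Longrightarrow>
      nat_trans X Y (U l) (U m) \<tau> \<Longrightarrow> P k \<sigma> l \<Longrightarrow> P l \<tau> m \<Longrightarrow>
      P k (\<lambda>x \<in> Obj X. \<tau> x \<cdot>\<^bsub>Y\<^esub> \<sigma> x) m"
  shows "category (transformation_cat X Y K U P)" (is "category ?C")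
proof
  fix t assume t: "t \<in> Arr ?C"
  then show "Dom ?C t \<in> Obj ?C" "Cod ?C t \<in> Obj ?C"
    by (cases t; simp add: Arr_transformation_cat)+
next
  show "k \<in> Obj ?C \<Longrightarrow> Idt ?C k \<in> hom ?C k k" for k
    by (simp add: hom_transformation_cat nat_trans_Idt U PI)
next
  show "t \<cdot>\<^bsub>?C\<^esub> s \<in> hom ?C k m" if "s \<in> hom ?C k l" "t \<in> hom ?C l m" for s t k l m
    using that by (auto simp: hom_transformation_cat intro: nat_trans_Cmp PC)
next
  fix t k l assume t: "t \<in> hom ?C k l"
  then obtain \<tau> where tau: "t = (k, \<tau>, l)" "nat_trans X Y (U k) (U l) \<tau>" and kl: "k \<in> K"
    by (auto simp: hom_transformation_cat)
  interpret Y: category Y using functor_cod_cat[OF nat_trans_dom[OF tau(2)]] .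
  have "(\<lambda>x \<in> Obj X. \<tau> x \<cdot>\<^bsub>Y\<^esub> Idt Y (omap (U k) x)) = \<tau>"
    "(\<lambda>x \<in> Obj X. Idt Y (omap (U l) x) \<cdot>\<^bsub>Y\<^esub> \<tau> x) = \<tau>"
    using nat_trans_ext[OF tau(2)] Y.Cmp_Idt_right[OF nat_trans_hom[OF tau(2)]]
      Y.Cmp_Idt_left[OF nat_trans_hom[OF tau(2)]]
    by (auto intro!: extensionalityI[of _ "Obj X"])
  then show "t \<cdot>\<^bsub>?C\<^esub> Idt ?C k = t" "Idt ?C l \<cdot>\<^bsub>?C\<^esub> t = t"
    unfolding tau(1) by (simp_all add: restrict_def cong: if_cong)
next
  fix r s t j k l m assume "r \<in> hom ?C j k" "s \<in> hom ?C k l" "t \<in> hom ?C l m"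
  then obtain \<rho> \<sigma> \<tau> where eq: "r = (j, \<rho>, k)" "s = (k, \<sigma>, l)" "t = (l, \<tau>, m)"
    and n: "nat_trans X Y (U j) (U k) \<rho>" "nat_trans X Y (U k) (U l) \<sigma>" "nat_trans X Y (U l) (U m) \<tau>"
    by (auto simp: hom_transformation_cat)
  interpret Y: category Y using functor_cod_cat[OF nat_trans_dom[OF n(1)]] .
  show "t \<cdot>\<^bsub>?C\<^esub> (s \<cdot>\<^bsub>?C\<^esub> r) = (t \<cdot>\<^bsub>?C\<^esub> s) \<cdot>\<^bsub>?C\<^esub> r"
    unfolding eq by (auto simp: restrict_def intro!: ext
        Y.Cmp_assoc[OF nat_trans_hom[OF n(1)] nat_trans_hom[OF n(2)] nat_trans_hom[OF n(3)]])
qed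

text \<open>
  The inverse is computed pointwise, so the only thing to ask for is that the side condition \<open>P\<close>
  holds for the pointwise inverse as well.
\<close>

lemma iso_transformation_cat:
  assumes k: "k \<in> K" and l: "l \<in> K" and t: "nat_trans X Y (U k) (U l) \<tau>"
    and iso: "\<And>x. x \<in> Obj X \<Longrightarrow> iso_arr Y (\<tau> x)"
    and P: "P k \<tau> l" "P l (\<lambda>x \<in> Obj X. inv_arr Y (\<tau> x)) k"
  shows "iso_arr (transformation_cat X Y K U P) (k, \<tau>, l)"
proof (rule iso_arrI)
  show "(k, \<tau>, l) \<in> hom (transformation_cat X Y K U P) k l"
    "(l, \<lambda>x \<in> Obj X. inv_arr Y (\<tau> x), k) \<in> hom (transformation_cat X Y K U P) l k"
    using assms nat_trans_inverse[OF t iso] by (simp_all add: hom_transformation_cat)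
qed (simp_all add: inv_arr_left[OF iso nat_trans_hom[OF t]] inv_arr_right[OF iso nat_trans_hom[OF t]]
    cong: restrict_cong)

section \<open>Equivalences of categories\<close>

definition fully_faithful ::
  "('o1, 'm1) cat \<Rightarrow> ('o2, 'm2) cat \<Rightarrow> ('o1, 'm1, 'o2, 'm2) ftor \<Rightarrow> bool" where
  "fully_faithful C D T \<longleftrightarrow> (\<forall>x \<in> Obj C. \<forall>y \<in> Obj C.
     bij_betw (amap T) (hom C x y) (hom D (omap T x) (omap T y)))"

definition essentially_surjective ::
  "('o1, 'm1) cat \<Rightarrow> ('o2, 'm2) cat \<Rightarrow> ('o1, 'm1, 'o2, 'm2) ftor \<Rightarrow> bool" where
  "essentially_surjective C D T \<longleftrightarrow>
     (\<forall>y \<in> Obj D. \<exists>x \<in> Obj C. \<exists>i \<in> hom D y (omap T x). iso_arr D i)"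

lemma fully_faithfulI:
  assumes T: "is_functor C D T"
    and inj: "\<And>x y u v. u \<in> hom C x y \<Longrightarrow> v \<in> hom C x y \<Longrightarrow> amap T u = amap T v \<Longrightarrow> u = v"
    and surj: "\<And>x y h. x \<in> Obj C \<Longrightarrow> y \<in> Obj C \<Longrightarrow> h \<in> hom D (omap T x) (omap T y) \<Longrightarrow>
      \<exists>u \<in> hom C x y. amap T u = h"
  shows "fully_faithful C D T"
  unfolding fully_faithful_def bij_betw_def inj_on_def
  using inj surj functor_hom[OF T] by (auto simp: image_iff) metis

lemma fully_faithful_eq:
  assumes "fully_faithful C D T" "category C"
    and "u \<in> hom C x y" "v \<in> hom C x y" "amap T u = amap T v"
  shows "u = v"
  using assms category.hom_obj_dom[OF assms(2,3)] category.hom_obj_cod[OF assms(2,3)]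
  unfolding fully_faithful_def bij_betw_def inj_on_def by blast

lemma fully_faithful_ex:
  assumes "fully_faithful C D T" "x \<in> Obj C" "y \<in> Obj C" "h \<in> hom D (omap T x) (omap T y)"
  shows "\<exists>u \<in> hom C x y. amap T u = h"
proof -
  have "h \<in> amap T ` hom C x y"
    using assms unfolding fully_faithful_def bij_betw_def by blast
  then show ?thesis by blast
qed

text \<open>
  A quasi-inverse \<open>H\<close> sends an object to a chosen preimage up to isomorphism, and an arrow to the
  unique lift of its conjugate by the chosen isomorphisms.  The functor laws of \<open>H\<close> and the
  naturality of the two transformations are then checked after applying the faithful functor \<open>G\<close>.
\<close>

lemma equivalent_categories_ff_es:
  assumes G: "is_functor D C G" and ff: "fully_faithful D C G" and es: "essentially_surjective D C G"
  shows "equivalent_categories C D"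
proof -
  interpret D: category D using functor_dom_cat[OF G] .
  interpret C: category C using functor_cod_cat[OF G] .
  have "\<forall>c. \<exists>d i. c \<in> Obj C \<longrightarrow> d \<in> Obj D \<and> i \<in> hom C c (omap G d) \<and> iso_arr C i"
    using es unfolding essentially_surjective_def by blast
  then obtain H0 \<iota> where H0: "\<And>c. c \<in> Obj C \<Longrightarrow> H0 c \<in> Obj D"
    and io: "\<And>c. c \<in> Obj C \<Longrightarrow> \<iota> c \<in> hom C c (omap G (H0 c))"
    and iso: "\<And>c. c \<in> Obj C \<Longrightarrow> iso_arr C (\<iota> c)"
    by metis
  note inv_io = inv_arr_hom[OF iso io]
  define conj where "conj h = (\<iota> (Cod C h) \<cdot>\<^bsub>C\<^esub> h) \<cdot>\<^bsub>C\<^esub> inv_arr C (\<iota> (Dom C h))" for h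
  have conj_hom: "conj h \<in> hom C (omap G (H0 x)) (omap G (H0 y))" if "h \<in> hom C x y" for h x y
    unfolding conj_def using that io inv_io C.hom_obj_dom[OF that] C.hom_obj_cod[OF that]
    by (auto simp: hom_Dom[OF that] hom_Cod[OF that] intro!: C.Cmp_in)
  have "\<forall>h. \<exists>k. h \<in> Arr C \<longrightarrow> k \<in> hom D (H0 (Dom C h)) (H0 (Cod C h)) \<and> amap G k = conj h"
    using fully_faithful_ex[OF ff H0 H0 conj_hom[OF Arr_hom]] C.Dom_in C.Cod_in by blast
  then obtain H1 where H1: "\<And>h. h \<in> Arr C \<Longrightarrow> H1 h \<in> hom D (H0 (Dom C h)) (H0 (Cod C h))"
    and GH1: "\<And>h. h \<in> Arr C \<Longrightarrow> amap G (H1 h) = conj h"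
    by metis
  have H1_hom: "H1 h \<in> hom D (H0 x) (H0 y)" if "h \<in> hom C x y" for h x y
    using H1 that by (auto simp: hom_def)
  have nat: "amap G (H1 h) \<cdot>\<^bsub>C\<^esub> \<iota> x = \<iota> y \<cdot>\<^bsub>C\<^esub> h" if h: "h \<in> hom C x y" for h x y
    unfolding GH1[OF hom_Arr[OF h]] conj_def hom_Dom[OF h] hom_Cod[OF h]
    using C.cancel_inv_right'[OF iso io C.Cmp_in[OF h io]] C.hom_obj_dom[OF h] C.hom_obj_cod[OF h]
    by simp
  \<comment> \<open>An arrow of \<open>D\<close> that satisfies the naturality square of \<open>h\<close> is the value of \<open>H\<close> at \<open>h\<close>.\<close>
  have uniq: "H1 h = k" if h: "h \<in> hom C x y" and k: "k \<in> hom D (H0 x) (H0 y)"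
    and eq: "amap G k \<cdot>\<^bsub>C\<^esub> \<iota> x = \<iota> y \<cdot>\<^bsub>C\<^esub> h" for h k x y
    by (rule fully_faithful_eq[OF ff D.category_axioms H1_hom[OF h] k],
        rule C.iso_epic[OF iso io functor_hom[OF G H1_hom[OF h]] functor_hom[OF G k]])
      (simp_all add: C.hom_obj_dom[OF h] eq nat[OF h])
  define H :: "('c, 'd, 'a, 'b) ftor" where "H = \<lparr>omap = restrict H0 (Obj C), amap = restrict H1 (Arr C)\<rparr>"
  have H_o: "omap H c = H0 c" if "c \<in> Obj C" for c using that by (simp add: H_def)
  have H_a: "amap H h = H1 h" if "h \<in> Arr C" for h using that by (simp add: H_def)
  have H: "is_functor C D H"
  proof (rule is_functorI)
    show "omap H \<in> extensional (Obj C)" "amap H \<in> extensional (Arr C)"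
      by (simp_all add: H_def)
    show "amap H u \<in> hom D (omap H x) (omap H y)" if "u \<in> hom C x y" for u x y
      using H1_hom[OF that] by (simp add: H_o H_a hom_Arr[OF that] C.hom_obj_dom[OF that] C.hom_obj_cod[OF that])
    show "amap H (Idt C x) = Idt D (omap H x)" if x: "x \<in> Obj C" for x
    proof -
      have "H1 (Idt C x) = Idt D (H0 x)"
        by (rule uniq[OF C.Idt_in[OF x] D.Idt_in[OF H0[OF x]]])
          (simp add: functor_Idt[OF G H0[OF x]] C.Cmp_Idt_left[OF io[OF x]] C.Cmp_Idt_right[OF io[OF x]])
      then show ?thesis using x by (simp add: H_o H_a hom_Arr[OF C.Idt_in])
    qed
    show "amap H (v \<cdot>\<^bsub>C\<^esub> u) = amap H v \<cdot>\<^bsub>D\<^esub> amap H u"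
      if u: "u \<in> hom C x y" and v: "v \<in> hom C y z" for u v x y z
    proof -
      note x = C.hom_obj_dom[OF u] note y = C.hom_obj_cod[OF u] note z = C.hom_obj_cod[OF v]
      note G' = functor_hom[OF G H1_hom]
      have "amap G (H1 v \<cdot>\<^bsub>D\<^esub> H1 u) \<cdot>\<^bsub>C\<^esub> \<iota> x = amap G (H1 v) \<cdot>\<^bsub>C\<^esub> (\<iota> y \<cdot>\<^bsub>C\<^esub> u)"
        by (simp add: functor_Cmp[OF G H1_hom[OF u] H1_hom[OF v]] nat[OF u, symmetric]
            C.Cmp_assoc[OF io[OF x] G'[OF u] G'[OF v]])
      also have "\<dots> = \<iota> z \<cdot>\<^bsub>C\<^esub> (v \<cdot>\<^bsub>C\<^esub> u)"
        by (simp add: C.Cmp_assoc[OF u io[OF y] G'[OF v]] nat[OF v] C.Cmp_assoc[OF u v io[OF z]])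
      finally have "H1 (v \<cdot>\<^bsub>C\<^esub> u) = H1 v \<cdot>\<^bsub>D\<^esub> H1 u"
        by (rule uniq[OF C.Cmp_in[OF u v] D.Cmp_in[OF H1_hom[OF u] H1_hom[OF v]]])
      then show ?thesis using hom_Arr[OF u] hom_Arr[OF v] hom_Arr[OF C.Cmp_in[OF u v]]
        by (simp add: H_a)
    qed
  qed (simp_all add: C.category_axioms D.category_axioms H_o H0)
  have eta: "nat_iso C C (id_functor C) (comp_functor C G H) (restrict \<iota> (Obj C))"
    unfolding nat_iso_def
  proof (intro conjI nat_transI)
    show "is_functor C C (id_functor C)" "is_functor C C (comp_functor C G H)"
      using is_functor_id[OF C.category_axioms] is_functor_comp[OF H G] .
    show "restrict \<iota> (Obj C) y \<cdot>\<^bsub>C\<^esub> amap (id_functor C) u =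
        amap (comp_functor C G H) u \<cdot>\<^bsub>C\<^esub> restrict \<iota> (Obj C) x" if u: "u \<in> hom C x y" for u x y
      using nat[OF u] by (simp add: H_a hom_Arr[OF u] C.hom_obj_dom[OF u] C.hom_obj_cod[OF u])
  qed (simp_all add: io H_o iso)
  define \<delta> where "\<delta> d = (SOME k. k \<in> hom D d (H0 (omap G d)) \<and> amap G k = \<iota> (omap G d))" for d
  have del: "\<delta> d \<in> hom D d (H0 (omap G d))" "amap G (\<delta> d) = \<iota> (omap G d)" if d: "d \<in> Obj D" for d
  proof -
    have "\<exists>k. k \<in> hom D d (H0 (omap G d)) \<and> amap G k = \<iota> (omap G d)"
      using fully_faithful_ex[OF ff d H0 io] functor_obj[OF G d] by auto
    from someI_ex[OF this, folded \<delta>_def]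
    show "\<delta> d \<in> hom D d (H0 (omap G d))" "amap G (\<delta> d) = \<iota> (omap G d)" by auto
  qed
  have del_iso: "iso_arr D (\<delta> d)" if d: "d \<in> Obj D" for d
  proof -
    note c = functor_obj[OF G d]
    note i = inv_arr[OF iso[OF c] io[OF c]]
    obtain k where k: "k \<in> hom D (H0 (omap G d)) d" "amap G k = inv_arr C (\<iota> (omap G d))"
      using fully_faithful_ex[OF ff H0[OF c] d i(1)] by auto
    show ?thesis
    proof (rule iso_arrI[OF del(1)[OF d] k(1)])
      show "k \<cdot>\<^bsub>D\<^esub> \<delta> d = Idt D d"
        by (rule fully_faithful_eq[OF ff D.category_axioms D.Cmp_in[OF del(1)[OF d] k(1)] D.Idt_in[OF d]])
          (simp add: functor_Cmp[OF G del(1)[OF d] k(1)] del(2)[OF d] k(2) i functor_Idt[OF G d])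
      show "\<delta> d \<cdot>\<^bsub>D\<^esub> k = Idt D (H0 (omap G d))"
        by (rule fully_faithful_eq[OF ff D.category_axioms D.Cmp_in[OF k(1) del(1)[OF d]] D.Idt_in[OF H0[OF c]]])
          (simp add: functor_Cmp[OF G k(1) del(1)[OF d]] del(2)[OF d] k(2) i functor_Idt[OF G H0[OF c]])
    qed
  qed
  have GH: "is_functor D D (comp_functor D H G)"
    using is_functor_comp[OF G H] .
  have "nat_trans D D (id_functor D) (comp_functor D H G) (restrict \<delta> (Obj D))"
  proof (rule nat_transI[OF is_functor_id[OF D.category_axioms] GH])
    fix u x y assume u: "u \<in> hom D x y"
    note x = D.hom_obj_dom[OF u] note y = D.hom_obj_cod[OF u]
    note Gu = functor_hom[OF G u]
    have "\<delta> y \<cdot>\<^bsub>D\<^esub> u = H1 (amap G u) \<cdot>\<^bsub>D\<^esub> \<delta> x"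
      by (rule fully_faithful_eq[OF ff D.category_axioms D.Cmp_in[OF u del(1)[OF y]]
            D.Cmp_in[OF del(1)[OF x] H1_hom[OF Gu]]])
        (simp add: functor_Cmp[OF G u del(1)[OF y]] functor_Cmp[OF G del(1)[OF x] H1_hom[OF Gu]]
          del(2) x y nat[OF Gu])
    then show "restrict \<delta> (Obj D) y \<cdot>\<^bsub>D\<^esub> amap (id_functor D) u =
        amap (comp_functor D H G) u \<cdot>\<^bsub>D\<^esub> restrict \<delta> (Obj D) x"
      using x y hom_Arr[OF u] hom_Arr[OF Gu] by (simp add: H_a)
  qed (simp_all add: del H_o functor_obj[OF G])
  from nat_trans_inverse[OF this]
  have co: "nat_iso D D (comp_functor D H G) (id_functor D) (\<lambda>d \<in> Obj D. inv_arr D (\<delta> d))"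
    unfolding nat_iso_def using del_iso D.iso_inv_arr[OF del_iso del(1)]
    by (simp cong: restrict_cong)
  show ?thesis
    unfolding equivalent_categories_def
  proof (intro conjI exI)
    show "category C" "category D" by (rule C.category_axioms, rule D.category_axioms)
  qed (rule H G eta co)+
qed

lemma faithful_if_iso_id:
  assumes n: "nat_trans C C S (id_functor C) \<sigma>" and iso: "\<And>x. x \<in> Obj C \<Longrightarrow> iso_arr C (\<sigma> x)"
    and u: "u \<in> hom C x y" and v: "v \<in> hom C x y" and eq: "amap S u = amap S v"
  shows "u = v"
proof -
  interpret C: category C using functor_dom_cat[OF nat_trans_dom[OF n]] .
  note x = C.hom_obj_dom[OF u]
  have "u \<cdot>\<^bsub>C\<^esub> \<sigma> x = v \<cdot>\<^bsub>C\<^esub> \<sigma> x"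
    using nat_trans_natural[OF n u] nat_trans_natural[OF n v] eq
    by (simp add: hom_Arr[OF u] hom_Arr[OF v])
  then show ?thesis
    by (rule C.iso_epic[OF iso[OF x] _ u v, rotated]) (use nat_trans_hom[OF n x] x in simp)
qed

text \<open>
  \<open>S\<close> is faithful since \<open>T S\<close> is isomorphic to the identity, and so is \<open>T\<close>, for the same reason.  For
  fullness, \<open>k : S x \<rightarrow> S y\<close> is lifted to the conjugate \<open>u\<close> of \<open>T k\<close> by \<open>\<eta>\<close>; naturality of \<open>\<eta>\<close> gives
  \<open>T (S u) = T k\<close>, and \<open>T\<close> is faithful.
\<close>

lemma equivalence_fully_faithful:
  assumes S: "is_functor C D S" and T: "is_functor D C T"
    and eta: "nat_iso C C (id_functor C) (comp_functor C T S) \<eta>"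
    and eps: "nat_iso D D (comp_functor D S T) (id_functor D) \<epsilon>"
  shows "fully_faithful C D S"
proof (rule fully_faithfulI[OF S])
  interpret C: category C using functor_dom_cat[OF S] .
  interpret D: category D using functor_cod_cat[OF S] .
  note h = nat_trans_hom[OF nat_iso_trans[OF eta]] and iso = nat_iso_iso[OF eta]
  have i: "nat_trans C C (comp_functor C T S) (id_functor C) (\<lambda>x \<in> Obj C. inv_arr C (\<eta> x))"
    using nat_trans_inverse[OF nat_iso_trans[OF eta] iso] .
  fix x y
  show "u = v" if "u \<in> hom C x y" "v \<in> hom C x y" "amap S u = amap S v" for u v
    by (rule faithful_if_iso_id[OF i _ that(1,2)])
      (use that h in \<open>auto simp: hom_Arr intro!: C.iso_inv_arr[OF iso]\<close>)
  fix k assume x: "x \<in> Obj C" and y: "y \<in> Obj C" and k: "k \<in> hom D (omap S x) (omap S y)"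
  have hx: "\<eta> x \<in> hom C x (omap T (omap S x))" and hy: "\<eta> y \<in> hom C y (omap T (omap S y))"
    using h x y by auto
  note Tk = functor_hom[OF T k]
  note Tkh = C.Cmp_in[OF hx Tk]
  define u where "u = inv_arr C (\<eta> y) \<cdot>\<^bsub>C\<^esub> (amap T k \<cdot>\<^bsub>C\<^esub> \<eta> x)"
  have u: "u \<in> hom C x y"
    unfolding u_def by (rule C.Cmp_in[OF Tkh inv_arr_hom[OF iso[OF y] hy]])
  have "amap T (amap S u) \<cdot>\<^bsub>C\<^esub> \<eta> x = \<eta> y \<cdot>\<^bsub>C\<^esub> u"
    using nat_trans_natural[OF nat_iso_trans[OF eta] u] by (simp add: hom_Arr[OF u])
  also have "\<dots> = amap T k \<cdot>\<^bsub>C\<^esub> \<eta> x"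
    unfolding u_def by (rule C.cancel_inv_left'[OF iso[OF y] hy Tkh])
  finally have "amap T (amap S u) = amap T k"
    by (rule C.iso_epic[OF iso[OF x] hx functor_hom[OF T functor_hom[OF S u]] Tk])
  then have "amap S u = k"
    using faithful_if_iso_id[OF nat_iso_trans[OF eps] nat_iso_iso[OF eps] functor_hom[OF S u] k]
    by (simp add: hom_Arr[OF k] hom_Arr[OF functor_hom[OF S u]])
  with u show "\<exists>u \<in> hom C x y. amap S u = k" by blast
qed

lemma equivalent_categories_obtain_ff:
  assumes "equivalent_categories C D"
  obtains S where "is_functor C D S" "fully_faithful C D S" "essentially_surjective C D S"
proof -
  from assms obtain S T \<eta> \<epsilon> where S: "is_functor C D S" and T: "is_functor D C T"
    and eta: "nat_iso C C (id_functor C) (comp_functor C T S) \<eta>"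
    and eps: "nat_iso D D (comp_functor D S T) (id_functor D) \<epsilon>"
    unfolding equivalent_categories_def by (elim conjE exE)
  interpret D: category D using functor_cod_cat[OF S] .
  have "essentially_surjective C D S"
    unfolding essentially_surjective_def
  proof
    fix y assume y: "y \<in> Obj D"
    have e: "\<epsilon> y \<in> hom D (omap S (omap T y)) y"
      using nat_trans_hom[OF nat_iso_trans[OF eps] y] y by simp
    show "\<exists>x \<in> Obj C. \<exists>i \<in> hom D y (omap S x). iso_arr D i"
      by (intro bexI[OF _ functor_obj[OF T y]] bexI[OF _ inv_arr_hom[OF nat_iso_iso[OF eps y] e]]
        D.iso_inv_arr[OF nat_iso_iso[OF eps y] e])
  qed
  with S equivalence_fully_faithful[OF S T eta eps] show thesis by (rule that)
qed

section \<open>Adjunctions by universal arrows\<close>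

text \<open>
  In other words, \<open>(r, e)\<close> is a terminal object of the comma category of \<open>L\<close> over \<open>y\<close>.  A
  right adjoint of \<open>L\<close> amounts to such an arrow for every \<open>y\<close>, with no functoriality to be checked.
\<close>

definition couniversal ::
  "('o1, 'm1) cat \<Rightarrow> ('o2, 'm2) cat \<Rightarrow> ('o1, 'm1, 'o2, 'm2) ftor \<Rightarrow> 'o2 \<Rightarrow> 'o1 \<Rightarrow> 'm2 \<Rightarrow> bool" where
  "couniversal C D L y r e \<longleftrightarrow> r \<in> Obj C \<and> e \<in> hom D (omap L r) y \<and>
     (\<forall>x \<in> Obj C. \<forall>h \<in> hom D (omap L x) y. \<exists>!k. k \<in> hom C x r \<and> e \<cdot>\<^bsub>D\<^esub> amap L k = h)"

lemma couniversal_ex: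
  "couniversal C D L y r e \<Longrightarrow> x \<in> Obj C \<Longrightarrow> h \<in> hom D (omap L x) y \<Longrightarrow>
    \<exists>k. k \<in> hom C x r \<and> e \<cdot>\<^bsub>D\<^esub> amap L k = h"
  unfolding couniversal_def by blast

lemma couniversal_eq:
  assumes "couniversal C D L y r e" "is_functor C D L" "k \<in> hom C x r" "k' \<in> hom C x r"
    and "e \<cdot>\<^bsub>D\<^esub> amap L k = e \<cdot>\<^bsub>D\<^esub> amap L k'"
  shows "k = k'"
proof -
  have x: "x \<in> Obj C" by (rule category.hom_obj_dom[OF functor_dom_cat[OF assms(2)] assms(3)])
  have "e \<in> hom D (omap L r) y" using assms(1) by (simp add: couniversal_def)
  then have "e \<cdot>\<^bsub>D\<^esub> amap L k \<in> hom D (omap L x) y"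
    by (rule category.Cmp_in[OF functor_cod_cat[OF assms(2)] functor_hom[OF assms(2,3)]])
  with x have "\<exists>!k'. k' \<in> hom C x r \<and> e \<cdot>\<^bsub>D\<^esub> amap L k' = e \<cdot>\<^bsub>D\<^esub> amap L k"
    using assms(1) unfolding couniversal_def by blast
  then show ?thesis using assms(3-5) by auto
qed

lemma adjunction_couniversal:
  assumes a: "adjunction C D a" and y: "y \<in> Obj D"
  shows "couniversal C D (lft a) y (omap (rgt a) y) (counit a y)"
proof -
  have L: "is_functor C D (lft a)" and R: "is_functor D C (rgt a)"
    and un: "nat_trans C C (id_functor C) (comp_functor C (rgt a) (lft a)) (unit a)"
    and co: "nat_trans D D (comp_functor D (lft a) (rgt a)) (id_functor D) (counit a)"
    and t1: "\<And>x. x \<in> Obj C \<Longrightarrow> counit a (omap (lft a) x) \<cdot>\<^bsub>D\<^esub> amap (lft a) (unit a x)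
                  = Idt D (omap (lft a) x)"
    and t2: "\<And>y. y \<in> Obj D \<Longrightarrow> amap (rgt a) (counit a y) \<cdot>\<^bsub>C\<^esub> unit a (omap (rgt a) y)
                  = Idt C (omap (rgt a) y)"
    using a unfolding adjunction_def by auto
  interpret C: category C using functor_dom_cat[OF L] .
  interpret D: category D using functor_cod_cat[OF L] .
  let ?L = "lft a" and ?R = "rgt a"
  have uh: "unit a x \<in> hom C x (omap ?R (omap ?L x))" if "x \<in> Obj C" for x
    using nat_trans_hom[OF un that] that by simp
  have ch: "counit a y \<in> hom D (omap ?L (omap ?R y)) y" if "y \<in> Obj D" for y
    using nat_trans_hom[OF co that] that by simp
  show ?thesis
    unfolding couniversal_def
  proof (intro conjI ballI)
    show "omap ?R y \<in> Obj C" "counit a y \<in> hom D (omap ?L (omap ?R y)) y"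
      using functor_obj[OF R y] ch[OF y] .
    fix x h assume x: "x \<in> Obj C" and h: "h \<in> hom D (omap ?L x) y"
    note Rh = functor_hom[OF R h] note Lx = functor_obj[OF L x]
    show "\<exists>!k. k \<in> hom C x (omap ?R y) \<and> counit a y \<cdot>\<^bsub>D\<^esub> amap ?L k = h"
    proof (intro ex1I conjI)
      show "amap ?R h \<cdot>\<^bsub>C\<^esub> unit a x \<in> hom C x (omap ?R y)"
        using C.Cmp_in[OF uh[OF x] Rh] .
      have "counit a y \<cdot>\<^bsub>D\<^esub> amap ?L (amap ?R h) = h \<cdot>\<^bsub>D\<^esub> counit a (omap ?L x)"
        using nat_trans_natural[OF co h] by (simp add: hom_Arr[OF h])
      then show "counit a y \<cdot>\<^bsub>D\<^esub> amap ?L (amap ?R h \<cdot>\<^bsub>C\<^esub> unit a x) = h"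
        using D.Cmp_assoc[OF functor_hom[OF L uh[OF x]] functor_hom[OF L Rh] ch[OF y]]
          D.Cmp_assoc[OF functor_hom[OF L uh[OF x]] ch[OF Lx] h]
        by (simp add: functor_Cmp[OF L uh[OF x] Rh] t1[OF x] D.Cmp_Idt_right[OF h])
    next
      fix k assume "k \<in> hom C x (omap ?R y) \<and> counit a y \<cdot>\<^bsub>D\<^esub> amap ?L k = h"
      then have k: "k \<in> hom C x (omap ?R y)" and kh: "counit a y \<cdot>\<^bsub>D\<^esub> amap ?L k = h" by auto
      note Lk = functor_hom[OF L k] note Ry = functor_obj[OF R y]
      have "amap ?R (amap ?L k) \<cdot>\<^bsub>C\<^esub> unit a x = unit a (omap ?R y) \<cdot>\<^bsub>C\<^esub> k"
        using nat_trans_natural[OF un k] by (simp add: hom_Arr[OF k])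
      then show "k = amap ?R h \<cdot>\<^bsub>C\<^esub> unit a x"
        using C.Cmp_assoc[OF uh[OF x] functor_hom[OF R Lk] functor_hom[OF R ch[OF y]]]
          C.Cmp_assoc[OF k uh[OF Ry] functor_hom[OF R ch[OF y]]]
        by (simp add: kh[symmetric] functor_Cmp[OF R Lk ch[OF y]] t2[OF y] C.Cmp_Idt_left[OF k])
    qed
  qed
qed

lemma adjunction_lft: "adjunction C D a \<Longrightarrow> is_functor C D (lft a)"
  by (simp add: adjunction_def)

text \<open>
  The right adjoint sends \<open>y\<close> to the source of a chosen couniversal arrow; everything else is forced,
  and every equation between arrows into that source is checked after composition with the arrow.
\<close>

lemma adjunction_of_couniversal:
  assumes L: "is_functor C D L"
    and ex: "\<And>y. y \<in> Obj D \<Longrightarrow> \<exists>r e. couniversal C D L y r e"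
  shows "\<exists>a. adjunction C D a \<and> lft a = L"
proof -
  interpret C: category C using functor_dom_cat[OF L] .
  interpret D: category D using functor_cod_cat[OF L] .
  have "\<forall>y. \<exists>r e. y \<in> Obj D \<longrightarrow> couniversal C D L y r e" using ex by blast
  then obtain R0 \<epsilon> where U: "\<And>y. y \<in> Obj D \<Longrightarrow> couniversal C D L y (R0 y) (\<epsilon> y)"
    by metis
  have R0: "R0 y \<in> Obj C" and eps: "\<epsilon> y \<in> hom D (omap L (R0 y)) y" if "y \<in> Obj D" for y
    using U[OF that] unfolding couniversal_def by auto
  have "\<forall>y x h. \<exists>k. y \<in> Obj D \<and> x \<in> Obj C \<and> h \<in> hom D (omap L x) y \<longrightarrow>
      k \<in> hom C x (R0 y) \<and> \<epsilon> y \<cdot>\<^bsub>D\<^esub> amap L k = h"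
    using couniversal_ex[OF U] by blast
  then obtain tr where tr: "\<And>y x h. y \<in> Obj D \<Longrightarrow> x \<in> Obj C \<Longrightarrow> h \<in> hom D (omap L x) y \<Longrightarrow>
      tr y x h \<in> hom C x (R0 y) \<and> \<epsilon> y \<cdot>\<^bsub>D\<^esub> amap L (tr y x h) = h"
    by metis
  define R1 where "R1 h = tr (Cod D h) (R0 (Dom D h)) (h \<cdot>\<^bsub>D\<^esub> \<epsilon> (Dom D h))" for h
  have R1: "R1 h \<in> hom C (R0 x) (R0 y)" "\<epsilon> y \<cdot>\<^bsub>D\<^esub> amap L (R1 h) = h \<cdot>\<^bsub>D\<^esub> \<epsilon> x"
    if h: "h \<in> hom D x y" for h x y
    using tr[OF D.hom_obj_cod[OF h] R0 D.Cmp_in[OF eps h]] D.hom_obj_dom[OF h]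
    unfolding R1_def hom_Dom[OF h] hom_Cod[OF h] by auto
  note eq = couniversal_eq[OF U L]
  define R :: "('c, 'd, 'a, 'b) ftor" where "R = \<lparr>omap = restrict R0 (Obj D), amap = restrict R1 (Arr D)\<rparr>"
  have R_o: "omap R y = R0 y" if "y \<in> Obj D" for y using that by (simp add: R_def)
  have R_a: "amap R h = R1 h" if "h \<in> Arr D" for h using that by (simp add: R_def)
  have R: "is_functor D C R"
  proof (rule is_functorI)
    show "omap R \<in> extensional (Obj D)" "amap R \<in> extensional (Arr D)"
      by (simp_all add: R_def)
    show "amap R u \<in> hom C (omap R x) (omap R y)" if "u \<in> hom D x y" for u x y
      using R1(1)[OF that] by (simp add: R_o R_a hom_Arr[OF that] D.hom_obj_dom[OF that] D.hom_obj_cod[OF that])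
    show "amap R (Idt D x) = Idt C (omap R x)" if x: "x \<in> Obj D" for x
    proof -
      have "R1 (Idt D x) = Idt C (R0 x)"
        by (rule eq[OF x R1(1)[OF D.Idt_in[OF x]] C.Idt_in[OF R0[OF x]]])
          (simp add: R1(2)[OF D.Idt_in[OF x]] functor_Idt[OF L R0[OF x]]
            D.Cmp_Idt_left[OF eps[OF x]] D.Cmp_Idt_right[OF eps[OF x]])
      then show ?thesis using x by (simp add: R_o R_a hom_Arr[OF D.Idt_in])
    qed
    show "amap R (v \<cdot>\<^bsub>D\<^esub> u) = amap R v \<cdot>\<^bsub>C\<^esub> amap R u"
      if u: "u \<in> hom D x y" and v: "v \<in> hom D y z" for u v x y z
    proof -
      note x = D.hom_obj_dom[OF u] note y = D.hom_obj_cod[OF u] note z = D.hom_obj_cod[OF v]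
      note L' = functor_hom[OF L R1(1)]
      have "\<epsilon> z \<cdot>\<^bsub>D\<^esub> amap L (R1 v \<cdot>\<^bsub>C\<^esub> R1 u) = (v \<cdot>\<^bsub>D\<^esub> \<epsilon> y) \<cdot>\<^bsub>D\<^esub> amap L (R1 u)"
        by (simp add: functor_Cmp[OF L R1(1)[OF u] R1(1)[OF v]] R1(2)[OF v, symmetric]
            D.Cmp_assoc[OF L'[OF u] L'[OF v] eps[OF z]])
      also have "\<dots> = (v \<cdot>\<^bsub>D\<^esub> u) \<cdot>\<^bsub>D\<^esub> \<epsilon> x"
        by (simp add: D.Cmp_assoc[OF L'[OF u] eps[OF y] v, symmetric] R1(2)[OF u] D.Cmp_assoc[OF eps[OF x] u v])
      finally have "R1 (v \<cdot>\<^bsub>D\<^esub> u) = R1 v \<cdot>\<^bsub>C\<^esub> R1 u"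
        by (intro eq[OF z R1(1)[OF D.Cmp_in[OF u v]] C.Cmp_in[OF R1(1)[OF u] R1(1)[OF v]]])
          (simp add: R1(2)[OF D.Cmp_in[OF u v]])
      then show ?thesis using hom_Arr[OF u] hom_Arr[OF v] hom_Arr[OF D.Cmp_in[OF u v]]
        by (simp add: R_a)
    qed
  qed (simp_all add: C.category_axioms D.category_axioms R_o R0)
  define \<eta> where "\<eta> x = tr (omap L x) x (Idt D (omap L x))" for x
  have eta: "\<eta> x \<in> hom C x (R0 (omap L x))"
    "\<epsilon> (omap L x) \<cdot>\<^bsub>D\<^esub> amap L (\<eta> x) = Idt D (omap L x)" if x: "x \<in> Obj C" for x
    using tr[OF functor_obj[OF L x] x D.Idt_in[OF functor_obj[OF L x]]] unfolding \<eta>_def by auto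
  have un: "nat_trans C C (id_functor C) (comp_functor C R L) (restrict \<eta> (Obj C))"
  proof (rule nat_transI[OF is_functor_id[OF C.category_axioms] is_functor_comp[OF L R]])
    fix u x y assume u: "u \<in> hom C x y"
    note x = C.hom_obj_dom[OF u] note y = C.hom_obj_cod[OF u]
    note Lx = functor_obj[OF L x] note Ly = functor_obj[OF L y] note Lu = functor_hom[OF L u]
    have "\<epsilon> (omap L y) \<cdot>\<^bsub>D\<^esub> amap L (\<eta> y \<cdot>\<^bsub>C\<^esub> u) = amap L u"
      using D.Cmp_assoc[OF Lu functor_hom[OF L eta(1)[OF y]] eps[OF Ly]]
      by (simp add: functor_Cmp[OF L u eta(1)[OF y]] eta(2)[OF y] D.Cmp_Idt_left[OF Lu])
    moreover have "\<epsilon> (omap L y) \<cdot>\<^bsub>D\<^esub> amap L (R1 (amap L u) \<cdot>\<^bsub>C\<^esub> \<eta> x) = amap L u"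
      using D.Cmp_assoc[OF functor_hom[OF L eta(1)[OF x]] functor_hom[OF L R1(1)[OF Lu]] eps[OF Ly]]
        D.Cmp_assoc[OF functor_hom[OF L eta(1)[OF x]] eps[OF Lx] Lu]
      by (simp add: functor_Cmp[OF L eta(1)[OF x] R1(1)[OF Lu]] R1(2)[OF Lu] eta(2)[OF x] D.Cmp_Idt_right[OF Lu])
    ultimately have "\<eta> y \<cdot>\<^bsub>C\<^esub> u = R1 (amap L u) \<cdot>\<^bsub>C\<^esub> \<eta> x"
      by (intro eq[OF Ly C.Cmp_in[OF u eta(1)[OF y]] C.Cmp_in[OF eta(1)[OF x] R1(1)[OF Lu]]]) simp
    then show "restrict \<eta> (Obj C) y \<cdot>\<^bsub>C\<^esub> amap (id_functor C) u =
        amap (comp_functor C R L) u \<cdot>\<^bsub>C\<^esub> restrict \<eta> (Obj C) x"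
      using x y hom_Arr[OF u] hom_Arr[OF Lu] by (simp add: R_a)
  qed (simp_all add: eta R_o functor_obj[OF L])
  have co: "nat_trans D D (comp_functor D L R) (id_functor D) (restrict \<epsilon> (Obj D))"
  proof (rule nat_transI[OF is_functor_comp[OF R L] is_functor_id[OF D.category_axioms]])
    fix u x y assume u: "u \<in> hom D x y"
    show "restrict \<epsilon> (Obj D) y \<cdot>\<^bsub>D\<^esub> amap (comp_functor D L R) u =
        amap (id_functor D) u \<cdot>\<^bsub>D\<^esub> restrict \<epsilon> (Obj D) x"
      using R1(2)[OF u] hom_Arr[OF u] D.hom_obj_dom[OF u] D.hom_obj_cod[OF u] by (simp add: R_a)
  qed (simp_all add: eps R_o)
  have t2: "amap R (\<epsilon> y) \<cdot>\<^bsub>C\<^esub> \<eta> (R0 y) = Idt C (R0 y)" if y: "y \<in> Obj D" for y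
  proof (rule eq[OF y _ C.Idt_in[OF R0[OF y]]])
    note e = eps[OF y] note r = R0[OF y] note Lr = functor_obj[OF L r]
    have Ra: "amap R (\<epsilon> y) = R1 (\<epsilon> y)" using hom_Arr[OF e] by (simp add: R_a)
    show "amap R (\<epsilon> y) \<cdot>\<^bsub>C\<^esub> \<eta> (R0 y) \<in> hom C (R0 y) (R0 y)"
      unfolding Ra by (rule C.Cmp_in[OF eta(1)[OF r] R1(1)[OF e]])
    show "\<epsilon> y \<cdot>\<^bsub>D\<^esub> amap L (amap R (\<epsilon> y) \<cdot>\<^bsub>C\<^esub> \<eta> (R0 y)) = \<epsilon> y \<cdot>\<^bsub>D\<^esub> amap L (Idt C (R0 y))"
      using D.Cmp_assoc[OF functor_hom[OF L eta(1)[OF r]] functor_hom[OF L R1(1)[OF e]] e]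
        D.Cmp_assoc[OF functor_hom[OF L eta(1)[OF r]] eps[OF Lr] e]
      by (simp add: Ra functor_Cmp[OF L eta(1)[OF r] R1(1)[OF e]] R1(2)[OF e] eta(2)[OF r]
          functor_Idt[OF L r])
  qed
  have "adjunction C D \<lparr>lft = L, rgt = R, unit = restrict \<eta> (Obj C), counit = restrict \<epsilon> (Obj D)\<rparr>"
    unfolding adjunction_def using L R un co eta(2) t2 by (simp add: functor_obj[OF L] R_o R0)
  then show ?thesis by (intro exI conjI) auto
qed

section \<open>Terminal objects and pullbacks under equivalences\<close>

definition pullback ::
  "('o, 'm) cat \<Rightarrow> 'o \<Rightarrow> 'o \<Rightarrow> 'm \<Rightarrow> 'm \<Rightarrow> 'o \<Rightarrow> 'm \<Rightarrow> 'm \<Rightarrow> bool" where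
  "pullback C x y p q w u v \<longleftrightarrow> u \<in> hom C w x \<and> v \<in> hom C w y \<and> p \<cdot>\<^bsub>C\<^esub> u = q \<cdot>\<^bsub>C\<^esub> v \<and>
     (\<forall>d. \<forall>m \<in> hom C d x. \<forall>n \<in> hom C d y. p \<cdot>\<^bsub>C\<^esub> m = q \<cdot>\<^bsub>C\<^esub> n \<longrightarrow>
        (\<exists>!k. k \<in> hom C d w \<and> u \<cdot>\<^bsub>C\<^esub> k = m \<and> v \<cdot>\<^bsub>C\<^esub> k = n))"

definition has_pullbacks :: "('o, 'm) cat \<Rightarrow> bool" where
  "has_pullbacks C \<longleftrightarrow>
     (\<forall>x y z. \<forall>p \<in> hom C x z. \<forall>q \<in> hom C y z. \<exists>w u v. pullback C x y p q w u v)"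

lemma equivalent_has_terminal:
  assumes eq: "equivalent_categories C D" and t: "terminal D t"
  shows "\<exists>t'. terminal C t'"
proof -
  from eq obtain S where S: "is_functor C D S" and ff: "fully_faithful C D S"
    and es: "essentially_surjective C D S"
    by (rule equivalent_categories_obtain_ff)
  interpret C: category C using functor_dom_cat[OF S] .
  interpret D: category D using functor_cod_cat[OF S] .
  from es terminal_obj[OF t] obtain t' i where t': "t' \<in> Obj C" and i: "i \<in> hom D t (omap S t')" "iso_arr D i"
    unfolding essentially_surjective_def by blast
  have "\<exists>!u. u \<in> hom C x t'" if x: "x \<in> Obj C" for x
  proof -
    from terminal_ex[OF t functor_obj[OF S x]] obtain h where h: "h \<in> hom D (omap S x) t" by blast
    from fully_faithful_ex[OF ff x t' D.Cmp_in[OF h i(1)]] obtain u where u: "u \<in> hom C x t'" by blast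
    show ?thesis
    proof (rule ex1I)
      show "u \<in> hom C x t'" by (rule u)
      fix v assume v: "v \<in> hom C x t'"
      note j = inv_arr_hom[OF i(2,1)]
      have "inv_arr D i \<cdot>\<^bsub>D\<^esub> amap S v = inv_arr D i \<cdot>\<^bsub>D\<^esub> amap S u"
        by (rule D.terminal_eq[OF t D.Cmp_in[OF functor_hom[OF S v] j] D.Cmp_in[OF functor_hom[OF S u] j]])
      then have "amap S v = amap S u"
        using D.cancel_inv_left'[OF i(2,1) functor_hom[OF S v]]
          D.cancel_inv_left'[OF i(2,1) functor_hom[OF S u]] by metis
      then show "v = u" by (rule fully_faithful_eq[OF ff C.category_axioms v u])
    qed
  qed
  with t' show ?thesis unfolding terminal_def by blast
qed

text \<open>
  The pullback is formed in \<open>D\<close> and its apex \<open>w\<close> is replaced by an isomorphic object \<open>S w'\<close>; since \<open>S\<close> is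
  fully faithful, arrows into \<open>S w'\<close> and commutative squares lift uniquely.
\<close>

lemma equivalent_has_pullbacks:
  assumes eq: "equivalent_categories C D" and pb: "has_pullbacks D"
  shows "has_pullbacks C"
proof -
  from eq obtain S where S: "is_functor C D S" and ff: "fully_faithful C D S"
    and es: "essentially_surjective C D S"
    by (rule equivalent_categories_obtain_ff)
  interpret C: category C using functor_dom_cat[OF S] .
  interpret D: category D using functor_cod_cat[OF S] .
  note faithful = fully_faithful_eq[OF ff C.category_axioms]
  have "\<exists>w u v. pullback C x y p q w u v" if p: "p \<in> hom C x z" and q: "q \<in> hom C y z" for x y z p q
  proof -
    note x = C.hom_obj_dom[OF p] and y = C.hom_obj_dom[OF q]
    obtain w u v where wpb: "pullback D (omap S x) (omap S y) (amap S p) (amap S q) w u v"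
      using pb functor_hom[OF S p] functor_hom[OF S q] unfolding has_pullbacks_def by meson
    then have u: "u \<in> hom D w (omap S x)" and v: "v \<in> hom D w (omap S y)"
      and uv: "amap S p \<cdot>\<^bsub>D\<^esub> u = amap S q \<cdot>\<^bsub>D\<^esub> v"
      and univ: "\<And>d m n. m \<in> hom D d (omap S x) \<Longrightarrow> n \<in> hom D d (omap S y) \<Longrightarrow>
        amap S p \<cdot>\<^bsub>D\<^esub> m = amap S q \<cdot>\<^bsub>D\<^esub> n \<Longrightarrow> \<exists>!k. k \<in> hom D d w \<and> u \<cdot>\<^bsub>D\<^esub> k = m \<and> v \<cdot>\<^bsub>D\<^esub> k = n"
      unfolding pullback_def by auto
    from es D.hom_obj_dom[OF u] obtain w' i where w': "w' \<in> Obj C"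
      and i: "i \<in> hom D w (omap S w')" "iso_arr D i"
      unfolding essentially_surjective_def by blast
    let ?j = "inv_arr D i"
    note j = inv_arr_hom[OF i(2,1)]
    obtain u' where u': "u' \<in> hom C w' x" "amap S u' = u \<cdot>\<^bsub>D\<^esub> ?j"
      using fully_faithful_ex[OF ff w' x D.Cmp_in[OF j u]] by blast
    obtain v' where v': "v' \<in> hom C w' y" "amap S v' = v \<cdot>\<^bsub>D\<^esub> ?j"
      using fully_faithful_ex[OF ff w' y D.Cmp_in[OF j v]] by blast
    note Sp = functor_hom[OF S p] and Sq = functor_hom[OF S q]
    have "pullback C x y p q w' u' v'"
      unfolding pullback_def
    proof (intro conjI allI ballI impI)
      show "u' \<in> hom C w' x" "v' \<in> hom C w' y" using u' v' by auto
      show "p \<cdot>\<^bsub>C\<^esub> u' = q \<cdot>\<^bsub>C\<^esub> v'"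
        by (rule faithful[OF C.Cmp_in[OF u'(1) p] C.Cmp_in[OF v'(1) q]])
          (simp add: functor_Cmp[OF S u'(1) p] functor_Cmp[OF S v'(1) q] u'(2) v'(2)
            D.Cmp_assoc[OF j u Sp] D.Cmp_assoc[OF j v Sq] uv)
      fix d m n assume m: "m \<in> hom C d x" and n: "n \<in> hom C d y" and mn: "p \<cdot>\<^bsub>C\<^esub> m = q \<cdot>\<^bsub>C\<^esub> n"
      note d = C.hom_obj_dom[OF m] and Sm = functor_hom[OF S m] and Sn = functor_hom[OF S n]
      have "amap S p \<cdot>\<^bsub>D\<^esub> amap S m = amap S q \<cdot>\<^bsub>D\<^esub> amap S n"
        using mn by (simp add: functor_Cmp[OF S m p, symmetric] functor_Cmp[OF S n q, symmetric])
      from univ[OF Sm Sn this] obtain k where k: "k \<in> hom D (omap S d) w"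
          "u \<cdot>\<^bsub>D\<^esub> k = amap S m" "v \<cdot>\<^bsub>D\<^esub> k = amap S n"
        and kuniq: "\<And>k'. k' \<in> hom D (omap S d) w \<Longrightarrow> u \<cdot>\<^bsub>D\<^esub> k' = amap S m \<Longrightarrow>
          v \<cdot>\<^bsub>D\<^esub> k' = amap S n \<Longrightarrow> k' = k"
        by blast
      obtain l where l: "l \<in> hom C d w'" "amap S l = i \<cdot>\<^bsub>D\<^esub> k"
        using fully_faithful_ex[OF ff d w' D.Cmp_in[OF k(1) i(1)]] by blast
      show "\<exists>!l. l \<in> hom C d w' \<and> u' \<cdot>\<^bsub>C\<^esub> l = m \<and> v' \<cdot>\<^bsub>C\<^esub> l = n"
      proof (intro ex1I conjI)
        show "l \<in> hom C d w'" by (rule l)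
        have cancel: "(a \<cdot>\<^bsub>D\<^esub> ?j) \<cdot>\<^bsub>D\<^esub> (i \<cdot>\<^bsub>D\<^esub> k) = a \<cdot>\<^bsub>D\<^esub> k" if a: "a \<in> hom D w b" for a b
          by (simp add: D.Cmp_assoc[OF D.Cmp_in[OF k(1) i(1)] j a, symmetric] D.cancel_inv_left[OF i(2,1) k(1)])
        show "u' \<cdot>\<^bsub>C\<^esub> l = m"
          by (rule faithful[OF C.Cmp_in[OF l(1) u'(1)] m])
            (simp add: functor_Cmp[OF S l(1) u'(1)] l(2) u'(2) cancel[OF u] k(2))
        show "v' \<cdot>\<^bsub>C\<^esub> l = n"
          by (rule faithful[OF C.Cmp_in[OF l(1) v'(1)] n])
            (simp add: functor_Cmp[OF S l(1) v'(1)] l(2) v'(2) cancel[OF v] k(3))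
      next
        fix l' assume l': "l' \<in> hom C d w' \<and> u' \<cdot>\<^bsub>C\<^esub> l' = m \<and> v' \<cdot>\<^bsub>C\<^esub> l' = n"
        then have l'h: "l' \<in> hom C d w'" by blast
        note Sl' = functor_hom[OF S l'h]
        have "u \<cdot>\<^bsub>D\<^esub> (?j \<cdot>\<^bsub>D\<^esub> amap S l') = amap S m" "v \<cdot>\<^bsub>D\<^esub> (?j \<cdot>\<^bsub>D\<^esub> amap S l') = amap S n"
          using functor_Cmp[OF S l'h u'(1)] functor_Cmp[OF S l'h v'(1)] l'
          by (simp_all add: D.Cmp_assoc[OF Sl' j u] D.Cmp_assoc[OF Sl' j v] u'(2) v'(2))
        then have "?j \<cdot>\<^bsub>D\<^esub> amap S l' = k" by (rule kuniq[OF D.Cmp_in[OF Sl' j]])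
        then have "amap S l' = amap S l"
          using D.cancel_inv_left'[OF i(2,1) Sl'] by (simp add: l(2))
        then show "l' = l" by (rule faithful[OF l'h l(1)])
      qed
    qed
    then show ?thesis by blast
  qed
  then show ?thesis unfolding has_pullbacks_def by blast
qed

section \<open>Sheaf categories have a terminal object and pullbacks\<close>

lemma hom_set_cat:
  "t \<in> hom set_cat A B \<longleftrightarrow> (\<exists>g. t = (A, g, B) \<and> small A \<and> small B \<and> g \<in> A \<rightarrow>\<^sub>E B)"
  by (auto simp: hom_def set_cat_def)

lemma set_cat_simps [simp]:
  "Obj set_cat = {A. small A}"
  "Idt set_cat A = (A, \<lambda>x \<in> A. x, A)"
  "(B', g, D) \<cdot>\<^bsub>set_cat\<^esub> (A, f, B) = (A, compose A g f, D)"
  by (simp_all add: set_cat_def)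

lemma category_set_cat: "category set_cat"
proof
  fix f g h :: "'a set \<times> ('a \<Rightarrow> 'a) \<times> 'a set" and A B C D :: "'a set"
  show "f \<in> Arr set_cat \<Longrightarrow> Dom set_cat f \<in> Obj set_cat"
    "f \<in> Arr set_cat \<Longrightarrow> Cod set_cat f \<in> Obj set_cat"
    by (auto simp: set_cat_def)
  show "A \<in> Obj set_cat \<Longrightarrow> Idt set_cat A \<in> hom set_cat A A"
    by (auto simp: hom_set_cat)
  show "f \<in> hom set_cat A B \<Longrightarrow> g \<in> hom set_cat B C \<Longrightarrow> g \<cdot>\<^bsub>set_cat\<^esub> f \<in> hom set_cat A C"
    by (auto simp: hom_set_cat compose_def PiE_def Pi_def)
  show "f \<in> hom set_cat A B \<Longrightarrow> f \<cdot>\<^bsub>set_cat\<^esub> Idt set_cat A = f"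
    "f \<in> hom set_cat A B \<Longrightarrow> Idt set_cat B \<cdot>\<^bsub>set_cat\<^esub> f = f"
    by (auto simp: hom_set_cat compose_def PiE_def Pi_def intro!: extensionalityI[of _ A])
  show "f \<in> hom set_cat A B \<Longrightarrow> g \<in> hom set_cat B C \<Longrightarrow> h \<in> hom set_cat C D \<Longrightarrow>
      h \<cdot>\<^bsub>set_cat\<^esub> (g \<cdot>\<^bsub>set_cat\<^esub> f) = (h \<cdot>\<^bsub>set_cat\<^esub> g) \<cdot>\<^bsub>set_cat\<^esub> f"
    by (auto simp: hom_set_cat compose_def PiE_def Pi_def intro!: extensionalityI[of _ A])
qed

lemma hom_op_cat [simp]: "hom (op_cat C) x y = hom C y x"
  by (auto simp: hom_def op_cat_def)

lemma op_cat_simps [simp]: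
  "Obj (op_cat C) = Obj C" "Arr (op_cat C) = Arr C" "Idt (op_cat C) = Idt C"
  "g \<cdot>\<^bsub>op_cat C\<^esub> f = f \<cdot>\<^bsub>C\<^esub> g"
  by (simp_all add: op_cat_def)

lemma (in category) category_op: "category (op_cat C)"
proof
  fix f g h w x y z
  show "f \<in> Arr (op_cat C) \<Longrightarrow> Dom (op_cat C) f \<in> Obj (op_cat C)"
    "f \<in> Arr (op_cat C) \<Longrightarrow> Cod (op_cat C) f \<in> Obj (op_cat C)"
    by (simp_all add: op_cat_def Dom_in Cod_in)
  show "x \<in> Obj (op_cat C) \<Longrightarrow> Idt (op_cat C) x \<in> hom (op_cat C) x x"
    by (simp add: Idt_in)
  show "f \<in> hom (op_cat C) x y \<Longrightarrow> g \<in> hom (op_cat C) y z \<Longrightarrow> g \<cdot>\<^bsub>op_cat C\<^esub> f \<in> hom (op_cat C) x z"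
    by (simp add: Cmp_in)
  show "f \<in> hom (op_cat C) x y \<Longrightarrow> f \<cdot>\<^bsub>op_cat C\<^esub> Idt (op_cat C) x = f"
    "f \<in> hom (op_cat C) x y \<Longrightarrow> Idt (op_cat C) y \<cdot>\<^bsub>op_cat C\<^esub> f = f"
    by (simp_all add: Cmp_Idt_left Cmp_Idt_right)
  show "f \<in> hom (op_cat C) w x \<Longrightarrow> g \<in> hom (op_cat C) x y \<Longrightarrow> h \<in> hom (op_cat C) y z \<Longrightarrow>
      h \<cdot>\<^bsub>op_cat C\<^esub> (g \<cdot>\<^bsub>op_cat C\<^esub> f) = (h \<cdot>\<^bsub>op_cat C\<^esub> g) \<cdot>\<^bsub>op_cat C\<^esub> f"
    by (simp add: Cmp_assoc)
qed

abbreviation presheaf :: "('u, 'u) cat \<Rightarrow> 'u presheaf \<Rightarrow> bool" where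
  "presheaf C P \<equiv> is_functor (op_cat C) set_cat P"

lemma presheaf_restr:
  assumes P: "presheaf C P"
  shows presheaf_amap: "f \<in> hom C x y \<Longrightarrow> amap P f = (omap P y, restr P f, omap P x)"
    and restr_in: "f \<in> hom C x y \<Longrightarrow> s \<in> omap P y \<Longrightarrow> restr P f s \<in> omap P x"
    and restr_Idt: "x \<in> Obj C \<Longrightarrow> s \<in> omap P x \<Longrightarrow> restr P (Idt C x) s = s"
    and restr_Cmp: "f \<in> hom C x y \<Longrightarrow> g \<in> hom C y z \<Longrightarrow> s \<in> omap P z \<Longrightarrow>
      restr P (g \<cdot>\<^bsub>C\<^esub> f) s = restr P f (restr P g s)"
proof -
  have r: "restr P f = fst (snd (amap P f))" for f by (rule ext) (simp add: restr_def)
  show 1: "amap P f = (omap P y, restr P f, omap P x)" if f: "f \<in> hom C x y" for f x y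
    using functor_hom[OF P, of f y x] f by (auto simp: hom_set_cat r)
  have 2: "restr P f \<in> omap P y \<rightarrow>\<^sub>E omap P x" if f: "f \<in> hom C x y" for f x y
    using functor_hom[OF P, of f y x] f by (auto simp: hom_set_cat r)
  show "f \<in> hom C x y \<Longrightarrow> s \<in> omap P y \<Longrightarrow> restr P f s \<in> omap P x"
    using 2 by (auto simp: PiE_def Pi_def)
  show "x \<in> Obj C \<Longrightarrow> s \<in> omap P x \<Longrightarrow> restr P (Idt C x) s = s"
    using functor_Idt[OF P, of x] by (simp add: restr_def)
  show "restr P (g \<cdot>\<^bsub>C\<^esub> f) s = restr P f (restr P g s)"
    if f: "f \<in> hom C x y" and g: "g \<in> hom C y z" and s: "s \<in> omap P z"
    using functor_Cmp[OF P, of g z y f x] f g s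
    by (simp add: 1[OF f] 1[OF g] compose_eq restr_def[of P "g \<cdot>\<^bsub>C\<^esub> f"])
qed

definition mk_presheaf :: "('u, 'u) cat \<Rightarrow> ('u \<Rightarrow> 'u set) \<Rightarrow> ('u \<Rightarrow> 'u \<Rightarrow> 'u) \<Rightarrow> 'u presheaf" where
  "mk_presheaf C A r = \<lparr>omap = (\<lambda>c \<in> Obj C. A c),
     amap = (\<lambda>f \<in> Arr C. (A (Cod C f), \<lambda>s \<in> A (Cod C f). r f s, A (Dom C f)))\<rparr>"

lemma omap_mk_presheaf [simp]: "c \<in> Obj C \<Longrightarrow> omap (mk_presheaf C A r) c = A c"
  by (simp add: mk_presheaf_def)

lemma restr_mk_presheaf: "f \<in> hom C x y \<Longrightarrow> s \<in> A y \<Longrightarrow> restr (mk_presheaf C A r) f s = r f s"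
  by (auto simp: mk_presheaf_def restr_def hom_def)

lemma presheaf_mk_presheaf:
  assumes "category C"
    and small: "\<And>c. c \<in> Obj C \<Longrightarrow> small (A c)"
    and r: "\<And>f x y s. f \<in> hom C x y \<Longrightarrow> s \<in> A y \<Longrightarrow> r f s \<in> A x"
    and rI: "\<And>x s. x \<in> Obj C \<Longrightarrow> s \<in> A x \<Longrightarrow> r (Idt C x) s = s"
    and rC: "\<And>f g x y z s. f \<in> hom C x y \<Longrightarrow> g \<in> hom C y z \<Longrightarrow> s \<in> A z \<Longrightarrow>
      r (g \<cdot>\<^bsub>C\<^esub> f) s = r f (r g s)"
  shows "presheaf C (mk_presheaf C A r)"
proof -
  interpret category C by fact
  have am: "amap (mk_presheaf C A r) f = (A y, \<lambda>s \<in> A y. r f s, A x)" if "f \<in> hom C x y" for f x y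
    using that by (simp add: mk_presheaf_def hom_Arr[OF that] hom_Dom[OF that] hom_Cod[OF that])
  show ?thesis
  proof (rule is_functorI)
    show "category (op_cat C)" "category set_cat" by (rule category_op, rule category_set_cat)
    show "omap (mk_presheaf C A r) \<in> extensional (Obj (op_cat C))"
      "amap (mk_presheaf C A r) \<in> extensional (Arr (op_cat C))"
      by (simp_all add: mk_presheaf_def)
    show "x \<in> Obj (op_cat C) \<Longrightarrow> omap (mk_presheaf C A r) x \<in> Obj set_cat" for x
      using small by simp
    fix x assume "x \<in> Obj (op_cat C)"
    then show "amap (mk_presheaf C A r) (Idt (op_cat C) x) = Idt set_cat (omap (mk_presheaf C A r) x)"
      using rI by (simp add: am[OF Idt_in] cong: restrict_cong)
  next
    fix u x y assume "u \<in> hom (op_cat C) x y"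
    then have u: "u \<in> hom C y x" by simp
    then show "amap (mk_presheaf C A r) u
        \<in> hom set_cat (omap (mk_presheaf C A r) x) (omap (mk_presheaf C A r) y)"
      using r[OF u] small hom_obj_dom[OF u] hom_obj_cod[OF u] by (simp add: am[OF u] hom_set_cat)
  next
    fix u v x y z assume "u \<in> hom (op_cat C) x y" "v \<in> hom (op_cat C) y z"
    then have u: "u \<in> hom C y x" and v: "v \<in> hom C z y" by simp_all
    show "amap (mk_presheaf C A r) (v \<cdot>\<^bsub>op_cat C\<^esub> u) =
        amap (mk_presheaf C A r) v \<cdot>\<^bsub>set_cat\<^esub> amap (mk_presheaf C A r) u"
      using r[OF u] by (simp add: am[OF u] am[OF v] am[OF Cmp_in[OF v u]] rC[OF v u] compose_def cong: restrict_cong)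
  qed
qed

text \<open>
  The action on sections of the component at \<open>c\<close> of a transformation of presheaves.
\<close>

definition app :: "('u \<Rightarrow> 'u set \<times> ('u \<Rightarrow> 'u) \<times> 'u set) \<Rightarrow> 'u \<Rightarrow> 'u \<Rightarrow> 'u" where
  "app \<tau> c s = fst (snd (\<tau> c)) s"

lemma presheaf_trans:
  assumes t: "nat_trans (op_cat C) set_cat P Q \<tau>"
  shows presheaf_trans_eq: "c \<in> Obj C \<Longrightarrow> \<tau> c = (omap P c, app \<tau> c, omap Q c)"
    and app_ext: "c \<in> Obj C \<Longrightarrow> app \<tau> c \<in> omap P c \<rightarrow>\<^sub>E omap Q c"
    and app_in: "c \<in> Obj C \<Longrightarrow> s \<in> omap P c \<Longrightarrow> app \<tau> c s \<in> omap Q c"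
    and app_natural: "f \<in> hom C x y \<Longrightarrow> s \<in> omap P y \<Longrightarrow>
      app \<tau> x (restr P f s) = restr Q f (app \<tau> y s)"
proof -
  note P = nat_trans_dom[OF t] and Q = nat_trans_cod[OF t]
  have "category (op_cat C)" using functor_dom_cat[OF P] .
  then interpret op: category "op_cat C" .
  have a: "app \<tau> c = fst (snd (\<tau> c))" for c by (rule ext) (simp add: app_def)
  show 1: "\<tau> c = (omap P c, app \<tau> c, omap Q c)" if "c \<in> Obj C" for c
    using nat_trans_hom[OF t, of c] that by (auto simp: hom_set_cat a)
  show 2: "app \<tau> c \<in> omap P c \<rightarrow>\<^sub>E omap Q c" if "c \<in> Obj C" for c
    using nat_trans_hom[OF t, of c] that by (auto simp: hom_set_cat a)
  show "c \<in> Obj C \<Longrightarrow> s \<in> omap P c \<Longrightarrow> app \<tau> c s \<in> omap Q c" using 2 by (auto simp: PiE_def Pi_def)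
  assume f: "f \<in> hom C x y" and s: "s \<in> omap P y"
  have x: "x \<in> Obj C" and y: "y \<in> Obj C"
    using op.hom_obj_dom[of f y x] op.hom_obj_cod[of f y x] f by auto
  have "compose (omap P y) (app \<tau> x) (restr P f) = compose (omap P y) (restr Q f) (app \<tau> y)"
    using nat_trans_natural[OF t, of f y x] f
    by (simp add: presheaf_amap[OF P f] presheaf_amap[OF Q f] 1[OF x] 1[OF y])
  then have "compose (omap P y) (app \<tau> x) (restr P f) s = compose (omap P y) (restr Q f) (app \<tau> y) s"
    by simp
  then show "app \<tau> x (restr P f s) = restr Q f (app \<tau> y s)"
    using s by (simp add: compose_eq)
qed

lemma presheaf_trans_cong:
  fixes C :: "('u, 'u) cat"
  assumes s: "nat_trans (op_cat C) set_cat P Q \<sigma>" and t: "nat_trans (op_cat C) set_cat P Q \<tau>"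
    and eq: "\<And>c s. c \<in> Obj C \<Longrightarrow> s \<in> omap P c \<Longrightarrow> app \<sigma> c s = app \<tau> c s"
  shows "\<sigma> = \<tau>"
proof (rule extensionalityI[of _ "Obj C"])
  show "\<sigma> \<in> extensional (Obj C)" "\<tau> \<in> extensional (Obj C)"
    using nat_trans_ext[OF s] nat_trans_ext[OF t] by auto
  fix c assume c: "c \<in> Obj C"
  have "app \<sigma> c = app \<tau> c"
    by (rule PiE_ext[OF app_ext[OF s c] app_ext[OF t c]]) (rule eq[OF c])
  then show "\<sigma> c = \<tau> c" by (simp add: presheaf_trans_eq[OF s c] presheaf_trans_eq[OF t c])
qed

definition mk_trans ::
  "('u, 'u) cat \<Rightarrow> 'u presheaf \<Rightarrow> 'u presheaf \<Rightarrow> ('u \<Rightarrow> 'u \<Rightarrow> 'u) \<Rightarrow>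
   'u \<Rightarrow> 'u set \<times> ('u \<Rightarrow> 'u) \<times> 'u set" where
  "mk_trans C P Q t = (\<lambda>c \<in> Obj C. (omap P c, \<lambda>s \<in> omap P c. t c s, omap Q c))"

lemma app_mk_trans [simp]: "c \<in> Obj C \<Longrightarrow> s \<in> omap P c \<Longrightarrow> app (mk_trans C P Q t) c s = t c s"
  by (simp add: app_def mk_trans_def)

lemma nat_trans_mk_trans:
  assumes "category C" and P: "presheaf C P" and Q: "presheaf C Q"
    and t: "\<And>c s. c \<in> Obj C \<Longrightarrow> s \<in> omap P c \<Longrightarrow> t c s \<in> omap Q c"
    and nat: "\<And>f x y s. f \<in> hom C x y \<Longrightarrow> s \<in> omap P y \<Longrightarrow> t x (restr P f s) = restr Q f (t y s)"
  shows "nat_trans (op_cat C) set_cat P Q (mk_trans C P Q t)"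
proof (rule nat_transI[OF P Q])
  interpret category C by fact
  show "mk_trans C P Q t \<in> extensional (Obj (op_cat C))" by (simp add: mk_trans_def)
  show "mk_trans C P Q t c \<in> hom set_cat (omap P c) (omap Q c)" if "c \<in> Obj (op_cat C)" for c
    using that functor_obj[OF P that] functor_obj[OF Q that] t by (simp add: mk_trans_def hom_set_cat)
  fix f x y assume "f \<in> hom (op_cat C) x y"
  then have f: "f \<in> hom C y x" by simp
  show "mk_trans C P Q t y \<cdot>\<^bsub>set_cat\<^esub> amap P f = amap Q f \<cdot>\<^bsub>set_cat\<^esub> mk_trans C P Q t x"
    using restr_in[OF P f] hom_obj_dom[OF f] hom_obj_cod[OF f] nat[OF f]
    by (simp add: mk_trans_def presheaf_amap[OF P f] presheaf_amap[OF Q f] compose_def cong: restrict_cong)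
qed

lemma sheaf_presheaf: "sheaf C J P \<Longrightarrow> presheaf C P"
  by (simp add: sheaf_def)

definition matching :: "('u, 'u) cat \<Rightarrow> 'u presheaf \<Rightarrow> 'u set \<Rightarrow> ('u \<Rightarrow> 'u) \<Rightarrow> bool" where
  "matching C P S m \<longleftrightarrow> (\<forall>f \<in> S. m f \<in> omap P (Dom C f)) \<and>
     (\<forall>f \<in> S. \<forall>g \<in> Arr C. Cod C g = Dom C f \<longrightarrow> restr P g (m f) = m (f \<cdot>\<^bsub>C\<^esub> g))"

lemma matching_in: "matching C P S m \<Longrightarrow> f \<in> S \<Longrightarrow> m f \<in> omap P (Dom C f)"
  and matching_restr: "matching C P S m \<Longrightarrow> f \<in> S \<Longrightarrow> g \<in> Arr C \<Longrightarrow> Cod C g = Dom C f \<Longrightarrow>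
    restr P g (m f) = m (f \<cdot>\<^bsub>C\<^esub> g)"
  unfolding matching_def by blast+

lemma sheaf_ex1:
  assumes "sheaf C J P" "c \<in> Obj C" "S \<in> J c" "matching C P S m"
  shows "\<exists>!s. s \<in> omap P c \<and> (\<forall>f \<in> S. restr P f s = m f)"
proof -
  have "\<forall>c \<in> Obj C. \<forall>S \<in> J c. \<forall>m. matching C P S m \<longrightarrow>
      (\<exists>!s. s \<in> omap P c \<and> (\<forall>f \<in> S. restr P f s = m f))"
    using assms(1) unfolding sheaf_def matching_def by (rule conjunct2)
  from this[rule_format, OF assms(2-4)] show ?thesis .
qed

lemma sheaf_amalgamation:
  assumes "sheaf C J P" "c \<in> Obj C" "S \<in> J c" "matching C P S m"
  shows "\<exists>s. s \<in> omap P c \<and> (\<forall>f \<in> S. restr P f s = m f)"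
  using sheaf_ex1[OF assms] by (rule ex1_implies_ex)

lemma cover_hom:
  assumes "grothendieck_topology C J" "c \<in> Obj C" "S \<in> J c" "f \<in> S"
  shows "f \<in> hom C (Dom C f) c"
proof -
  have "\<forall>c \<in> Obj C. \<forall>S \<in> J c. sieve C c S"
    using assms(1) unfolding grothendieck_topology_def by (rule conjunct1)
  from this[rule_format, OF assms(2,3)] have "S \<subseteq> {f \<in> Arr C. Cod C f = c}"
    unfolding sieve_def by (rule conjunct1)
  with assms(4) show ?thesis unfolding hom_def by blast
qed

lemma sheaf_separated:
  assumes P: "sheaf C J P" and C: "category C" and J: "grothendieck_topology C J"
    and c: "c \<in> Obj C" and S: "S \<in> J c"
    and s: "s \<in> omap P c" and t: "t \<in> omap P c" and eq: "\<And>f. f \<in> S \<Longrightarrow> restr P f s = restr P f t"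
  shows "s = t"
proof -
  interpret category C by fact
  note P' = sheaf_presheaf[OF P]
  note Sh = cover_hom[OF J c S]
  have m: "matching C P S (\<lambda>f. restr P f s)"
    unfolding matching_def
  proof (intro conjI ballI impI)
    show "restr P f s \<in> omap P (Dom C f)" if "f \<in> S" for f using restr_in[OF P' Sh[OF that] s] .
    show "restr P g (restr P f s) = restr P (f \<cdot>\<^bsub>C\<^esub> g) s"
      if "f \<in> S" "g \<in> Arr C" "Cod C g = Dom C f" for f g
      using restr_Cmp[OF P' Arr_hom[OF that(2)] _ s, of f] Sh[OF that(1)] that(3) by simp
  qed
  note the = the1_equality[OF sheaf_ex1[OF P c S m]]
  show ?thesis
    by (rule trans[OF sym[OF the] the]) (simp_all add: s t eq)
qed

lemma sheafI:
  assumes P: "presheaf C P"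
    and ex: "\<And>c S m. c \<in> Obj C \<Longrightarrow> S \<in> J c \<Longrightarrow> matching C P S m \<Longrightarrow>
      \<exists>s. s \<in> omap P c \<and> (\<forall>f \<in> S. restr P f s = m f)"
    and sep: "\<And>c S s t. c \<in> Obj C \<Longrightarrow> S \<in> J c \<Longrightarrow> s \<in> omap P c \<Longrightarrow> t \<in> omap P c \<Longrightarrow>
      (\<And>f. f \<in> S \<Longrightarrow> restr P f s = restr P f t) \<Longrightarrow> s = t"
  shows "sheaf C J P"
  unfolding sheaf_def
proof (intro conjI ballI allI impI)
  fix c S m
  assume c: "c \<in> Obj C" and S: "S \<in> J c" and m: "(\<forall>f \<in> S. m f \<in> omap P (Dom C f)) \<and>
     (\<forall>f \<in> S. \<forall>g \<in> Arr C. Cod C g = Dom C f \<longrightarrow> restr P g (m f) = m (f \<cdot>\<^bsub>C\<^esub> g))"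
  show "\<exists>!s. s \<in> omap P c \<and> (\<forall>f \<in> S. restr P f s = m f)"
  proof (rule ex_ex1I)
    show "\<exists>s. s \<in> omap P c \<and> (\<forall>f \<in> S. restr P f s = m f)"
      by (rule ex[OF c S]) (simp add: matching_def m)
    fix s t
    assume s: "s \<in> omap P c \<and> (\<forall>f \<in> S. restr P f s = m f)"
      and t: "t \<in> omap P c \<and> (\<forall>f \<in> S. restr P f t = m f)"
    show "s = t" by (rule sep[OF c S]) (simp_all add: s t)
  qed
qed (rule P)

lemma hom_sheaf_cat:
  "t \<in> hom (sheaf_cat C J) P Q \<longleftrightarrow>
     (\<exists>\<tau>. t = (P, \<tau>, Q) \<and> sheaf C J P \<and> sheaf C J Q \<and> nat_trans (op_cat C) set_cat P Q \<tau>)"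
  by (simp add: sheaf_cat_def hom_transformation_cat)

lemma sheaf_cat_simps [simp]:
  "Obj (sheaf_cat C J) = {P. sheaf C J P}"
  "(Q', \<tau>, R) \<cdot>\<^bsub>sheaf_cat C J\<^esub> (P, \<sigma>, Q) = (P, \<lambda>c \<in> Obj C. \<tau> c \<cdot>\<^bsub>set_cat\<^esub> \<sigma> c, R)"
  by (simp_all add: sheaf_cat_def)

lemma app_Cmp:
  fixes C :: "('u, 'u) cat"
  assumes "nat_trans (op_cat C) set_cat P Q \<sigma>" "nat_trans (op_cat C) set_cat Q R \<tau>"
    and "c \<in> Obj C" "s \<in> omap P c"
  shows "app (\<lambda>c \<in> Obj C. \<tau> c \<cdot>\<^bsub>set_cat\<^esub> \<sigma> c) c s = app \<tau> c (app \<sigma> c s)"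
  using assms(4) by (simp add: app_def[of "restrict _ _"] assms(3) presheaf_trans_eq[OF assms(1,3)]
      presheaf_trans_eq[OF assms(2,3)] compose_eq)

lemma nat_trans_set_Cmp:
  assumes "nat_trans (op_cat C) set_cat P Q \<sigma>" "nat_trans (op_cat C) set_cat Q R \<tau>"
  shows "nat_trans (op_cat C) set_cat P R (\<lambda>c \<in> Obj C. \<tau> c \<cdot>\<^bsub>set_cat\<^esub> \<sigma> c)"
  using nat_trans_Cmp[OF assms] by simp

lemma small_subset: "small B \<Longrightarrow> A \<subseteq> B \<Longrightarrow> small A"
  unfolding small_def by (rule lesspoll_trans1[OF subset_imp_lepoll])

lemma small_image: "small (A :: 'u set) \<Longrightarrow> small ((h :: 'u \<Rightarrow> 'u) ` A)"
  unfolding small_def by (rule lesspoll_trans1[OF image_lepoll])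

lemma universe_infinite: "inaccessible_universe TYPE('u) \<Longrightarrow> infinite (UNIV :: 'u set)"
  unfolding inaccessible_universe_def using countable_finite by auto

lemma small_singleton: "inaccessible_universe TYPE('u) \<Longrightarrow> small {x :: 'u}"
  unfolding small_def by (rule finite_lesspoll_infinite) (simp_all add: universe_infinite)

text \<open>
  A product is a small union of small sets, hence its coded copy is small by closure of the
  universe under small unions.
\<close>

lemma small_image_Times:
  fixes A B :: "'u set" and h :: "'u \<times> 'u \<Rightarrow> 'u"
  assumes U: "inaccessible_universe TYPE('u)" and A: "small A" and B: "small B"
  shows "small (h ` (A \<times> B))"
proof -
  have "\<forall>(I :: 'u set) (A :: 'u \<Rightarrow> 'u set). small I \<longrightarrow> (\<forall>i \<in> I. small (A i)) \<longrightarrow> small (\<Union>i \<in> I. A i)"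
    using U unfolding inaccessible_universe_def by (elim conjE)
  from this[rule_format, OF A small_image[OF B]]
  have "small (\<Union>a \<in> A. (\<lambda>b. h (a, b)) ` B)" .
  moreover have "(\<Union>a \<in> A. (\<lambda>b. h (a, b)) ` B) = h ` (A \<times> B)" by auto
  ultimately show ?thesis by simp
qed

lemma universe_pairing:
  assumes "inaccessible_universe TYPE('u)"
  obtains pr :: "'u \<times> 'u \<Rightarrow> 'u" where "inj pr"
proof -
  from iffD2[OF card_of_ordIso card_of_Times_same_infinite[OF universe_infinite[OF assms]]]
  obtain h :: "'u \<times> 'u \<Rightarrow> 'u" where "bij_betw h (UNIV \<times> UNIV) UNIV" by (rule exE)
  then have "inj h" by (simp add: bij_betw_def)
  then show thesis by (rule that)
qed

text \<open>
  The terminal sheaf is the constant presheaf on a singleton.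
\<close>

lemma sheaf_cat_has_terminal:
  fixes C :: "('u, 'u) cat"
  assumes U: "inaccessible_universe TYPE('u)" and C: "category C"
    and J: "grothendieck_topology C J"
  shows "\<exists>t. terminal (sheaf_cat C J) t"
proof -
  interpret category C by fact
  fix z :: 'u
  define T where "T = mk_presheaf C (\<lambda>_. {z}) (\<lambda>_ s. s)"
  have T: "presheaf C T"
    unfolding T_def by (rule presheaf_mk_presheaf) (auto simp: C small_singleton[OF U])
  have Tz: "omap T c = {z}" if "c \<in> Obj C" for c using that by (simp add: T_def)
  have T_sheaf: "sheaf C J T"
  proof (rule sheafI[OF T])
    fix c S m assume c: "c \<in> Obj C" and S: "S \<in> J c" and m: "matching C T S m"
    have "restr T f z = m f" if f: "f \<in> S" for f
    proof -
      note fh = cover_hom[OF J c S f]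
      have "m f = z" using matching_in[OF m f] Tz[OF hom_obj_dom[OF fh]] by simp
      moreover have "restr T f z = z" using restr_in[OF T fh, of z] Tz c hom_obj_dom[OF fh] by simp
      ultimately show ?thesis by simp
    qed
    then show "\<exists>s. s \<in> omap T c \<and> (\<forall>f \<in> S. restr T f s = m f)" using Tz[OF c] by blast
  qed (simp add: Tz)
  have "\<exists>!u. u \<in> hom (sheaf_cat C J) P T" if P: "sheaf C J P" for P
  proof -
    note P' = sheaf_presheaf[OF P]
    let ?t = "mk_trans C P T (\<lambda>_ _. z)"
    have t: "nat_trans (op_cat C) set_cat P T ?t"
      by (rule nat_trans_mk_trans[OF C P' T])
        (auto simp: Tz T_def hom_obj_dom hom_obj_cod restr_mk_presheaf)
    show ?thesis
    proof (rule ex1I[of _ "(P, ?t, T)"])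
      show "(P, ?t, T) \<in> hom (sheaf_cat C J) P T" using P T_sheaf t by (simp add: hom_sheaf_cat)
      fix u assume "u \<in> hom (sheaf_cat C J) P T"
      then obtain \<tau> where u: "u = (P, \<tau>, T)" and tau: "nat_trans (op_cat C) set_cat P T \<tau>"
        by (auto simp: hom_sheaf_cat)
      have "\<tau> = ?t"
        by (rule presheaf_trans_cong[OF tau t]) (use app_in[OF tau] Tz in auto)
      then show "u = (P, ?t, T)" using u by simp
    qed
  qed
  then show ?thesis unfolding terminal_def using T_sheaf by auto
qed

text \<open>
  Pullbacks of sheaves are computed on sections.  Sections are elements of the universe \<open>'u\<close>, so a pair
  of sections is coded by an injection \<open>pr\<close> of pairs into \<open>'u\<close>.  A matching family of pairs is
  amalgamated componentwise, and the two amalgamations agree in \<open>R\<close> because \<open>R\<close> is separated.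
\<close>

lemma sheaf_cat_has_pullbacks:
  fixes C :: "('u, 'u) cat"
  assumes U: "inaccessible_universe TYPE('u)" and C: "category C"
    and J: "grothendieck_topology C J"
  shows "has_pullbacks (sheaf_cat C J)"
  unfolding has_pullbacks_def
proof (intro allI ballI)
  interpret category C by fact
  obtain pr :: "'u \<times> 'u \<Rightarrow> 'u" where pr: "inj pr" using universe_pairing[OF U] .
  define p1 where "p1 e = fst (inv pr e)" for e
  define p2 where "p2 e = snd (inv pr e)" for e
  have p1 [simp]: "p1 (pr (s, t)) = s" and p2 [simp]: "p2 (pr (s, t)) = t" for s t
    by (simp_all add: p1_def p2_def inv_f_f[OF pr])
  fix P Q R p q
  assume "p \<in> hom (sheaf_cat C J) P R" "q \<in> hom (sheaf_cat C J) Q R"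
  then obtain \<sigma> \<tau> where p: "p = (P, \<sigma>, R)" and q: "q = (Q, \<tau>, R)"
    and P: "sheaf C J P" and Q: "sheaf C J Q" and R: "sheaf C J R"
    and si: "nat_trans (op_cat C) set_cat P R \<sigma>" and ta: "nat_trans (op_cat C) set_cat Q R \<tau>"
    by (auto simp: hom_sheaf_cat)
  note P' = sheaf_presheaf[OF P] and Q' = sheaf_presheaf[OF Q] and R' = sheaf_presheaf[OF R]
  define A where "A c = {pr (s, t) | s t. s \<in> omap P c \<and> t \<in> omap Q c \<and> app \<sigma> c s = app \<tau> c t}" for c
  have AI: "pr (s, t) \<in> A c \<longleftrightarrow> s \<in> omap P c \<and> t \<in> omap Q c \<and> app \<sigma> c s = app \<tau> c t" for s t c
    unfolding A_def using inj_eq[OF pr] by auto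
  have AE: "\<exists>s t. e = pr (s, t) \<and> s \<in> omap P c \<and> t \<in> omap Q c \<and> app \<sigma> c s = app \<tau> c t"
    if "e \<in> A c" for e c
    using that unfolding A_def by blast
  have A1: "p1 e \<in> omap P c" and A2: "p2 e \<in> omap Q c"
    and A12: "app \<sigma> c (p1 e) = app \<tau> c (p2 e)" if "e \<in> A c" for e c
    using AE[OF that] by auto
  define W where "W = mk_presheaf C A (\<lambda>f e. pr (restr P f (p1 e), restr Q f (p2 e)))"
  have W: "presheaf C W"
    unfolding W_def
  proof (rule presheaf_mk_presheaf[OF C])
    show "small (A c)" if "c \<in> Obj C" for c
    proof (rule small_subset)
      show "small (pr ` (omap P c \<times> omap Q c))"
        using small_image_Times[OF U] functor_obj[OF P'] functor_obj[OF Q'] that by simp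
    qed (auto simp: A_def)
    show "pr (restr P f (p1 e), restr Q f (p2 e)) \<in> A x" if f: "f \<in> hom C x y" and e: "e \<in> A y" for f x y e
      using AE[OF e] restr_in[OF P' f] restr_in[OF Q' f] app_natural[OF si f] app_natural[OF ta f]
      by (auto simp: AI)
    show "pr (restr P (Idt C x) (p1 e), restr Q (Idt C x) (p2 e)) = e"
      if "x \<in> Obj C" "e \<in> A x" for x e
      using AE[OF that(2)] restr_Idt[OF P' that(1)] restr_Idt[OF Q' that(1)] by auto
    show "pr (restr P (g \<cdot>\<^bsub>C\<^esub> f) (p1 e), restr Q (g \<cdot>\<^bsub>C\<^esub> f) (p2 e)) =
        pr (restr P f (p1 (pr (restr P g (p1 e), restr Q g (p2 e)))),
          restr Q f (p2 (pr (restr P g (p1 e), restr Q g (p2 e)))))"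
      if f: "f \<in> hom C x y" and g: "g \<in> hom C y z" and e: "e \<in> A z" for f g x y z e
      using AE[OF e] restr_Cmp[OF P' f g] restr_Cmp[OF Q' f g] by auto
  qed
  have Wo: "omap W c = A c" if "c \<in> Obj C" for c using that by (simp add: W_def)
  have Wr: "restr W f (pr (s, t)) = pr (restr P f s, restr Q f t)"
    if "f \<in> hom C x y" "pr (s, t) \<in> A y" for f x y s t
    unfolding W_def by (subst restr_mk_presheaf[where A = A, OF that]) simp
  have W_sheaf: "sheaf C J W"
  proof (rule sheafI[OF W])
    fix c S m assume c: "c \<in> Obj C" and S: "S \<in> J c" and m: "matching C W S m"
    note Sh = cover_hom[OF J c S]
    have mA: "m f \<in> A (Dom C f)" if "f \<in> S" for f
      using matching_in[OF m that] Wo[OF hom_obj_dom[OF Sh[OF that]]] by simp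
    have mW: "restr W g (m f) = m (f \<cdot>\<^bsub>C\<^esub> g)" if "f \<in> S" "g \<in> Arr C" "Cod C g = Dom C f" for f g
      using matching_restr[OF m that] .
    have comp: "restr P g (p1 (m f)) = p1 (m (f \<cdot>\<^bsub>C\<^esub> g)) \<and> restr Q g (p2 (m f)) = p2 (m (f \<cdot>\<^bsub>C\<^esub> g))"
      if f: "f \<in> S" and g: "g \<in> Arr C" "Cod C g = Dom C f" for f g
    proof -
      have gh: "g \<in> hom C (Dom C g) (Dom C f)" using g by (simp add: hom_def)
      from AE[OF mA[OF f]] obtain s t where st: "m f = pr (s, t)" by blast
      show ?thesis
        using Wr[OF gh, of s t] mA[OF f] mW[OF f g, symmetric] by (simp add: st)
    qed
    have "matching C P S (\<lambda>f. p1 (m f))" "matching C Q S (\<lambda>f. p2 (m f))"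
      unfolding matching_def using A1[OF mA] A2[OF mA] comp by auto
    with sheaf_amalgamation[OF P c S] sheaf_amalgamation[OF Q c S] obtain s t
      where s: "s \<in> omap P c" "\<And>f. f \<in> S \<Longrightarrow> restr P f s = p1 (m f)"
        and t: "t \<in> omap Q c" "\<And>f. f \<in> S \<Longrightarrow> restr Q f t = p2 (m f)"
      by metis
    have "app \<sigma> c s = app \<tau> c t"
    proof (rule sheaf_separated[OF R C J c S app_in[OF si c s(1)] app_in[OF ta c t(1)]])
      fix f assume f: "f \<in> S"
      have "app \<sigma> (Dom C f) (p1 (m f)) = app \<tau> (Dom C f) (p2 (m f))" by (rule A12[OF mA[OF f]])
      then show "restr R f (app \<sigma> c s) = restr R f (app \<tau> c t)"
        by (simp add: app_natural[OF si Sh[OF f] s(1), symmetric]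
            app_natural[OF ta Sh[OF f] t(1), symmetric] s(2)[OF f] t(2)[OF f])
    qed
    then have st: "pr (s, t) \<in> A c" using s t by (simp add: AI)
    have "restr W f (pr (s, t)) = m f" if f: "f \<in> S" for f
      using AE[OF mA[OF f]] by (auto simp: Wr[OF Sh[OF f] st] s(2)[OF f] t(2)[OF f])
    with st show "\<exists>e. e \<in> omap W c \<and> (\<forall>f \<in> S. restr W f e = m f)" using Wo[OF c] by blast
  next
    fix c S e e' assume c: "c \<in> Obj C" and S: "S \<in> J c" and e: "e \<in> omap W c" and e': "e' \<in> omap W c"
      and eq: "\<And>f. f \<in> S \<Longrightarrow> restr W f e = restr W f e'"
    note Sh = cover_hom[OF J c S]
    from e AE obtain s t where st: "e = pr (s, t)" "s \<in> omap P c" "t \<in> omap Q c" unfolding Wo[OF c] by blast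
    from e' AE obtain s' t' where st': "e' = pr (s', t')" "s' \<in> omap P c" "t' \<in> omap Q c"
      unfolding Wo[OF c] by blast
    have "restr P f s = restr P f s' \<and> restr Q f t = restr Q f t'" if f: "f \<in> S" for f
      using eq[OF f] e e' Wr[OF Sh[OF f], of s t] Wr[OF Sh[OF f], of s' t'] inj_eq[OF pr]
      unfolding Wo[OF c] st(1) st'(1) by simp
    then have "s = s'" "t = t'"
      using sheaf_separated[OF P C J c S st(2) st'(2)] sheaf_separated[OF Q C J c S st(3) st'(3)] by auto
    then show "e = e'" using st st' by simp
  qed
  define u where "u = mk_trans C W P (\<lambda>c. p1)"
  define v where "v = mk_trans C W Q (\<lambda>c. p2)"
  have u: "nat_trans (op_cat C) set_cat W P u"
    unfolding u_def
  proof (rule nat_trans_mk_trans[OF C W P'])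
    show "p1 e \<in> omap P c" if "c \<in> Obj C" "e \<in> omap W c" for c e using A1 that Wo by simp
    show "p1 (restr W f e) = restr P f (p1 e)" if f: "f \<in> hom C x y" and e: "e \<in> omap W y" for f x y e
      using AE[of e y] e Wr[OF f] unfolding Wo[OF hom_obj_cod[OF f]] by auto
  qed
  have v: "nat_trans (op_cat C) set_cat W Q v"
    unfolding v_def
  proof (rule nat_trans_mk_trans[OF C W Q'])
    show "p2 e \<in> omap Q c" if "c \<in> Obj C" "e \<in> omap W c" for c e using A2 that Wo by simp
    show "p2 (restr W f e) = restr Q f (p2 e)" if f: "f \<in> hom C x y" and e: "e \<in> omap W y" for f x y e
      using AE[of e y] e Wr[OF f] unfolding Wo[OF hom_obj_cod[OF f]] by auto
  qed
  have app_u: "app u c (pr (s, t)) = s" and app_v: "app v c (pr (s, t)) = t"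
    if "c \<in> Obj C" "pr (s, t) \<in> A c" for c s t
    using that Wo by (simp_all add: u_def v_def)
  have "pullback (sheaf_cat C J) P Q p q W (W, u, P) (W, v, Q)"
    unfolding pullback_def
  proof (intro conjI allI ballI impI)
    show "(W, u, P) \<in> hom (sheaf_cat C J) W P" "(W, v, Q) \<in> hom (sheaf_cat C J) W Q"
      using W_sheaf P Q u v by (simp_all add: hom_sheaf_cat)
    have "(\<lambda>c \<in> Obj C. \<sigma> c \<cdot>\<^bsub>set_cat\<^esub> u c) = (\<lambda>c \<in> Obj C. \<tau> c \<cdot>\<^bsub>set_cat\<^esub> v c)"
    proof (rule presheaf_trans_cong[OF nat_trans_set_Cmp[OF u si] nat_trans_set_Cmp[OF v ta]])
      fix c e assume c: "c \<in> Obj C" and e: "e \<in> omap W c"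
      from AE[OF e[unfolded Wo[OF c]]] e
      show "app (\<lambda>c \<in> Obj C. \<sigma> c \<cdot>\<^bsub>set_cat\<^esub> u c) c e = app (\<lambda>c \<in> Obj C. \<tau> c \<cdot>\<^bsub>set_cat\<^esub> v c) c e"
        by (auto simp: app_Cmp[OF u si c] app_Cmp[OF v ta c] app_u[OF c] app_v[OF c] Wo[OF c])
    qed
    then show "p \<cdot>\<^bsub>sheaf_cat C J\<^esub> (W, u, P) = q \<cdot>\<^bsub>sheaf_cat C J\<^esub> (W, v, Q)" by (simp add: p q)
    fix D m n
    assume "m \<in> hom (sheaf_cat C J) D P" "n \<in> hom (sheaf_cat C J) D Q"
      and pm: "p \<cdot>\<^bsub>sheaf_cat C J\<^esub> m = q \<cdot>\<^bsub>sheaf_cat C J\<^esub> n"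
    then obtain \<mu> \<nu> where m: "m = (D, \<mu>, P)" and n: "n = (D, \<nu>, Q)" and D: "sheaf C J D"
      and mu: "nat_trans (op_cat C) set_cat D P \<mu>" and nu: "nat_trans (op_cat C) set_cat D Q \<nu>"
      by (auto simp: hom_sheaf_cat)
    note D' = sheaf_presheaf[OF D]
    have "app (\<lambda>c \<in> Obj C. \<sigma> c \<cdot>\<^bsub>set_cat\<^esub> \<mu> c) c d = app (\<lambda>c \<in> Obj C. \<tau> c \<cdot>\<^bsub>set_cat\<^esub> \<nu> c) c d" for c d
      using pm by (simp add: p q m n)
    then have comm: "app \<sigma> c (app \<mu> c d) = app \<tau> c (app \<nu> c d)" if "c \<in> Obj C" "d \<in> omap D c" for c d
      using app_Cmp[OF mu si that] app_Cmp[OF nu ta that] by simp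
    define k where "k = mk_trans C D W (\<lambda>c d. pr (app \<mu> c d, app \<nu> c d))"
    have kA: "pr (app \<mu> c d, app \<nu> c d) \<in> A c" if "c \<in> Obj C" "d \<in> omap D c" for c d
      using app_in[OF mu that] app_in[OF nu that] comm[OF that] by (simp add: AI)
    have k: "nat_trans (op_cat C) set_cat D W k"
      unfolding k_def
    proof (rule nat_trans_mk_trans[OF C D' W])
      show "pr (app \<mu> c d, app \<nu> c d) \<in> omap W c" if "c \<in> Obj C" "d \<in> omap D c" for c d
        using kA[OF that] Wo[OF that(1)] by simp
      show "pr (app \<mu> x (restr D f d), app \<nu> x (restr D f d)) = restr W f (pr (app \<mu> y d, app \<nu> y d))"
        if f: "f \<in> hom C x y" and d: "d \<in> omap D y" for f x y d
        by (simp add: Wr[OF f kA[OF hom_obj_cod[OF f] d]] app_natural[OF mu f d] app_natural[OF nu f d])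
    qed
    have app_k: "app k c d = pr (app \<mu> c d, app \<nu> c d)" if "c \<in> Obj C" "d \<in> omap D c" for c d
      using that by (simp add: k_def)
    have uk: "(\<lambda>c \<in> Obj C. u c \<cdot>\<^bsub>set_cat\<^esub> k c) = \<mu>"
      by (rule presheaf_trans_cong[OF nat_trans_set_Cmp[OF k u] mu])
        (simp add: app_Cmp[OF k u] app_k app_u kA)
    have vk: "(\<lambda>c \<in> Obj C. v c \<cdot>\<^bsub>set_cat\<^esub> k c) = \<nu>"
      by (rule presheaf_trans_cong[OF nat_trans_set_Cmp[OF k v] nu])
        (simp add: app_Cmp[OF k v] app_k app_v kA)
    show "\<exists>!l. l \<in> hom (sheaf_cat C J) D W \<and> (W, u, P) \<cdot>\<^bsub>sheaf_cat C J\<^esub> l = m \<and>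
        (W, v, Q) \<cdot>\<^bsub>sheaf_cat C J\<^esub> l = n"
    proof (rule ex1I)
      show "(D, k, W) \<in> hom (sheaf_cat C J) D W \<and> (W, u, P) \<cdot>\<^bsub>sheaf_cat C J\<^esub> (D, k, W) = m \<and>
        (W, v, Q) \<cdot>\<^bsub>sheaf_cat C J\<^esub> (D, k, W) = n"
        using D W_sheaf k uk vk by (simp add: hom_sheaf_cat m n)
    next
      fix l assume l: "l \<in> hom (sheaf_cat C J) D W \<and> (W, u, P) \<cdot>\<^bsub>sheaf_cat C J\<^esub> l = m \<and>
        (W, v, Q) \<cdot>\<^bsub>sheaf_cat C J\<^esub> l = n"
      then obtain \<xi> where l': "l = (D, \<xi>, W)" and la: "nat_trans (op_cat C) set_cat D W \<xi>"
        by (auto simp: hom_sheaf_cat)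
      have ul: "(\<lambda>c \<in> Obj C. u c \<cdot>\<^bsub>set_cat\<^esub> \<xi> c) = \<mu>" and vl: "(\<lambda>c \<in> Obj C. v c \<cdot>\<^bsub>set_cat\<^esub> \<xi> c) = \<nu>"
        using l by (simp_all add: l' m n)
      have "\<xi> = k"
      proof (rule presheaf_trans_cong[OF la k])
        fix c d assume c: "c \<in> Obj C" and d: "d \<in> omap D c"
        from AE[of "app \<xi> c d" c] app_in[OF la c d]
        obtain s t where st: "app \<xi> c d = pr (s, t)" "pr (s, t) \<in> A c"
          unfolding Wo[OF c] by (metis)
        have "app \<mu> c d = s" "app \<nu> c d = t"
          using app_Cmp[OF la u c d] app_Cmp[OF la v c d] st
          by (simp_all add: ul vl app_u[OF c] app_v[OF c])
        then show "app \<xi> c d = app k c d" using st by (simp add: app_k[OF c d])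
      qed
      then show "l = (D, k, W)" by (simp add: l')
    qed
  qed
  then show "\<exists>w u v. pullback (sheaf_cat C J) P Q p q w u v" by blast
qed

lemma grothendieck_toposE:
  assumes "grothendieck_topos TYPE('u) E"
  obtains C :: "('u, 'u) cat" and J where "category C" "grothendieck_topology C J"
    "equivalent_categories E (sheaf_cat C J)"
  using assms unfolding grothendieck_topos_def small_site_def by (elim exE conjE)

lemma topos_has_terminal:
  assumes U: "inaccessible_universe TYPE('u)" and E: "grothendieck_topos TYPE('u) E"
  shows "\<exists>t. terminal E t"
proof -
  from E obtain C :: "('u, 'u) cat" and J where "category C" "grothendieck_topology C J"
    and eq: "equivalent_categories E (sheaf_cat C J)"
    by (rule grothendieck_toposE)
  with sheaf_cat_has_terminal[OF U] obtain t where "terminal (sheaf_cat C J) t" by blast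
  with eq show ?thesis by (rule equivalent_has_terminal)
qed

lemma topos_has_pullbacks:
  assumes U: "inaccessible_universe TYPE('u)" and E: "grothendieck_topos TYPE('u) E"
  shows "has_pullbacks E"
proof -
  from E obtain C :: "('u, 'u) cat" and J where C: "category C" and J: "grothendieck_topology C J"
    and eq: "equivalent_categories E (sheaf_cat C J)"
    by (rule grothendieck_toposE)
  from eq sheaf_cat_has_pullbacks[OF U C J] show ?thesis by (rule equivalent_has_pullbacks)
qed

lemma topos_category: "grothendieck_topos TYPE('u) E \<Longrightarrow> category E"
  unfolding grothendieck_topos_def equivalent_categories_def by (elim exE conjE)

text \<open>
  A terminal object is a limit of the empty diagram; the arrows of a cone over that diagram are
  not constrained.
\<close>

lemma preserves_finite_limits_terminal:
  assumes C: "category C" and T: "is_functor C D T" and pres: "preserves_finite_limits C D T"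
    and t: "terminal C t"
  shows "terminal D (omap T t)"
proof -
  define I :: "(nat, nat) cat" where
    "I = \<lparr>Obj = {}, Arr = {}, Dom = id, Cod = id, Idt = id, Cmp = (\<lambda>_ _. 0)\<rparr>"
  have I: "category I" by standard (auto simp: I_def hom_def)
  define G where "G = \<lparr>omap = (\<lambda>_::nat. undefined :: 'a), amap = (\<lambda>_::nat. undefined :: 'b)\<rparr>"
  have G: "is_functor I C G" using C I by (simp add: is_functor_def I_def G_def)
  have "limit_cone I C G t \<pi>" for \<pi>
    unfolding limit_cone_def cone_def
    using G t by (auto simp: terminal_def I_def)
  then have "limit_cone I D (comp_functor I T G) (omap T t) (\<lambda>i. amap T (undefined i))"
    using pres unfolding preserves_finite_limits_def by (auto simp: I_def)
  then have lim: "\<And>d \<rho>. cone I D (comp_functor I T G) d \<rho> \<Longrightarrow> \<exists>!h. h \<in> hom D d (omap T t)"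
    and t': "omap T t \<in> Obj D"
    unfolding limit_cone_def cone_def by (auto simp: I_def)
  have "cone I D (comp_functor I T G) d undefined" if "d \<in> Obj D" for d
    unfolding cone_def using is_functor_comp[OF G T] that by (simp add: I_def)
  with lim t' show ?thesis unfolding terminal_def by blast
qed

section \<open>Slices\<close>

lemma Obj_slice: "x \<in> Obj (slice C c) \<longleftrightarrow> x \<in> Arr C \<and> Cod C x = c"
  by (simp add: slice_def)

lemma Obj_slice_hom: "x \<in> Obj (slice C c) \<longleftrightarrow> x \<in> hom C (Dom C x) c"
  by (auto simp: slice_def hom_def)

lemma hom_slice_iff:
  "(x', u, y') \<in> hom (slice C c) x y \<longleftrightarrow> x' = x \<and> y' = y \<and> x \<in> Obj (slice C c) \<and> y \<in> Obj (slice C c) \<and>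
     u \<in> hom C (Dom C x) (Dom C y) \<and> y \<cdot>\<^bsub>C\<^esub> u = x"
  by (auto simp: slice_def hom_def)

lemma hom_sliceE:
  assumes "t \<in> hom (slice C c) x y"
  obtains u where "t = (x, u, y)" "u \<in> hom C (Dom C x) (Dom C y)" "y \<cdot>\<^bsub>C\<^esub> u = x"
  using assms by (cases t) (auto simp: hom_slice_iff)

text \<open>
  Arrows of a slice are triples; the middle entry is the underlying arrow of the ambient category.
\<close>

definition und :: "'m \<times> 'm \<times> 'm \<Rightarrow> 'm" where
  "und t = fst (snd t)"

lemma und_simp [simp]: "und (x, u, y) = u"
  by (simp add: und_def)

lemma und_slice:
  assumes "t \<in> hom (slice C c) x y"
  shows und_eq: "t = (x, und t, y)"
    and und_hom: "und t \<in> hom C (Dom C x) (Dom C y)"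
    and und_over: "y \<cdot>\<^bsub>C\<^esub> und t = x"
  using assms by (auto elim!: hom_sliceE)

lemma slice_simps [simp]:
  "Dom (slice C c) (x, u, y) = x" "Cod (slice C c) (x, u, y) = y"
  "Idt (slice C c) x = (x, Idt C (Dom C x), x)"
  "(y', v, z) \<cdot>\<^bsub>slice C c\<^esub> (x, u, y) = (x, v \<cdot>\<^bsub>C\<^esub> u, z)"
  by (simp_all add: slice_def)

lemma und_Cmp [simp]: "und (t \<cdot>\<^bsub>slice C c\<^esub> s) = und t \<cdot>\<^bsub>C\<^esub> und s"
  by (cases s; cases t) simp

context category
begin

lemma category_slice: "category (slice C c)"
proof
  fix t x y
  show "t \<in> Arr (slice C c) \<Longrightarrow> Dom (slice C c) t \<in> Obj (slice C c)"
    "t \<in> Arr (slice C c) \<Longrightarrow> Cod (slice C c) t \<in> Obj (slice C c)"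
    by (auto simp: slice_def)
  show "x \<in> Obj (slice C c) \<Longrightarrow> Idt (slice C c) x \<in> hom (slice C c) x x"
    by (simp add: hom_slice_iff)
      (simp add: Obj_slice Idt_in Dom_in Cmp_Idt_right[OF Arr_hom])
  show "t \<cdot>\<^bsub>slice C c\<^esub> Idt (slice C c) x = t" "Idt (slice C c) y \<cdot>\<^bsub>slice C c\<^esub> t = t"
    if "t \<in> hom (slice C c) x y"
    using that by (auto elim!: hom_sliceE simp: Cmp_Idt_left Cmp_Idt_right)
next
  fix s t x y z assume s: "s \<in> hom (slice C c) x y" and t: "t \<in> hom (slice C c) y z"
  from s obtain u where u: "s = (x, u, y)" "u \<in> hom C (Dom C x) (Dom C y)" "y \<cdot>\<^bsub>C\<^esub> u = x" by (rule hom_sliceE)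
  from t obtain v where v: "t = (y, v, z)" "v \<in> hom C (Dom C y) (Dom C z)" "z \<cdot>\<^bsub>C\<^esub> v = y" by (rule hom_sliceE)
  have x: "x \<in> Obj (slice C c)" and z: "z \<in> Obj (slice C c)"
    using s t unfolding u v by (simp_all add: hom_slice_iff)
  show "t \<cdot>\<^bsub>slice C c\<^esub> s \<in> hom (slice C c) x z"
    using Cmp_assoc[OF u(2) v(2) z[unfolded Obj_slice_hom]]
    by (simp add: u(1) v(1) hom_slice_iff x z Cmp_in[OF u(2) v(2)] u(3) v(3))
next
  fix r s t w x y z
  assume "r \<in> hom (slice C c) w x" "s \<in> hom (slice C c) x y" "t \<in> hom (slice C c) y z"
  then show "t \<cdot>\<^bsub>slice C c\<^esub> (s \<cdot>\<^bsub>slice C c\<^esub> r) = (t \<cdot>\<^bsub>slice C c\<^esub> s) \<cdot>\<^bsub>slice C c\<^esub> r"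
    by (elim hom_sliceE) (simp add: Cmp_assoc)
qed

lemma iso_sliceI:
  assumes t: "(x, u, y) \<in> hom (slice C c) x y" and u: "iso_arr C u"
  shows "iso_arr (slice C c) (x, u, y)"
proof (rule iso_arrI[OF t])
  from t have uh: "u \<in> hom C (Dom C x) (Dom C y)" and yu: "y \<cdot>\<^bsub>C\<^esub> u = x"
    and x: "x \<in> Obj (slice C c)" and y: "y \<in> Obj (slice C c)"
    by (simp_all add: hom_slice_iff)
  note yh = y[unfolded Obj_slice_hom]
  show "(y, inv_arr C u, x) \<in> hom (slice C c) y x"
    using cancel_inv_right[OF u uh yh] by (simp add: hom_slice_iff x y inv_arr_hom[OF u uh] yu)
  show "(y, inv_arr C u, x) \<cdot>\<^bsub>slice C c\<^esub> (x, u, y) = Idt (slice C c) x"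
    "(x, u, y) \<cdot>\<^bsub>slice C c\<^esub> (y, inv_arr C u, x) = Idt (slice C c) y"
    by (simp_all add: inv_arr[OF u uh])
qed

lemma iso_sliceD:
  assumes t: "t \<in> hom (slice C c) x y" and iso: "iso_arr (slice C c) t"
  shows "iso_arr C (und t)"
proof -
  from t obtain u where u: "t = (x, u, y)" "u \<in> hom C (Dom C x) (Dom C y)" by (rule hom_sliceE)
  note i = inv_arr[OF iso t]
  from i(1) obtain v where v: "inv_arr (slice C c) t = (y, v, x)" "v \<in> hom C (Dom C y) (Dom C x)"
    by (rule hom_sliceE)
  have "iso_arr C u"
    by (rule iso_arrI[OF u(2) v(2)]) (use i(2,3) in \<open>simp_all add: v(1)[unfolded u(1)] u(1)\<close>)
  then show ?thesis by (simp add: u(1))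
qed

text \<open>The identity of \<open>c\<close> is terminal over \<open>c\<close>, so the terminal objects are the isomorphisms.\<close>

lemma terminal_slice_iso:
  assumes c: "c \<in> Obj C"
  shows "terminal (slice C c) t \<longleftrightarrow> t \<in> Obj (slice C c) \<and> iso_arr C t"
proof safe
  assume t: "terminal (slice C c) t"
  then show to: "t \<in> Obj (slice C c)" by (rule terminal_obj)
  note th = to[unfolded Obj_slice_hom]
  have idc: "Idt C c \<in> Obj (slice C c)" using Idt_in[OF c] by (simp add: Obj_slice hom_def)
  have d: "Dom C (Idt C c) = c" by (rule hom_Dom[OF Idt_in[OF c]])
  from terminal_ex[OF t idc] obtain w where "w \<in> hom (slice C c) (Idt C c) t" by blast
  then obtain s where s: "s \<in> hom C c (Dom C t)" "t \<cdot>\<^bsub>C\<^esub> s = Idt C c"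
    by (auto elim: hom_sliceE simp: d)
  have "(t, s \<cdot>\<^bsub>C\<^esub> t, t) \<in> hom (slice C c) t t"
    by (simp add: hom_slice_iff to Cmp_in[OF th s(1)] Cmp_assoc[OF th s(1) th] s(2) Cmp_Idt_left[OF th])
  moreover have "(t, Idt C (Dom C t), t) \<in> hom (slice C c) t t"
    using category.Idt_in[OF category_slice to] by simp
  ultimately have "s \<cdot>\<^bsub>C\<^esub> t = Idt C (Dom C t)"
    using category.terminal_eq[OF category_slice t] by blast
  then show "iso_arr C t" by (rule iso_arrI[OF th s(1) _ s(2)])
next
  assume to: "t \<in> Obj (slice C c)" and iso: "iso_arr C t"
  note th = to[unfolded Obj_slice_hom]
  have "\<exists>!w. w \<in> hom (slice C c) x t" if x: "x \<in> Obj (slice C c)" for x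
  proof (rule ex_ex1I)
    note xh = x[unfolded Obj_slice_hom]
    have "(x, inv_arr C t \<cdot>\<^bsub>C\<^esub> x, t) \<in> hom (slice C c) x t"
      by (simp add: hom_slice_iff x to Cmp_in[OF xh inv_arr_hom[OF iso th]] cancel_inv_left'[OF iso th xh])
    then show "\<exists>w. w \<in> hom (slice C c) x t" by blast
    fix v w assume "v \<in> hom (slice C c) x t" "w \<in> hom (slice C c) x t"
    then obtain v' w' where v: "v = (x, v', t)" "v' \<in> hom C (Dom C x) (Dom C t)" "t \<cdot>\<^bsub>C\<^esub> v' = x"
      and w: "w = (x, w', t)" "w' \<in> hom C (Dom C x) (Dom C t)" "t \<cdot>\<^bsub>C\<^esub> w' = x"
      by (elim hom_sliceE) blast
    then show "v = w" using cancel_inv_left[OF iso th v(2)] cancel_inv_left[OF iso th w(2)] by simp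
  qed
  with to show "terminal (slice C c) t" unfolding terminal_def by blast
qed

lemma omap_postcomp: "h \<in> hom C c d \<Longrightarrow> x \<in> Obj (slice C c) \<Longrightarrow> omap (postcomp C h) x = h \<cdot>\<^bsub>C\<^esub> x"
  by (simp add: postcomp_def hom_Dom)

lemma amap_postcomp:
  "h \<in> hom C c d \<Longrightarrow> (x, u, y) \<in> hom (slice C c) x y \<Longrightarrow>
    amap (postcomp C h) (x, u, y) = (h \<cdot>\<^bsub>C\<^esub> x, u, h \<cdot>\<^bsub>C\<^esub> y)"
  by (simp add: postcomp_def hom_Dom) (simp add: hom_def)

lemma postcomp_obj: "h \<in> hom C c d \<Longrightarrow> x \<in> Obj (slice C c) \<Longrightarrow> h \<cdot>\<^bsub>C\<^esub> x \<in> Obj (slice C d)"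
  and Dom_postcomp: "h \<in> hom C c d \<Longrightarrow> x \<in> Obj (slice C c) \<Longrightarrow> Dom C (h \<cdot>\<^bsub>C\<^esub> x) = Dom C x"
  using Cmp_in[of x "Dom C x" c h d] by (auto simp: Obj_slice hom_def)

lemma postcomp_hom:
  assumes h: "h \<in> hom C c d" and t: "(x, u, y) \<in> hom (slice C c) x y"
  shows "(h \<cdot>\<^bsub>C\<^esub> x, u, h \<cdot>\<^bsub>C\<^esub> y) \<in> hom (slice C d) (h \<cdot>\<^bsub>C\<^esub> x) (h \<cdot>\<^bsub>C\<^esub> y)"
proof -
  from t have u: "u \<in> hom C (Dom C x) (Dom C y)" and yu: "y \<cdot>\<^bsub>C\<^esub> u = x"
    and x: "x \<in> Obj (slice C c)" and y: "y \<in> Obj (slice C c)"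
    by (simp_all add: hom_slice_iff)
  show ?thesis
    by (simp add: hom_slice_iff postcomp_obj[OF h] Dom_postcomp[OF h] x y u yu
        Cmp_assoc[OF u y[unfolded Obj_slice_hom] h, symmetric])
qed

lemma und_postcomp:
  assumes h: "h \<in> hom C c d" and t: "t \<in> hom (slice C c) x y"
  shows "und (amap (postcomp C h) t) = und t"
proof -
  from t obtain u where u: "t = (x, u, y)" by (rule hom_sliceE)
  show ?thesis unfolding u by (simp add: amap_postcomp[OF h t[unfolded u]])
qed

lemma is_functor_postcomp:
  assumes h: "h \<in> hom C c d"
  shows "is_functor (slice C c) (slice C d) (postcomp C h)"
proof (rule is_functorI)
  show "category (slice C c)" "category (slice C d)" by (rule category_slice)+
  show "omap (postcomp C h) \<in> extensional (Obj (slice C c))"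
    "amap (postcomp C h) \<in> extensional (Arr (slice C c))"
    by (simp_all add: postcomp_def hom_Dom[OF h])
  fix x assume x: "x \<in> Obj (slice C c)"
  show "omap (postcomp C h) x \<in> Obj (slice C d)"
    by (simp add: omap_postcomp[OF h x] postcomp_obj[OF h x])
  show "amap (postcomp C h) (Idt (slice C c) x) = Idt (slice C d) (omap (postcomp C h) x)"
    using category.Idt_in[OF category_slice x]
    by (simp add: amap_postcomp[OF h] omap_postcomp[OF h x] Dom_postcomp[OF h x])
next
  fix t x y assume t: "t \<in> hom (slice C c) x y"
  from t obtain u where u: "t = (x, u, y)" by (rule hom_sliceE)
  have "x \<in> Obj (slice C c)" "y \<in> Obj (slice C c)" using t by (simp_all add: u hom_slice_iff)
  then show "amap (postcomp C h) t \<in> hom (slice C d) (omap (postcomp C h) x) (omap (postcomp C h) y)"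
    using postcomp_hom[OF h t[unfolded u]] by (simp add: u amap_postcomp[OF h t[unfolded u]] omap_postcomp[OF h])
next
  fix s t x y z assume s: "s \<in> hom (slice C c) x y" and t: "t \<in> hom (slice C c) y z"
  from s obtain u where u: "s = (x, u, y)" by (rule hom_sliceE)
  from t obtain v where v: "t = (y, v, z)" by (rule hom_sliceE)
  show "amap (postcomp C h) (t \<cdot>\<^bsub>slice C c\<^esub> s) = amap (postcomp C h) t \<cdot>\<^bsub>slice C d\<^esub> amap (postcomp C h) s"
    using category.Cmp_in[OF category_slice s t]
    by (simp add: u v amap_postcomp[OF h s[unfolded u]] amap_postcomp[OF h t[unfolded v]] amap_postcomp[OF h])
qed

end

section \<open>Split opfibrations and their total categories\<close>

text \<open>
  Split means that the pushforwards compose strictly.  Canonical stacks have this property, since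
  postcomposition is strictly associative.
\<close>

locale split_opfibration =
  fixes B :: "('ob, 'mb) cat" and S :: "('ob, 'mb, 'o, 'm) opfib"
  assumes base: "category B"
    and fiber: "b \<in> Obj B \<Longrightarrow> category (Fib S b)"
    and push: "g \<in> hom B b b' \<Longrightarrow> is_functor (Fib S b) (Fib S b') (Push S g)"
    and push_Idt_obj: "b \<in> Obj B \<Longrightarrow> x \<in> Obj (Fib S b) \<Longrightarrow> omap (Push S (Idt B b)) x = x"
    and push_Idt_arr: "b \<in> Obj B \<Longrightarrow> v \<in> Arr (Fib S b) \<Longrightarrow> amap (Push S (Idt B b)) v = v"
    and push_Cmp_obj: "g \<in> hom B b b' \<Longrightarrow> h \<in> hom B b' b'' \<Longrightarrow> x \<in> Obj (Fib S b) \<Longrightarrow>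
      omap (Push S (h \<cdot>\<^bsub>B\<^esub> g)) x = omap (Push S h) (omap (Push S g) x)"
    and push_Cmp_arr: "g \<in> hom B b b' \<Longrightarrow> h \<in> hom B b' b'' \<Longrightarrow> v \<in> Arr (Fib S b) \<Longrightarrow>
      amap (Push S (h \<cdot>\<^bsub>B\<^esub> g)) v = amap (Push S h) (amap (Push S g) v)"

lemma total_cat_simps [simp]:
  "Dom (total_cat B S) (p, gv, q) = p" "Cod (total_cat B S) (p, gv, q) = q"
  "Idt (total_cat B S) (b, x) = ((b, x), (Idt B b, Idt (Fib S b) x), (b, x))"
  "(q', (h, w), (b'', x'')) \<cdot>\<^bsub>total_cat B S\<^esub> (p, (g, v), q) =
     (p, (h \<cdot>\<^bsub>B\<^esub> g, w \<cdot>\<^bsub>Fib S b''\<^esub> amap (Push S h) v), (b'', x''))"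
  by (simp_all add: total_cat_def)

lemma Obj_total: "(b, x) \<in> Obj (total_cat B S) \<longleftrightarrow> b \<in> Obj B \<and> x \<in> Obj (Fib S b)"
  by (simp add: total_cat_def)

lemma hom_total_iff:
  "(p', (g, v), q') \<in> hom (total_cat B S) (b, x) (b', x') \<longleftrightarrow> p' = (b, x) \<and> q' = (b', x') \<and>
     g \<in> hom B b b' \<and> x \<in> Obj (Fib S b) \<and> x' \<in> Obj (Fib S b') \<and>
     v \<in> hom (Fib S b') (omap (Push S g) x) x'"
  by (auto simp: total_cat_def hom_def)

lemma hom_totalE:
  assumes "t \<in> hom (total_cat B S) (b, x) (b', x')"
  obtains g v where "t = ((b, x), (g, v), (b', x'))" "g \<in> hom B b b'" "x \<in> Obj (Fib S b)"
    "x' \<in> Obj (Fib S b')" "v \<in> hom (Fib S b') (omap (Push S g) x) x'"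
proof -
  obtain p g v q where t: "t = (p, (g, v), q)" by (cases t) auto
  show thesis using assms that unfolding t hom_total_iff by blast
qed

context split_opfibration
begin

sublocale B: category B by (rule base)

lemma fiber_cod: "g \<in> hom B b b' \<Longrightarrow> category (Fib S b')"
  by (rule fiber[OF B.hom_obj_cod])

lemma total_Cmp_in:
  assumes g: "g \<in> hom B b b'" and h: "h \<in> hom B b' b''" and x: "x \<in> Obj (Fib S b)"
    and v: "v \<in> hom (Fib S b') (omap (Push S g) x) x'"
    and w: "w \<in> hom (Fib S b'') (omap (Push S h) x') x''"
  shows "w \<cdot>\<^bsub>Fib S b''\<^esub> amap (Push S h) v \<in> hom (Fib S b'') (omap (Push S (h \<cdot>\<^bsub>B\<^esub> g)) x) x''"
  unfolding push_Cmp_obj[OF g h x]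
  by (rule category.Cmp_in[OF fiber_cod[OF h] functor_hom[OF push[OF h] v] w])

lemma category_total: "category (total_cat B S)"
proof
  fix t assume "t \<in> Arr (total_cat B S)"
  then show "Dom (total_cat B S) t \<in> Obj (total_cat B S)" "Cod (total_cat B S) t \<in> Obj (total_cat B S)"
    using B.hom_obj_dom B.hom_obj_cod by (auto simp: total_cat_def)
next
  fix p assume p: "p \<in> Obj (total_cat B S)"
  obtain b x where bx: "p = (b, x)" by fastforce
  then show "Idt (total_cat B S) p \<in> hom (total_cat B S) p p"
    using p by (simp add: hom_total_iff Obj_total B.Idt_in push_Idt_obj category.Idt_in[OF fiber])
next
  fix s t p q r assume s: "s \<in> hom (total_cat B S) p q" and t: "t \<in> hom (total_cat B S) q r"
  obtain b x b' x' b'' x'' where pqr: "p = (b, x)" "q = (b', x')" "r = (b'', x'')"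
    by (metis surj_pair)
  from s[unfolded pqr] obtain g v where g: "s = ((b, x), (g, v), (b', x'))" "g \<in> hom B b b'"
    "x \<in> Obj (Fib S b)" "x' \<in> Obj (Fib S b')" "v \<in> hom (Fib S b') (omap (Push S g) x) x'"
    by (rule hom_totalE)
  from t[unfolded pqr] obtain h w where h: "t = ((b', x'), (h, w), (b'', x''))" "h \<in> hom B b' b''"
    "x' \<in> Obj (Fib S b')" "x'' \<in> Obj (Fib S b'')" "w \<in> hom (Fib S b'') (omap (Push S h) x') x''"
    by (rule hom_totalE)
  show "t \<cdot>\<^bsub>total_cat B S\<^esub> s \<in> hom (total_cat B S) p r"
    using total_Cmp_in[OF g(2) h(2) g(3,5) h(5)]
    by (simp add: g(1) h(1) pqr hom_total_iff B.Cmp_in[OF g(2) h(2)] g(3) h(4))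
next
  fix t p q assume t: "t \<in> hom (total_cat B S) p q"
  obtain b x b' x' where pq: "p = (b, x)" "q = (b', x')" by (metis surj_pair)
  from t[unfolded pq] obtain g v where g: "t = ((b, x), (g, v), (b', x'))" "g \<in> hom B b b'"
    "x \<in> Obj (Fib S b)" "x' \<in> Obj (Fib S b')" "v \<in> hom (Fib S b') (omap (Push S g) x) x'"
    by (rule hom_totalE)
  interpret Fc: category "Fib S b'" using fiber_cod[OF g(2)] .
  show "t \<cdot>\<^bsub>total_cat B S\<^esub> Idt (total_cat B S) p = t"
    by (simp add: pq g(1) B.Cmp_Idt_right[OF g(2)] functor_Idt[OF push[OF g(2)] g(3)] Fc.Cmp_Idt_right[OF g(5)])
  show "Idt (total_cat B S) q \<cdot>\<^bsub>total_cat B S\<^esub> t = t"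
    by (simp add: pq g(1) B.Cmp_Idt_left[OF g(2)] push_Idt_arr[OF B.hom_obj_cod[OF g(2)] hom_Arr[OF g(5)]]
        Fc.Cmp_Idt_left[OF g(5)])
next
  fix t1 t2 t3 p1 p2 p3 p4
  assume t1: "t1 \<in> hom (total_cat B S) p1 p2" and t2: "t2 \<in> hom (total_cat B S) p2 p3"
    and t3: "t3 \<in> hom (total_cat B S) p3 p4"
  obtain b1 x1 b2 x2 b3 x3 b4 x4 where p: "p1 = (b1, x1)" "p2 = (b2, x2)" "p3 = (b3, x3)" "p4 = (b4, x4)"
    by (metis surj_pair)
  from t1[unfolded p] obtain g1 v1 where g1: "t1 = ((b1, x1), (g1, v1), (b2, x2))" "g1 \<in> hom B b1 b2"
    "v1 \<in> hom (Fib S b2) (omap (Push S g1) x1) x2"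
    by (rule hom_totalE)
  from t2[unfolded p] obtain g2 v2 where g2: "t2 = ((b2, x2), (g2, v2), (b3, x3))" "g2 \<in> hom B b2 b3"
    "v2 \<in> hom (Fib S b3) (omap (Push S g2) x2) x3"
    by (rule hom_totalE)
  from t3[unfolded p] obtain g3 v3 where g3: "t3 = ((b3, x3), (g3, v3), (b4, x4))" "g3 \<in> hom B b3 b4"
    "v3 \<in> hom (Fib S b4) (omap (Push S g3) x3) x4"
    by (rule hom_totalE)
  interpret F4: category "Fib S b4" using fiber_cod[OF g3(2)] .
  note P2 = functor_hom[OF push[OF g2(2)] g1(3)]
  show "t3 \<cdot>\<^bsub>total_cat B S\<^esub> (t2 \<cdot>\<^bsub>total_cat B S\<^esub> t1) = (t3 \<cdot>\<^bsub>total_cat B S\<^esub> t2) \<cdot>\<^bsub>total_cat B S\<^esub> t1"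
    by (simp add: g1(1) g2(1) g3(1) B.Cmp_assoc[OF g1(2) g2(2) g3(2)]
        functor_Cmp[OF push[OF g3(2)] P2 g2(3)] push_Cmp_arr[OF g2(2) g3(2) hom_Arr[OF g1(3)]]
        F4.Cmp_assoc[OF functor_hom[OF push[OF g3(2)] P2] functor_hom[OF push[OF g3(2)] g2(3)] g3(3)])
qed

lemma iso_total_vertical:
  assumes b: "b \<in> Obj B" and v: "v \<in> hom (Fib S b) x y" "iso_arr (Fib S b) v"
  shows "iso_arr (total_cat B S) ((b, x), (Idt B b, v), (b, y))"
proof (rule iso_arrI)
  interpret Fb: category "Fib S b" using fiber[OF b] .
  note x = Fb.hom_obj_dom[OF v(1)] and y = Fb.hom_obj_cod[OF v(1)]
  note i = inv_arr[OF v(2,1)]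
  show "((b, x), (Idt B b, v), (b, y)) \<in> hom (total_cat B S) (b, x) (b, y)"
    "((b, y), (Idt B b, inv_arr (Fib S b) v), (b, x)) \<in> hom (total_cat B S) (b, y) (b, x)"
    using b v i x y by (simp_all add: hom_total_iff B.Idt_in push_Idt_obj)
  show "((b, y), (Idt B b, inv_arr (Fib S b) v), (b, x)) \<cdot>\<^bsub>total_cat B S\<^esub> ((b, x), (Idt B b, v), (b, y)) =
      Idt (total_cat B S) (b, x)"
    "((b, x), (Idt B b, v), (b, y)) \<cdot>\<^bsub>total_cat B S\<^esub> ((b, y), (Idt B b, inv_arr (Fib S b) v), (b, x)) =
      Idt (total_cat B S) (b, y)"
    using b by (simp_all add: B.Cmp_Idt_left[OF B.Idt_in[OF b]] push_Idt_arr hom_Arr[OF v(1)] hom_Arr[OF i(1)] i)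
qed

lemma vertical_iff:
  "t \<in> hom (total_cat B S) (b, x) (b', x') \<Longrightarrow> vertical B S t \<longleftrightarrow> fst (fst (snd t)) = Idt B b"
  unfolding vertical_def by (auto elim!: hom_totalE simp: hom_Arr hom_total_iff dest: hom_Arr)

lemma vertical_Idt: "p \<in> Obj (total_cat B S) \<Longrightarrow> vertical B S (Idt (total_cat B S) p)"
  using category.Idt_in[OF category_total, of p] by (cases p) (simp add: vertical_iff)

lemma vertical_Cmp:
  assumes s: "s \<in> hom (total_cat B S) (b, x) (b, y)" and t: "t \<in> hom (total_cat B S) (b, y) (b, z)"
    and vs: "vertical B S s" and vt: "vertical B S t"
  shows "vertical B S (t \<cdot>\<^bsub>total_cat B S\<^esub> s)"
proof -
  note st = category.Cmp_in[OF category_total s t]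
  from s obtain g v where g: "s = ((b, x), (g, v), (b, y))" "g \<in> hom B b b" by (rule hom_totalE)
  from t obtain h w where h: "t = ((b, y), (h, w), (b, z))" "h \<in> hom B b b" by (rule hom_totalE)
  have "g = Idt B b" "h = Idt B b"
    using vs vt unfolding vertical_iff[OF s] vertical_iff[OF t] by (simp_all add: g h)
  then have "h \<cdot>\<^bsub>B\<^esub> g = Idt B b" using B.Cmp_Idt_left[OF g(2)] by simp
  then show ?thesis unfolding vertical_iff[OF st] by (simp add: g(1) h(1))
qed

text \<open>
  The base component of the inverse is an inverse of an identity, hence an identity.
\<close>

lemma vertical_inv_arr:
  assumes t: "t \<in> hom (total_cat B S) (b, x) (b, y)" and iso: "iso_arr (total_cat B S) t"
    and vt: "vertical B S t"
  shows "vertical B S (inv_arr (total_cat B S) t)"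
proof -
  from t obtain g v where g: "t = ((b, x), (g, v), (b, y))" "g \<in> hom B b b" by (rule hom_totalE)
  note ih = inv_arr_hom[OF iso t]
  from ih obtain h w where h: "inv_arr (total_cat B S) t = ((b, y), (h, w), (b, x))" "h \<in> hom B b b"
    by (rule hom_totalE)
  have "g = Idt B b" using vt unfolding vertical_iff[OF t] by (simp add: g)
  moreover have "h \<cdot>\<^bsub>B\<^esub> g = Idt B b"
    using inv_arr_left[OF iso t] unfolding h(1) by (simp add: g)
  ultimately have "h = Idt B b" using B.Cmp_Idt_right[OF h(2)] by simp
  then show ?thesis unfolding vertical_iff[OF ih] by (simp add: h)
qed

end

lemma opfib_term_morphismD:
  assumes "opfib_term_morphism B S' S A"
  shows opfib_mor_adj: "b \<in> Obj B \<Longrightarrow> adjunction (Fib S' b) (Fib S b) (adjs A b)"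
    and opfib_mor_terminal: "b \<in> Obj B \<Longrightarrow> preserves_terminal (Fib S' b) (Fib S b) (lft (adjs A b))"
    and opfib_mor_coh: "g \<in> hom B b b' \<Longrightarrow> nat_iso (Fib S' b) (Fib S b')
          (comp_functor (Fib S' b) (Push S g) (lft (adjs A b)))
          (comp_functor (Fib S' b) (lft (adjs A b')) (Push S' g)) (coh A g)"
    and opfib_mor_coh_Idt: "b \<in> Obj B \<Longrightarrow> x \<in> Obj (Fib S' b) \<Longrightarrow>
      coh A (Idt B b) x = Idt (Fib S b) (omap (lft (adjs A b)) x)"
    and opfib_mor_coh_Cmp: "g \<in> hom B b b' \<Longrightarrow> h \<in> hom B b' b'' \<Longrightarrow> x \<in> Obj (Fib S' b) \<Longrightarrow>
      coh A (h \<cdot>\<^bsub>B\<^esub> g) x = coh A h (omap (Push S' g) x) \<cdot>\<^bsub>Fib S b''\<^esub> amap (Push S h) (coh A g x)"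
  using assms unfolding opfib_term_morphism_def by simp_all

lemma opfib_mor_lft:
  "opfib_term_morphism B S' S A \<Longrightarrow> b \<in> Obj B \<Longrightarrow> is_functor (Fib S' b) (Fib S b) (lft (adjs A b))"
  by (rule adjunction_lft[OF opfib_mor_adj])

lemma opfib_mor_coh_hom:
  assumes A: "opfib_term_morphism B S' S A" and g: "g \<in> hom B b b'" and x: "x \<in> Obj (Fib S' b)"
  shows "coh A g x \<in> hom (Fib S b') (omap (Push S g) (omap (lft (adjs A b)) x))
    (omap (lft (adjs A b')) (omap (Push S' g) x))"
  using nat_trans_hom[OF nat_iso_trans[OF opfib_mor_coh[OF A g]] x] x by simp

lemma opfib_mor_coh_natural:
  assumes A: "opfib_term_morphism B S' S A" and g: "g \<in> hom B b b'" and v: "v \<in> hom (Fib S' b) x y"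
  shows "coh A g y \<cdot>\<^bsub>Fib S b'\<^esub> amap (Push S g) (amap (lft (adjs A b)) v) =
    amap (lft (adjs A b')) (amap (Push S' g) v) \<cdot>\<^bsub>Fib S b'\<^esub> coh A g x"
  using nat_trans_natural[OF nat_iso_trans[OF opfib_mor_coh[OF A g]] v] hom_Arr[OF v] by simp

lemma omap_total_functor:
  "b \<in> Obj B \<Longrightarrow> x \<in> Obj (Fib S' b) \<Longrightarrow> omap (total_functor B S' S A) (b, x) = (b, omap (lft (adjs A b)) x)"
  by (simp add: total_functor_def Obj_total)

lemma amap_total_functor:
  assumes "((b, x), (g, v), (b', x')) \<in> hom (total_cat B S') (b, x) (b', x')"
  shows "amap (total_functor B S' S A) ((b, x), (g, v), (b', x')) =
    ((b, omap (lft (adjs A b)) x), (g, amap (lft (adjs A b')) v \<cdot>\<^bsub>Fib S b'\<^esub> coh A g x),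
     (b', omap (lft (adjs A b')) x'))"
  using hom_Arr[OF assms] by (simp add: total_functor_def)

text \<open>Functoriality on total categories is naturality and the cocycle condition of the comparison cells.\<close>

lemma is_functor_total:
  assumes S': "split_opfibration B S'" and S: "split_opfibration B S"
    and A: "opfib_term_morphism B S' S A"
  shows "is_functor (total_cat B S') (total_cat B S) (total_functor B S' S A)"
proof (rule is_functorI)
  interpret S': split_opfibration B S' by fact
  interpret S: split_opfibration B S by fact
  note L = opfib_mor_lft[OF A]
  let ?T = "total_functor B S' S A"
  show "category (total_cat B S')" "category (total_cat B S)"
    by (rule S'.category_total, rule S.category_total)
  show "omap ?T \<in> extensional (Obj (total_cat B S'))" "amap ?T \<in> extensional (Arr (total_cat B S'))"
    by (simp_all add: total_functor_def)
  fix p assume p: "p \<in> Obj (total_cat B S')"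
  obtain b x where bx: "p = (b, x)" by fastforce
  have b: "b \<in> Obj B" and x: "x \<in> Obj (Fib S' b)" using p by (simp_all add: bx Obj_total)
  interpret Fb: category "Fib S b" using S.fiber[OF b] .
  show "omap ?T p \<in> Obj (total_cat B S)"
    using b x functor_obj[OF L[OF b] x] by (simp add: bx omap_total_functor Obj_total)
  have i: "((b, x), (Idt B b, Idt (Fib S' b) x), (b, x)) \<in> hom (total_cat B S') (b, x) (b, x)"
    using category.Idt_in[OF S'.category_total p] by (simp add: bx)
  show "amap ?T (Idt (total_cat B S') p) = Idt (total_cat B S) (omap ?T p)"
    by (simp add: bx amap_total_functor[OF i] omap_total_functor[OF b x] functor_Idt[OF L[OF b] x]
        opfib_mor_coh_Idt[OF A b x] Fb.Cmp_Idt_left[OF Fb.Idt_in[OF functor_obj[OF L[OF b] x]]])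
next
  interpret S': split_opfibration B S' by fact
  interpret S: split_opfibration B S by fact
  note L = opfib_mor_lft[OF A]
  let ?T = "total_functor B S' S A"
  have coh_v: "amap (lft (adjs A b')) v \<cdot>\<^bsub>Fib S b'\<^esub> coh A g x \<in>
      hom (Fib S b') (omap (Push S g) (omap (lft (adjs A b)) x)) (omap (lft (adjs A b')) x')"
    if g: "g \<in> hom B b b'" and x: "x \<in> Obj (Fib S' b)" and v: "v \<in> hom (Fib S' b') (omap (Push S' g) x) x'"
    for g v b b' x x'
    by (rule category.Cmp_in[OF S.fiber_cod[OF g] opfib_mor_coh_hom[OF A g x]
          functor_hom[OF L[OF S'.B.hom_obj_cod[OF g]] v]])
  fix s p q assume s: "s \<in> hom (total_cat B S') p q"
  obtain b x b' x' where pq: "p = (b, x)" "q = (b', x')" by (metis surj_pair)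
  from s[unfolded pq] obtain g v where g: "s = ((b, x), (g, v), (b', x'))" "g \<in> hom B b b'"
    "x \<in> Obj (Fib S' b)" "x' \<in> Obj (Fib S' b')" "v \<in> hom (Fib S' b') (omap (Push S' g) x) x'"
    by (rule hom_totalE)
  note b = S'.B.hom_obj_dom[OF g(2)] and b' = S'.B.hom_obj_cod[OF g(2)]
  note s' = s[unfolded pq g(1)]
  show "amap ?T s \<in> hom (total_cat B S) (omap ?T p) (omap ?T q)"
    using functor_obj[OF L[OF b] g(3)] functor_obj[OF L[OF b'] g(4)]
    by (simp add: pq g(1) amap_total_functor[OF s'] omap_total_functor[OF b g(3)] omap_total_functor[OF b' g(4)]
        hom_total_iff g(2) coh_v[OF g(2,3,5)])
  fix t r assume t: "t \<in> hom (total_cat B S') q r"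
  obtain b'' x'' where r: "r = (b'', x'')" by (metis surj_pair)
  from t[unfolded pq r] obtain h w where h: "t = ((b', x'), (h, w), (b'', x''))" "h \<in> hom B b' b''"
    "x' \<in> Obj (Fib S' b')" "x'' \<in> Obj (Fib S' b'')" "w \<in> hom (Fib S' b'') (omap (Push S' h) x') x''"
    by (rule hom_totalE)
  note b'' = S'.B.hom_obj_cod[OF h(2)]
  note t' = t[unfolded pq r h(1)]
  have ts: "((b, x), (h \<cdot>\<^bsub>B\<^esub> g, w \<cdot>\<^bsub>Fib S' b''\<^esub> amap (Push S' h) v), (b'', x'')) \<in>
      hom (total_cat B S') (b, x) (b'', x'')"
    using category.Cmp_in[OF S'.category_total s t] by (simp add: pq r g(1) h(1))
  interpret F'': category "Fib S b''" using S.fiber[OF b''] .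
  let ?L = "\<lambda>b. lft (adjs A b)"
  let ?c = "\<lambda>u v. u \<cdot>\<^bsub>Fib S b''\<^esub> v"
  note Pv = functor_hom[OF S'.push[OF h(2)] g(5)]
  note LPv = functor_hom[OF L[OF b''] Pv] and Lw = functor_hom[OF L[OF b''] h(5)]
  note Pgx = functor_obj[OF S'.push[OF g(2)] g(3)]
  note c1 = opfib_mor_coh_hom[OF A h(2) Pgx] and c2 = opfib_mor_coh_hom[OF A g(2,3)]
  note c3 = opfib_mor_coh_hom[OF A h(2) h(3)]
  note Pc2 = functor_hom[OF S.push[OF h(2)] c2]
  note Lv = functor_hom[OF L[OF b'] g(5)]
  note PLv = functor_hom[OF S.push[OF h(2)] Lv]
  have "?c (amap (?L b'') (w \<cdot>\<^bsub>Fib S' b''\<^esub> amap (Push S' h) v)) (coh A (h \<cdot>\<^bsub>B\<^esub> g) x) =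
      ?c (?c (amap (?L b'') w) (amap (?L b'') (amap (Push S' h) v)))
        (?c (coh A h (omap (Push S' g) x)) (amap (Push S h) (coh A g x)))"
    by (simp add: functor_Cmp[OF L[OF b''] Pv h(5)] opfib_mor_coh_Cmp[OF A g(2) h(2) g(3)])
  also have "\<dots> = ?c (amap (?L b'') w) (?c (?c (amap (?L b'') (amap (Push S' h) v))
        (coh A h (omap (Push S' g) x))) (amap (Push S h) (coh A g x)))"
    by (simp add: F''.Cmp_assoc[OF F''.Cmp_in[OF Pc2 c1] LPv Lw, symmetric] F''.Cmp_assoc[OF Pc2 c1 LPv])
  also have "\<dots> = ?c (amap (?L b'') w) (?c (?c (coh A h x') (amap (Push S h) (amap (?L b') v)))
        (amap (Push S h) (coh A g x)))"
    by (simp add: opfib_mor_coh_natural[OF A h(2) g(5)])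
  also have "\<dots> = ?c (?c (amap (?L b'') w) (coh A h x')) (amap (Push S h)
        (amap (?L b') v \<cdot>\<^bsub>Fib S b'\<^esub> coh A g x))"
    by (simp add: functor_Cmp[OF S.push[OF h(2)] c2 Lv] F''.Cmp_assoc[OF Pc2 PLv c3, symmetric]
        F''.Cmp_assoc[OF F''.Cmp_in[OF Pc2 PLv] c3 Lw])
  finally show "amap ?T (t \<cdot>\<^bsub>total_cat B S'\<^esub> s) = amap ?T t \<cdot>\<^bsub>total_cat B S\<^esub> amap ?T s"
    by (simp add: g(1) h(1) amap_total_functor[OF s'] amap_total_functor[OF t'] amap_total_functor[OF ts])
qed

lemma total_functor_component:
  assumes "nat_trans (total_cat B S') (total_cat B S) (total_functor B S' S A) (total_functor B S' S A') \<theta>"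
    and "b \<in> Obj B" "x \<in> Obj (Fib S' b)"
  shows "\<theta> (b, x) \<in> hom (total_cat B S) (b, omap (lft (adjs A b)) x) (b, omap (lft (adjs A' b)) x)"
  using nat_trans_hom[OF assms(1), of "(b, x)"] assms(2,3) by (simp add: Obj_total omap_total_functor)

lemma category_OpfibTerm:
  assumes S': "split_opfibration B S'" and S: "split_opfibration B S"
  shows "category (OpfibTerm B S' S)"
  unfolding OpfibTerm_def
proof (rule category_transformation_cat)
  interpret S: split_opfibration B S by fact
  let ?T = "total_functor B S' S"
  show T: "is_functor (total_cat B S') (total_cat B S) (?T A)" if "A \<in> {A. opfib_term_morphism B S' S A}" for A
    using is_functor_total[OF S' S] that by simp
  show "\<forall>p \<in> Obj (total_cat B S'). vertical B S ((\<lambda>x \<in> Obj (total_cat B S'). Idt (total_cat B S) (omap (?T A) x)) p)"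
    if "A \<in> {A. opfib_term_morphism B S' S A}" for A
    using functor_obj[OF T[OF that]] S.vertical_Idt by simp
next
  interpret S: split_opfibration B S by fact
  let ?T = "total_functor B S' S"
  fix A1 A2 A3 \<sigma> \<tau>
  assume s: "nat_trans (total_cat B S') (total_cat B S) (?T A1) (?T A2) \<sigma>"
    and t: "nat_trans (total_cat B S') (total_cat B S) (?T A2) (?T A3) \<tau>"
    and v: "\<forall>p \<in> Obj (total_cat B S'). vertical B S (\<sigma> p)" "\<forall>p \<in> Obj (total_cat B S'). vertical B S (\<tau> p)"
  show "\<forall>p \<in> Obj (total_cat B S').
      vertical B S ((\<lambda>x \<in> Obj (total_cat B S'). \<tau> x \<cdot>\<^bsub>total_cat B S\<^esub> \<sigma> x) p)"
  proof (rule ballI)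
    fix p assume p: "p \<in> Obj (total_cat B S')"
    obtain b x where bx: "p = (b, x)" by fastforce
    have b: "b \<in> Obj B" and x: "x \<in> Obj (Fib S' b)" using p by (simp_all add: bx Obj_total)
    from S.vertical_Cmp[OF total_functor_component[OF s b x] total_functor_component[OF t b x]] v p
    show "vertical B S ((\<lambda>x \<in> Obj (total_cat B S'). \<tau> x \<cdot>\<^bsub>total_cat B S\<^esub> \<sigma> x) p)"
      by (simp add: bx)
  qed
qed

lemma split_opfibration_canonical_stack:
  assumes f: "is_functor F E (lft f)"
  shows "split_opfibration F (canonical_stack E f)"
proof (rule split_opfibration.intro)
  interpret F: category F using functor_dom_cat[OF f] .
  interpret E: category E using functor_cod_cat[OF f] .
  show "category F" by (rule F.category_axioms)
  fix b show "category (Fib (canonical_stack E f) b)"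
    by (simp add: canonical_stack_def E.category_slice)
  fix b' b'' g h x v
  show "is_functor (Fib (canonical_stack E f) b) (Fib (canonical_stack E f) b') (Push (canonical_stack E f) g)"
    if "g \<in> hom F b b'"
    using E.is_functor_postcomp[OF functor_hom[OF f that]] by (simp add: canonical_stack_def)
  show "omap (Push (canonical_stack E f) (Idt F b)) x = x"
    if b: "b \<in> Obj F" and x: "x \<in> Obj (Fib (canonical_stack E f) b)"
    using x E.omap_postcomp[OF E.Idt_in[OF functor_obj[OF f b]]] E.Cmp_Idt_left
    by (simp add: canonical_stack_def functor_Idt[OF f b] Obj_slice_hom)
  show "amap (Push (canonical_stack E f) (Idt F b)) v = v"
    if b: "b \<in> Obj F" and v: "v \<in> Arr (Fib (canonical_stack E f) b)"
  proof -
    have "v \<in> hom (slice E (omap (lft f) b)) (Dom (slice E (omap (lft f) b)) v) (Cod (slice E (omap (lft f) b)) v)"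
      using Arr_hom[OF v] by (simp add: canonical_stack_def)
    then obtain x u y where v': "v = (x, u, y)" "v \<in> hom (slice E (omap (lft f) b)) x y"
      by (metis hom_sliceE)
    have xy: "x \<in> Obj (slice E (omap (lft f) b))" "y \<in> Obj (slice E (omap (lft f) b))"
      using v'(2) unfolding v'(1) hom_slice_iff by auto
    show ?thesis
      using v'(2) E.amap_postcomp[OF E.Idt_in[OF functor_obj[OF f b]], of x u y]
        E.Cmp_Idt_left[OF xy(1)[unfolded Obj_slice_hom]] E.Cmp_Idt_left[OF xy(2)[unfolded Obj_slice_hom]]
      by (simp add: v'(1) canonical_stack_def functor_Idt[OF f b])
  qed
  assume g: "g \<in> hom F b b'" and h: "h \<in> hom F b' b''"
  note pg = functor_hom[OF f g] and ph = functor_hom[OF f h]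
  note phg = E.Cmp_in[OF pg ph]
  have Cmp_x: "(amap (lft f) h \<cdot>\<^bsub>E\<^esub> amap (lft f) g) \<cdot>\<^bsub>E\<^esub> x = amap (lft f) h \<cdot>\<^bsub>E\<^esub> (amap (lft f) g \<cdot>\<^bsub>E\<^esub> x)"
    if "x \<in> Obj (slice E (omap (lft f) b))" for x
    using E.Cmp_assoc[OF that[unfolded Obj_slice_hom] pg ph] by simp
  show "omap (Push (canonical_stack E f) (h \<cdot>\<^bsub>F\<^esub> g)) x =
      omap (Push (canonical_stack E f) h) (omap (Push (canonical_stack E f) g) x)"
    if "x \<in> Obj (Fib (canonical_stack E f) b)"
    using that E.omap_postcomp[OF pg] E.omap_postcomp[OF ph E.postcomp_obj[OF pg]] E.omap_postcomp[OF phg] Cmp_x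
    by (simp add: canonical_stack_def functor_Cmp[OF f g h])
  show "amap (Push (canonical_stack E f) (h \<cdot>\<^bsub>F\<^esub> g)) v =
      amap (Push (canonical_stack E f) h) (amap (Push (canonical_stack E f) g) v)"
    if v: "v \<in> Arr (Fib (canonical_stack E f) b)"
  proof -
    have "v \<in> hom (slice E (omap (lft f) b)) (Dom (slice E (omap (lft f) b)) v) (Cod (slice E (omap (lft f) b)) v)"
      using Arr_hom[OF v] by (simp add: canonical_stack_def)
    then obtain x u y where v': "v = (x, u, y)" "(x, u, y) \<in> hom (slice E (omap (lft f) b)) x y"
      by (metis hom_sliceE)
    have xy: "x \<in> Obj (slice E (omap (lft f) b))" "y \<in> Obj (slice E (omap (lft f) b))"
      using v'(2) unfolding hom_slice_iff by auto
    show ?thesis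
      using E.amap_postcomp[OF pg v'(2)] E.amap_postcomp[OF ph E.postcomp_hom[OF pg v'(2)]]
        E.amap_postcomp[OF phg v'(2)] Cmp_x xy
      by (simp add: v'(1) canonical_stack_def functor_Cmp[OF f g h])
  qed
qed

section \<open>The total category of a canonical stack\<close>

text \<open>
  In the total category of a canonical stack, an arrow from \<open>x : X \<rightarrow> f\<^sup>* b\<close> to \<open>y : Y \<rightarrow> f\<^sup>* b'\<close> is just a pair of
  \<open>g : b \<rightarrow> b'\<close> and \<open>u : X \<rightarrow> Y\<close> with \<open>y \<circ> u = f\<^sup>* g \<circ> x\<close>; the other entries are forced.  The total category is
  the comma category of \<open>E\<close> over \<open>f\<^sup>*\<close>, and all computations below are on such pairs.
\<close>

definition tarr ::
  "('oe, 'me) cat \<Rightarrow> ('of, 'mf, 'oe, 'me) adj \<Rightarrow> 'of \<Rightarrow> 'me \<Rightarrow> 'mf \<Rightarrow> 'me \<Rightarrow> 'of \<Rightarrow> 'me \<Rightarrow>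
   ('of \<times> 'me) \<times> ('mf \<times> 'me \<times> 'me \<times> 'me) \<times> ('of \<times> 'me)" where
  "tarr E f b x g u b' y = ((b, x), (g, (amap (lft f) g \<cdot>\<^bsub>E\<^esub> x, u, y)), (b', y))"

lemma tarr_eq_iff [simp]:
  "tarr E f b x g u b' y = tarr E f b x g' u' b' y \<longleftrightarrow> g = g' \<and> u = u'"
  by (auto simp: tarr_def)

locale canonical =
  fixes E :: "('oe, 'me) cat" and F :: "('of, 'mf) cat" and f :: "('of, 'mf, 'oe, 'me) adj"
  assumes f: "is_functor F E (lft f)"
begin

sublocale E: category E by (rule functor_cod_cat[OF f])

sublocale F: category F by (rule functor_dom_cat[OF f])

abbreviation p :: "'of \<Rightarrow> 'oe" where "p \<equiv> omap (lft f)"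

abbreviation pa :: "'mf \<Rightarrow> 'me" where "pa \<equiv> amap (lft f)"

abbreviation S :: "('of, 'mf, 'me, 'me \<times> 'me \<times> 'me) opfib" where "S \<equiv> canonical_stack E f"

abbreviation tot where "tot \<equiv> total_cat F S"

sublocale split: split_opfibration F S
  by (rule split_opfibration_canonical_stack[OF f])

lemma Fib_S [simp]: "Fib S b = slice E (p b)"
  and Push_S [simp]: "Push S g = postcomp E (pa g)"
  by (simp_all add: canonical_stack_def)

lemma pa_hom: "g \<in> hom F b b' \<Longrightarrow> pa g \<in> hom E (p b) (p b')"
  by (rule functor_hom[OF f])

lemma pa_Idt_Cmp: "b \<in> Obj F \<Longrightarrow> x \<in> hom E y (p b) \<Longrightarrow> pa (Idt F b) \<cdot>\<^bsub>E\<^esub> x = x"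
  by (simp add: functor_Idt[OF f] E.Cmp_Idt_left)

lemma Obj_tot: "(b, x) \<in> Obj tot \<longleftrightarrow> b \<in> Obj F \<and> x \<in> Obj (slice E (p b))"
  by (simp add: Obj_total)

lemma hom_tarr:
  "tarr E f b x g u b' y \<in> hom tot (b, x) (b', y) \<longleftrightarrow> g \<in> hom F b b' \<and> x \<in> Obj (slice E (p b)) \<and>
     y \<in> Obj (slice E (p b')) \<and> u \<in> hom E (Dom E x) (Dom E y) \<and> y \<cdot>\<^bsub>E\<^esub> u = pa g \<cdot>\<^bsub>E\<^esub> x"
  unfolding tarr_def hom_total_iff
  using E.omap_postcomp[OF pa_hom] E.postcomp_obj[OF pa_hom] E.Dom_postcomp[OF pa_hom]
  by (auto simp: hom_slice_iff)

lemma hom_totE: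
  assumes "t \<in> hom tot (b, x) (b', y)"
  obtains g u where "t = tarr E f b x g u b' y"
proof -
  from assms obtain g v where t: "t = ((b, x), (g, v), (b', y))" and g: "g \<in> hom F b b'"
    and x: "x \<in> Obj (Fib S b)" and v: "v \<in> hom (Fib S b') (omap (Push S g) x) y"
    by (rule hom_totalE)
  have "v = (pa g \<cdot>\<^bsub>E\<^esub> x, und v, y)"
    using und_eq[OF v[unfolded Fib_S]] x E.omap_postcomp[OF pa_hom[OF g]] by simp
  with t have "t = tarr E f b x g (und v) b' y" by (simp add: tarr_def)
  then show thesis by (rule that)
qed

lemma Cmp_tarr:
  assumes s: "tarr E f b x g u b' y \<in> hom tot (b, x) (b', y)"
    and t: "tarr E f b' y h w b'' z \<in> hom tot (b', y) (b'', z)"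
  shows "tarr E f b' y h w b'' z \<cdot>\<^bsub>tot\<^esub> tarr E f b x g u b' y = tarr E f b x (h \<cdot>\<^bsub>F\<^esub> g) (w \<cdot>\<^bsub>E\<^esub> u) b'' z"
proof -
  from s have g: "g \<in> hom F b b'" and x: "x \<in> Obj (slice E (p b))" by (simp_all add: hom_tarr)
  from t have h: "h \<in> hom F b' b''" by (simp add: hom_tarr)
  from s have v: "(pa g \<cdot>\<^bsub>E\<^esub> x, u, y) \<in> hom (slice E (p b')) (pa g \<cdot>\<^bsub>E\<^esub> x) y"
    by (simp add: tarr_def hom_total_iff E.omap_postcomp[OF pa_hom[OF g] x])
  have "pa (h \<cdot>\<^bsub>F\<^esub> g) \<cdot>\<^bsub>E\<^esub> x = pa h \<cdot>\<^bsub>E\<^esub> (pa g \<cdot>\<^bsub>E\<^esub> x)"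
    using E.Cmp_assoc[OF x[unfolded Obj_slice_hom] pa_hom[OF g] pa_hom[OF h]] by (simp add: functor_Cmp[OF f g h])
  then show ?thesis
    by (simp add: tarr_def E.amap_postcomp[OF pa_hom[OF h] v])
qed

lemma Idt_tarr:
  assumes "(b, x) \<in> Obj tot"
  shows "Idt tot (b, x) = tarr E f b x (Idt F b) (Idt E (Dom E x)) b x"
  using assms pa_Idt_Cmp[of b x "Dom E x"] by (simp add: tarr_def Obj_tot Obj_slice_hom)

lemma vertical_tarr:
  "tarr E f b x g u b' y \<in> hom tot (b, x) (b', y) \<Longrightarrow> vertical F S (tarr E f b x g u b' y) \<longleftrightarrow> g = Idt F b"
  using split.vertical_iff[of "tarr E f b x g u b' y"] by (simp add: tarr_def)

lemma iso_tarr: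
  assumes t: "tarr E f b x (Idt F b) u b y \<in> hom tot (b, x) (b, y)" and u: "iso_arr E u"
  shows "iso_arr tot (tarr E f b x (Idt F b) u b y)"
proof -
  from t have b: "b \<in> Obj F" and x: "x \<in> Obj (slice E (p b))" and y: "y \<in> Obj (slice E (p b))"
    and uh: "u \<in> hom E (Dom E x) (Dom E y)" and yu: "y \<cdot>\<^bsub>E\<^esub> u = pa (Idt F b) \<cdot>\<^bsub>E\<^esub> x"
    using F.hom_obj_dom by (auto simp: hom_tarr)
  have px: "pa (Idt F b) \<cdot>\<^bsub>E\<^esub> x = x" using pa_Idt_Cmp[OF b x[unfolded Obj_slice_hom]] .
  have v: "(x, u, y) \<in> hom (slice E (p b)) x y" using x y uh yu px by (simp add: hom_slice_iff)
  from split.iso_total_vertical[OF b, unfolded Fib_S, OF v E.iso_sliceI[OF v u]] show ?thesis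
    by (simp add: tarr_def px)
qed

end

section \<open>Lifting an adjunction to slices\<close>

text \<open>
  A functor \<open>L : D \<rightarrow> C\<close> and an arrow \<open>h : L d \<rightarrow> c\<close> induce a functor from the slice over \<open>d\<close> to the slice
  over \<open>c\<close>, namely \<open>L\<close> followed by postcomposition with \<open>h\<close>.
\<close>

definition slice_lift ::
  "('o1, 'm1) cat \<Rightarrow> ('o2, 'm2) cat \<Rightarrow> ('o1, 'm1, 'o2, 'm2) ftor \<Rightarrow> 'o1 \<Rightarrow> 'm2 \<Rightarrow>
   ('m1, 'm1 \<times> 'm1 \<times> 'm1, 'm2, 'm2 \<times> 'm2 \<times> 'm2) ftor" where
  "slice_lift D C L d h =
     \<lparr>omap = (\<lambda>x \<in> Obj (slice D d). h \<cdot>\<^bsub>C\<^esub> amap L x),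
      amap = (\<lambda>(x, u, y) \<in> Arr (slice D d). (h \<cdot>\<^bsub>C\<^esub> amap L x, amap L u, h \<cdot>\<^bsub>C\<^esub> amap L y))\<rparr>"

lemma omap_slice_lift [simp]:
  "x \<in> Obj (slice D d) \<Longrightarrow> omap (slice_lift D C L d h) x = h \<cdot>\<^bsub>C\<^esub> amap L x"
  by (simp add: slice_lift_def)

lemma amap_slice_lift:
  "(x, u, y) \<in> hom (slice D d) x y \<Longrightarrow>
    amap (slice_lift D C L d h) (x, u, y) = (h \<cdot>\<^bsub>C\<^esub> amap L x, amap L u, h \<cdot>\<^bsub>C\<^esub> amap L y)"
  by (simp add: slice_lift_def) (simp add: hom_def)

context
  fixes D :: "('o1, 'm1) cat" and C :: "('o2, 'm2) cat" and L :: "('o1, 'm1, 'o2, 'm2) ftor"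
    and d h c
  assumes L: "is_functor D C L" and h: "h \<in> hom C (omap L d) c"
begin

interpretation D: category D by (rule functor_dom_cat[OF L])
interpretation C: category C by (rule functor_cod_cat[OF L])

lemma slice_lift_hom: "x \<in> Obj (slice D d) \<Longrightarrow> h \<cdot>\<^bsub>C\<^esub> amap L x \<in> hom C (omap L (Dom D x)) c"
  using C.Cmp_in[OF functor_hom[OF L] h] by (simp add: Obj_slice_hom)

lemma Dom_slice_lift: "x \<in> Obj (slice D d) \<Longrightarrow> Dom C (h \<cdot>\<^bsub>C\<^esub> amap L x) = omap L (Dom D x)"
  using hom_Dom[OF slice_lift_hom] .

lemma slice_lift_obj: "x \<in> Obj (slice D d) \<Longrightarrow> h \<cdot>\<^bsub>C\<^esub> amap L x \<in> Obj (slice C c)"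
  using slice_lift_hom Dom_slice_lift by (simp add: Obj_slice_hom[of "h \<cdot>\<^bsub>C\<^esub> amap L x"])

lemma is_functor_slice_lift: "is_functor (slice D d) (slice C c) (slice_lift D C L d h)"
proof (rule is_functorI)
  show "category (slice D d)" "category (slice C c)"
    by (rule D.category_slice, rule C.category_slice)
  show "omap (slice_lift D C L d h) \<in> extensional (Obj (slice D d))"
    "amap (slice_lift D C L d h) \<in> extensional (Arr (slice D d))"
    by (simp_all add: slice_lift_def)
  fix x assume x: "x \<in> Obj (slice D d)"
  show "omap (slice_lift D C L d h) x \<in> Obj (slice C c)" using slice_lift_obj[OF x] x by simp
  have i: "(x, Idt D (Dom D x), x) \<in> hom (slice D d) x x"
    using category.Idt_in[OF D.category_slice x] by simp
  show "amap (slice_lift D C L d h) (Idt (slice D d) x) = Idt (slice C c) (omap (slice_lift D C L d h) x)"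
    using x D.hom_obj_dom[OF x[unfolded Obj_slice_hom]]
    by (simp add: amap_slice_lift[OF i] Dom_slice_lift functor_Idt[OF L])
next
  fix t x y assume t: "t \<in> hom (slice D d) x y"
  from t obtain u where u: "t = (x, u, y)" "u \<in> hom D (Dom D x) (Dom D y)" "y \<cdot>\<^bsub>D\<^esub> u = x" by (rule hom_sliceE)
  from t have x: "x \<in> Obj (slice D d)" and y: "y \<in> Obj (slice D d)" by (simp_all add: u hom_slice_iff)
  have "(h \<cdot>\<^bsub>C\<^esub> amap L y) \<cdot>\<^bsub>C\<^esub> amap L u = h \<cdot>\<^bsub>C\<^esub> amap L x"
    using C.Cmp_assoc[OF functor_hom[OF L u(2)] functor_hom[OF L y[unfolded Obj_slice_hom]] h]
      functor_Cmp[OF L u(2) y[unfolded Obj_slice_hom]] by (simp add: u(3))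
  then show "amap (slice_lift D C L d h) t
      \<in> hom (slice C c) (omap (slice_lift D C L d h) x) (omap (slice_lift D C L d h) y)"
    using x y functor_hom[OF L u(2)] slice_lift_obj Dom_slice_lift
    by (simp add: u(1) amap_slice_lift[OF t[unfolded u(1)]] hom_slice_iff)
next
  fix s t x y z assume s: "s \<in> hom (slice D d) x y" and t: "t \<in> hom (slice D d) y z"
  from s obtain u where u: "s = (x, u, y)" "u \<in> hom D (Dom D x) (Dom D y)" by (rule hom_sliceE)
  from t obtain v where v: "t = (y, v, z)" "v \<in> hom D (Dom D y) (Dom D z)" by (rule hom_sliceE)
  show "amap (slice_lift D C L d h) (t \<cdot>\<^bsub>slice D d\<^esub> s) =
      amap (slice_lift D C L d h) t \<cdot>\<^bsub>slice C c\<^esub> amap (slice_lift D C L d h) s"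
    using category.Cmp_in[OF D.category_slice s t]
    by (simp add: u(1) v(1) amap_slice_lift[OF s[unfolded u(1)]] amap_slice_lift[OF t[unfolded v(1)]]
        amap_slice_lift functor_Cmp[OF L u(2) v(2)])
qed

text \<open>
  Let \<open>R\<close> be right adjoint to \<open>L\<close>.  The right adjoint of the lifted functor sends \<open>y : Y \<rightarrow> c\<close> to the
  pullback of \<open>R y : R Y \<rightarrow> R c\<close> along the transpose \<open>d \<rightarrow> R c\<close> of \<open>h\<close>.
\<close>

lemma slice_lift_couniversal:
  assumes pb: "has_pullbacks D"
    and co: "\<And>y. y \<in> Obj C \<Longrightarrow> \<exists>r e. couniversal D C L y r e"
    and d: "d \<in> Obj D" and y: "y \<in> Obj (slice C c)"
  shows "\<exists>r e. couniversal (slice D d) (slice C c) (slice_lift D C L d h) y r e"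
proof -
  note yh = y[unfolded Obj_slice_hom]
  obtain rY eY where Y: "couniversal D C L (Dom C y) rY eY" using co[OF C.hom_obj_dom[OF yh]] by blast
  obtain rc ec where c: "couniversal D C L c rc ec" using co[OF C.hom_obj_cod[OF yh]] by blast
  from Y have rY: "rY \<in> Obj D" and eY: "eY \<in> hom C (omap L rY) (Dom C y)" by (simp_all add: couniversal_def)
  from c have ec: "ec \<in> hom C (omap L rc) c" by (simp add: couniversal_def)
  obtain m where m: "m \<in> hom D rY rc" "ec \<cdot>\<^bsub>C\<^esub> amap L m = y \<cdot>\<^bsub>C\<^esub> eY"
    using couniversal_ex[OF c rY C.Cmp_in[OF eY yh]] by blast
  obtain n where n: "n \<in> hom D d rc" "ec \<cdot>\<^bsub>C\<^esub> amap L n = h"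
    using couniversal_ex[OF c d h] by blast
  have "\<exists>w u v. pullback D rY d m n w u v" using pb m(1) n(1) unfolding has_pullbacks_def by simp
  then obtain w u v where "pullback D rY d m n w u v" by (elim exE)
  then have u: "u \<in> hom D w rY" and v: "v \<in> hom D w d" and uv: "m \<cdot>\<^bsub>D\<^esub> u = n \<cdot>\<^bsub>D\<^esub> v"
    and univ: "\<And>z i j. i \<in> hom D z rY \<Longrightarrow> j \<in> hom D z d \<Longrightarrow> m \<cdot>\<^bsub>D\<^esub> i = n \<cdot>\<^bsub>D\<^esub> j \<Longrightarrow>
      \<exists>!k. k \<in> hom D z w \<and> u \<cdot>\<^bsub>D\<^esub> k = i \<and> v \<cdot>\<^bsub>D\<^esub> k = j"
    unfolding pullback_def by simp_all
  have Dv: "Dom D v = w" by (rule hom_Dom[OF v])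
  have vo: "v \<in> Obj (slice D d)" using v by (simp add: Obj_slice_hom Dv)
  note Lu = functor_hom[OF L u] and Lv = functor_hom[OF L v]
  let ?e = "eY \<cdot>\<^bsub>C\<^esub> amap L u"
  note e = C.Cmp_in[OF Lu eY]
  have ye: "y \<cdot>\<^bsub>C\<^esub> ?e = h \<cdot>\<^bsub>C\<^esub> amap L v"
  proof -
    have "y \<cdot>\<^bsub>C\<^esub> ?e = ec \<cdot>\<^bsub>C\<^esub> amap L (m \<cdot>\<^bsub>D\<^esub> u)"
      by (simp add: C.Cmp_assoc[OF Lu eY yh] m(2)[symmetric] functor_Cmp[OF L u m(1)]
          C.Cmp_assoc[OF Lu functor_hom[OF L m(1)] ec])
    also have "\<dots> = h \<cdot>\<^bsub>C\<^esub> amap L v"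
      by (simp add: uv functor_Cmp[OF L v n(1)] C.Cmp_assoc[OF Lv functor_hom[OF L n(1)] ec] n(2))
    finally show ?thesis .
  qed
  have "couniversal (slice D d) (slice C c) (slice_lift D C L d h) y v (h \<cdot>\<^bsub>C\<^esub> amap L v, ?e, y)"
    unfolding couniversal_def
  proof (intro conjI ballI)
    show "v \<in> Obj (slice D d)" by (rule vo)
    show "(h \<cdot>\<^bsub>C\<^esub> amap L v, ?e, y) \<in> hom (slice C c) (omap (slice_lift D C L d h) v) y"
      using vo y e ye by (simp add: hom_slice_iff slice_lift_obj Dom_slice_lift Dv)
    fix x t assume x: "x \<in> Obj (slice D d)" and t: "t \<in> hom (slice C c) (omap (slice_lift D C L d h) x) y"
    note xh = x[unfolded Obj_slice_hom] note X = D.hom_obj_dom[OF xh]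
    from t x obtain s where s: "t = (h \<cdot>\<^bsub>C\<^esub> amap L x, s, y)" "s \<in> hom C (omap L (Dom D x)) (Dom C y)"
      "y \<cdot>\<^bsub>C\<^esub> s = h \<cdot>\<^bsub>C\<^esub> amap L x"
      by (auto elim!: hom_sliceE simp: Dom_slice_lift)
    obtain k where k: "k \<in> hom D (Dom D x) rY" "eY \<cdot>\<^bsub>C\<^esub> amap L k = s"
      using couniversal_ex[OF Y X s(2)] by blast
    note Lk = functor_hom[OF L k(1)]
    have "m \<cdot>\<^bsub>D\<^esub> k = n \<cdot>\<^bsub>D\<^esub> x"
    proof (rule couniversal_eq[OF c L D.Cmp_in[OF k(1) m(1)] D.Cmp_in[OF xh n(1)]])
      have "ec \<cdot>\<^bsub>C\<^esub> amap L (m \<cdot>\<^bsub>D\<^esub> k) = y \<cdot>\<^bsub>C\<^esub> s"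
        by (simp add: functor_Cmp[OF L k(1) m(1)] C.Cmp_assoc[OF Lk functor_hom[OF L m(1)] ec] m(2)
            C.Cmp_assoc[OF Lk eY yh, symmetric] k(2))
      moreover have "ec \<cdot>\<^bsub>C\<^esub> amap L (n \<cdot>\<^bsub>D\<^esub> x) = h \<cdot>\<^bsub>C\<^esub> amap L x"
        by (simp add: functor_Cmp[OF L xh n(1)] n(2)
            C.Cmp_assoc[OF functor_hom[OF L xh] functor_hom[OF L n(1)] ec])
      ultimately show "ec \<cdot>\<^bsub>C\<^esub> amap L (m \<cdot>\<^bsub>D\<^esub> k) = ec \<cdot>\<^bsub>C\<^esub> amap L (n \<cdot>\<^bsub>D\<^esub> x)" by (simp add: s(3))
    qed
    from univ[OF k(1) xh this] obtain l where l: "l \<in> hom D (Dom D x) w" "u \<cdot>\<^bsub>D\<^esub> l = k" "v \<cdot>\<^bsub>D\<^esub> l = x"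
      and l_uniq: "\<And>l'. l' \<in> hom D (Dom D x) w \<Longrightarrow> u \<cdot>\<^bsub>D\<^esub> l' = k \<Longrightarrow> v \<cdot>\<^bsub>D\<^esub> l' = x \<Longrightarrow> l' = l"
      by blast
    have e_l: "?e \<cdot>\<^bsub>C\<^esub> amap L l' = eY \<cdot>\<^bsub>C\<^esub> amap L (u \<cdot>\<^bsub>D\<^esub> l')" if "l' \<in> hom D (Dom D x) w" for l'
      by (simp add: functor_Cmp[OF L that u] C.Cmp_assoc[OF functor_hom[OF L that] Lu eY])
    show "\<exists>!q. q \<in> hom (slice D d) x v \<and>
        (h \<cdot>\<^bsub>C\<^esub> amap L v, ?e, y) \<cdot>\<^bsub>slice C c\<^esub> amap (slice_lift D C L d h) q = t"
    proof (rule ex1I)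
      have q: "(x, l, v) \<in> hom (slice D d) x v" using l x vo by (simp add: hom_slice_iff Dv)
      then show "(x, l, v) \<in> hom (slice D d) x v \<and>
          (h \<cdot>\<^bsub>C\<^esub> amap L v, ?e, y) \<cdot>\<^bsub>slice C c\<^esub> amap (slice_lift D C L d h) (x, l, v) = t"
        by (simp add: amap_slice_lift[OF q] s(1) e_l[OF l(1)] l(2) k(2))
      fix q assume q: "q \<in> hom (slice D d) x v \<and>
          (h \<cdot>\<^bsub>C\<^esub> amap L v, ?e, y) \<cdot>\<^bsub>slice C c\<^esub> amap (slice_lift D C L d h) q = t"
      then have "q \<in> hom (slice D d) x v" by (rule conjunct1)
      then obtain l' where l': "q = (x, l', v)" "l' \<in> hom D (Dom D x) w" "v \<cdot>\<^bsub>D\<^esub> l' = x"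
        unfolding Dv[symmetric] by (rule hom_sliceE)
      have qh: "(x, l', v) \<in> hom (slice D d) x v" using q l'(1) by simp
      have "eY \<cdot>\<^bsub>C\<^esub> amap L (u \<cdot>\<^bsub>D\<^esub> l') = s"
        using q by (simp add: l'(1) amap_slice_lift[OF qh] s(1) e_l[OF l'(2)])
      then have "u \<cdot>\<^bsub>D\<^esub> l' = k"
        by (intro couniversal_eq[OF Y L D.Cmp_in[OF l'(2) u] k(1)]) (simp add: k(2))
      then have "l' = l" using l_uniq[OF l'(2) _ l'(3)] by simp
      then show "q = (x, l, v)" by (simp add: l'(1))
    qed
  qed
  then show ?thesis by blast
qed

lemma slice_lift_adjunction:
  assumes "has_pullbacks D" "\<And>y. y \<in> Obj C \<Longrightarrow> \<exists>r e. couniversal D C L y r e" "d \<in> Obj D"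
  shows "\<exists>\<alpha>. adjunction (slice D d) (slice C c) \<alpha> \<and> lft \<alpha> = slice_lift D C L d h"
  by (rule adjunction_of_couniversal[OF is_functor_slice_lift slice_lift_couniversal[OF assms]])

end

section \<open>Weak morphisms and terminal-preserving morphisms of canonical stacks\<close>

locale relative_topos_pair =
  T: canonical E F f + T': canonical E' F f'
  for E :: "('oe, 'me) cat" and E' :: "('oe', 'me') cat" and F :: "('of, 'mf) cat"
    and f :: "('of, 'mf, 'oe, 'me) adj" and f' :: "('of, 'mf, 'oe', 'me') adj" +
  fixes one :: 'of
  assumes one: "terminal F one"
    and one_E: "terminal E (omap (lft f) one)"
    and one_E': "terminal E' (omap (lft f') one)"
    and pullbacks_E': "has_pullbacks E'"
begin

abbreviation W where "W \<equiv> Wmor_over E E' F f f'"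

abbreviation Opf where "Opf \<equiv> OpfibTerm F T'.S T.S"

lemma Obj_W: "(a, \<phi>) \<in> Obj W \<longleftrightarrow>
    adjunction E' E a \<and> nat_iso F E (comp_functor F (lft a) (lft f')) (lft f) \<phi>"
  by (simp add: Wmor_over_def weak_morphism_def)

lemma hom_W: "t \<in> hom W (a, \<phi>) (b, \<psi>) \<longleftrightarrow> (\<exists>\<theta>. t = ((a, \<phi>), \<theta>, (b, \<psi>)) \<and> (a, \<phi>) \<in> Obj W \<and>
    (b, \<psi>) \<in> Obj W \<and> nat_trans E' E (lft a) (lft b) \<theta> \<and>
    (\<forall>x \<in> Obj F. \<psi> x \<cdot>\<^bsub>E\<^esub> \<theta> (T'.p x) = \<phi> x))"
  by (auto simp: Wmor_over_def hom_transformation_cat)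

lemma Obj_O: "A \<in> Obj Opf \<longleftrightarrow> opfib_term_morphism F T'.S T.S A"
  by (simp add: OpfibTerm_def)

lemma hom_O: "t \<in> hom Opf A B \<longleftrightarrow> (\<exists>\<theta>. t = (A, \<theta>, B) \<and> A \<in> Obj Opf \<and> B \<in> Obj Opf \<and>
    nat_trans T'.tot T.tot (total_functor F T'.S T.S A) (total_functor F T'.S T.S B) \<theta> \<and>
    (\<forall>p \<in> Obj T'.tot. vertical F T.S (\<theta> p)))"
  by (simp add: OpfibTerm_def hom_transformation_cat)

lemma category_W: "category W"
  unfolding Wmor_over_def
proof (rule category_transformation_cat)
  let ?K = "{(a, \<phi>). weak_morphism E E' a \<and> nat_iso F E (comp_functor F (lft a) (lft f')) (lft f) \<phi>}"
  let ?U = "\<lambda>(a, \<phi>). lft a"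
  fix k assume k: "k \<in> ?K"
  obtain a \<phi> where a: "k = (a, \<phi>)" by fastforce
  from k have adj: "adjunction E' E a" and phi_nat_iso: "nat_iso F E (comp_functor F (lft a) (lft f')) (lft f) \<phi>"
    by (simp_all add: a weak_morphism_def)
  show "is_functor E' E (?U k)" using adjunction_lft[OF adj] by (simp add: a)
  have "\<phi> x \<cdot>\<^bsub>E\<^esub> Idt E (omap (lft a) (T'.p x)) = \<phi> x" if "x \<in> Obj F" for x
    using nat_trans_hom[OF nat_iso_trans[OF phi_nat_iso] that] that T.E.Cmp_Idt_right by simp
  then show "(\<lambda>(a, \<phi>) \<theta> (b, \<psi>). \<forall>x \<in> Obj F. \<psi> x \<cdot>\<^bsub>E\<^esub> \<theta> (T'.p x) = \<phi> x) k
      (\<lambda>x \<in> Obj E'. Idt E (omap (?U k) x)) k"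
    by (simp add: a functor_obj[OF T'.f])
next
  let ?K = "{(a, \<phi>). weak_morphism E E' a \<and> nat_iso F E (comp_functor F (lft a) (lft f')) (lft f) \<phi>}"
  let ?U = "\<lambda>(a, \<phi>). lft a"
  let ?P = "\<lambda>(a, \<phi>) \<theta> (b, \<psi>). \<forall>x \<in> Obj F. \<psi> x \<cdot>\<^bsub>E\<^esub> \<theta> (T'.p x) = \<phi> x"
  fix k l m \<sigma> \<tau> assume "m \<in> ?K" and s: "nat_trans E' E (?U k) (?U l) \<sigma>" and t: "nat_trans E' E (?U l) (?U m) \<tau>"
    and P: "?P k \<sigma> l" "?P l \<tau> m"
  obtain a \<phi> b \<psi> c \<chi> where klm: "k = (a, \<phi>)" "l = (b, \<psi>)" "m = (c, \<chi>)" by fastforce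
  with \<open>m \<in> ?K\<close> have chi: "nat_iso F E (comp_functor F (lft c) (lft f')) (lft f) \<chi>" by simp
  have "\<chi> x \<cdot>\<^bsub>E\<^esub> (\<tau> (T'.p x) \<cdot>\<^bsub>E\<^esub> \<sigma> (T'.p x)) = \<phi> x" if x: "x \<in> Obj F" for x
  proof -
    note y = functor_obj[OF T'.f x]
    have "\<chi> x \<in> hom E (omap (lft c) (T'.p x)) (T.p x)"
      using nat_trans_hom[OF nat_iso_trans[OF chi] x] x by simp
    from T.E.Cmp_assoc[OF nat_trans_hom[OF s y] nat_trans_hom[OF t y], unfolded klm prod.case, OF this] P x
    show ?thesis by (simp add: klm)
  qed
  then show "?P k (\<lambda>x \<in> Obj E'. \<tau> x \<cdot>\<^bsub>E\<^esub> \<sigma> x) m"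
    by (simp add: klm functor_obj[OF T'.f])
qed

lemma category_O: "category Opf"
  by (rule category_OpfibTerm[OF T'.split.split_opfibration_axioms T.split.split_opfibration_axioms])

text \<open>
  \<open>stack_mor (a, \<phi>)\<close> acts on the fiber over \<open>b\<close> by \<open>x \<mapsto> \<phi> b \<circ> a\<^sup>* x\<close>.  By naturality of \<open>\<phi>\<close> these
  functors commute strictly with the pushforwards, so that the comparison cells are identities.  The
  right adjoints may be chosen arbitrarily, since they are unique up to isomorphism.
\<close>

definition stack_mor ::
  "('oe', 'me', 'oe, 'me) adj \<times> ('of \<Rightarrow> 'me) \<Rightarrow>
   ('of, 'mf, 'me', 'me' \<times> 'me' \<times> 'me', 'me, 'me \<times> 'me \<times> 'me) opfib_mor" where
  "stack_mor = (\<lambda>(a, \<phi>). \<lparr>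
     adjs = (\<lambda>b \<in> Obj F. SOME \<alpha>. adjunction (slice E' (T'.p b)) (slice E (T.p b)) \<alpha> \<and>
        lft \<alpha> = slice_lift E' E (lft a) (T'.p b) (\<phi> b)),
     coh = (\<lambda>g \<in> Arr F. \<lambda>x \<in> Obj (slice E' (T'.p (Dom F g))).
        Idt (slice E (T.p (Cod F g))) (T.pa g \<cdot>\<^bsub>E\<^esub> (\<phi> (Dom F g) \<cdot>\<^bsub>E\<^esub> amap (lft a) x)))\<rparr>)"

lemma T'_slice_pa: "g \<in> hom F b b' \<Longrightarrow> x \<in> Obj (slice E' (T'.p b)) \<Longrightarrow>
    T'.pa g \<cdot>\<^bsub>E'\<^esub> x \<in> Obj (slice E' (T'.p b'))"
  using T'.E.postcomp_obj[OF T'.pa_hom] .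

context
  fixes a \<phi>
  assumes k: "(a, \<phi>) \<in> Obj W"
begin

lemma a_adj: "adjunction E' E a"
  and phi_nat_iso: "nat_iso F E (comp_functor F (lft a) (lft f')) (lft f) \<phi>"
  using k by (simp_all add: Obj_W)

lemma lft_functor: "is_functor E' E (lft a)"
  by (rule adjunction_lft[OF a_adj])

lemma phi_hom: "b \<in> Obj F \<Longrightarrow> \<phi> b \<in> hom E (omap (lft a) (T'.p b)) (T.p b)"
  using nat_trans_hom[OF nat_iso_trans[OF phi_nat_iso], of b] by simp

lemma phi_iso: "b \<in> Obj F \<Longrightarrow> iso_arr E (\<phi> b)"
  by (rule nat_iso_iso[OF phi_nat_iso])

lemma phi_natural:
  "g \<in> hom F b b' \<Longrightarrow> \<phi> b' \<cdot>\<^bsub>E\<^esub> amap (lft a) (T'.pa g) = T.pa g \<cdot>\<^bsub>E\<^esub> \<phi> b"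
  using nat_trans_natural[OF nat_iso_trans[OF phi_nat_iso], of g b b'] by (simp add: hom_Arr)

lemma stack_mor_adj:
  assumes b: "b \<in> Obj F"
  shows "adjunction (slice E' (T'.p b)) (slice E (T.p b)) (adjs (stack_mor (a, \<phi>)) b)"
    and stack_mor_lft: "lft (adjs (stack_mor (a, \<phi>)) b) = slice_lift E' E (lft a) (T'.p b) (\<phi> b)"
proof -
  have "\<exists>\<alpha>. adjunction (slice E' (T'.p b)) (slice E (T.p b)) \<alpha> \<and>
      lft \<alpha> = slice_lift E' E (lft a) (T'.p b) (\<phi> b)"
    by (rule slice_lift_adjunction[OF lft_functor phi_hom[OF b] pullbacks_E' _ functor_obj[OF T'.f b]])
      (blast intro: adjunction_couniversal[OF a_adj])
  from someI_ex[OF this]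
  show "adjunction (slice E' (T'.p b)) (slice E (T.p b)) (adjs (stack_mor (a, \<phi>)) b)"
    "lft (adjs (stack_mor (a, \<phi>)) b) = slice_lift E' E (lft a) (T'.p b) (\<phi> b)"
    using b by (simp_all add: stack_mor_def)
qed

lemma stack_mor_coh:
  "g \<in> hom F b b' \<Longrightarrow> x \<in> Obj (slice E' (T'.p b)) \<Longrightarrow>
    coh (stack_mor (a, \<phi>)) g x = Idt (slice E (T.p b')) (T.pa g \<cdot>\<^bsub>E\<^esub> (\<phi> b \<cdot>\<^bsub>E\<^esub> amap (lft a) x))"
  by (simp add: stack_mor_def hom_Arr hom_Dom hom_Cod del: slice_simps)

text \<open>
  This is the strict commutation with pushforwards.
\<close>

lemma slice_lift_pa:
  assumes g: "g \<in> hom F b b'" and x: "x \<in> Obj (slice E' (T'.p b))"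
  shows "\<phi> b' \<cdot>\<^bsub>E\<^esub> amap (lft a) (T'.pa g \<cdot>\<^bsub>E'\<^esub> x) = T.pa g \<cdot>\<^bsub>E\<^esub> (\<phi> b \<cdot>\<^bsub>E\<^esub> amap (lft a) x)"
proof -
  note b = T.F.hom_obj_dom[OF g] and b' = T.F.hom_obj_cod[OF g]
  note Lx = functor_hom[OF lft_functor x[unfolded Obj_slice_hom]] and Lg = functor_hom[OF lft_functor T'.pa_hom[OF g]]
  show ?thesis
    by (simp add: functor_Cmp[OF lft_functor x[unfolded Obj_slice_hom] T'.pa_hom[OF g]]
        T.E.Cmp_assoc[OF Lx Lg phi_hom[OF b']] phi_natural[OF g] T.E.Cmp_assoc[OF Lx phi_hom[OF b] T.pa_hom[OF g]])
qed

lemma lift_obj: "b \<in> Obj F \<Longrightarrow> x \<in> Obj (slice E' (T'.p b)) \<Longrightarrow>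
    \<phi> b \<cdot>\<^bsub>E\<^esub> amap (lft a) x \<in> Obj (slice E (T.p b))"
  and Dom_lift: "b \<in> Obj F \<Longrightarrow> x \<in> Obj (slice E' (T'.p b)) \<Longrightarrow>
    Dom E (\<phi> b \<cdot>\<^bsub>E\<^esub> amap (lft a) x) = omap (lft a) (Dom E' x)"
  using slice_lift_obj[OF lft_functor phi_hom] Dom_slice_lift[OF lft_functor phi_hom] by blast+

lemma opfib_term_morphism_stack_mor: "opfib_term_morphism F T'.S T.S (stack_mor (a, \<phi>))"
  unfolding opfib_term_morphism_def
proof (intro conjI ballI allI)
  let ?A = "stack_mor (a, \<phi>)"
  show "adjs ?A \<in> extensional (Obj F)" "coh ?A \<in> extensional (Arr F)"
    by (simp_all add: stack_mor_def)
  fix b assume b: "b \<in> Obj F"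
  show "adjunction (Fib T'.S b) (Fib T.S b) (adjs ?A b)"
    using stack_mor_adj[OF b] by simp
  show "preserves_terminal (Fib T'.S b) (Fib T.S b) (lft (adjs ?A b))"
    unfolding preserves_terminal_def
  proof (intro allI impI)
    fix t assume "terminal (Fib T'.S b) t"
    then have t: "t \<in> Obj (slice E' (T'.p b))" and iso: "iso_arr E' t"
      using T'.E.terminal_slice_iso[OF functor_obj[OF T'.f b]] by simp_all
    note th = t[unfolded Obj_slice_hom]
    have "iso_arr E (\<phi> b \<cdot>\<^bsub>E\<^esub> amap (lft a) t)"
      by (rule T.E.iso_Cmp[OF functor_iso[OF lft_functor iso th] functor_hom[OF lft_functor th] phi_iso[OF b] phi_hom[OF b]])
    then show "terminal (Fib T.S b) (omap (lft (adjs ?A b)) t)"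
      using T.E.terminal_slice_iso[OF functor_obj[OF T.f b]] lift_obj[OF b t]
      by (simp add: stack_mor_lft[OF b] t)
  qed
  fix x assume "x \<in> Obj (Fib T'.S b)"
  then have x: "x \<in> Obj (slice E' (T'.p b))" by simp
  show "coh ?A (Idt F b) x = Idt (Fib T.S b) (omap (lft (adjs ?A b)) x)"
    using T.pa_Idt_Cmp[OF b lift_obj[OF b x, unfolded Obj_slice_hom]]
    by (simp add: stack_mor_coh[OF T.F.Idt_in[OF b] x] stack_mor_lft[OF b] x)
next
  let ?A = "stack_mor (a, \<phi>)"
  fix b b' g assume g: "g \<in> hom F b b'"
  note b = T.F.hom_obj_dom[OF g] and b' = T.F.hom_obj_cod[OF g]
  note lft_b = stack_mor_lft[OF b] and lft_b' = stack_mor_lft[OF b']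
  let ?S = "comp_functor (Fib T'.S b) (Push T.S g) (lft (adjs ?A b))"
  let ?T = "comp_functor (Fib T'.S b) (lft (adjs ?A b')) (Push T'.S g)"
  interpret sl: category "slice E (T.p b')" by (rule T.E.category_slice)
  have Sx: "omap ?S x = T.pa g \<cdot>\<^bsub>E\<^esub> (\<phi> b \<cdot>\<^bsub>E\<^esub> amap (lft a) x)" if x: "x \<in> Obj (slice E' (T'.p b))" for x
    using x by (simp add: lft_b T.E.omap_postcomp[OF T.pa_hom[OF g]] lift_obj[OF b])
  have Tx: "omap ?T x = T.pa g \<cdot>\<^bsub>E\<^esub> (\<phi> b \<cdot>\<^bsub>E\<^esub> amap (lft a) x)" if x: "x \<in> Obj (slice E' (T'.p b))" for x
    using x by (simp add: lft_b' T'.E.omap_postcomp[OF T'.pa_hom[OF g]] T'_slice_pa[OF g] slice_lift_pa[OF g])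
  have S: "is_functor (slice E' (T'.p b)) (slice E (T.p b')) ?S"
    using is_functor_comp[OF is_functor_slice_lift[OF lft_functor phi_hom[OF b]] T.E.is_functor_postcomp[OF T.pa_hom[OF g]]]
    by (simp add: lft_b)
  have T: "is_functor (slice E' (T'.p b)) (slice E (T.p b')) ?T"
    using is_functor_comp[OF T'.E.is_functor_postcomp[OF T'.pa_hom[OF g]] is_functor_slice_lift[OF lft_functor phi_hom[OF b']]]
    by (simp add: lft_b')
  have ob: "T.pa g \<cdot>\<^bsub>E\<^esub> (\<phi> b \<cdot>\<^bsub>E\<^esub> amap (lft a) x) \<in> Obj (slice E (T.p b'))"
    if x: "x \<in> Obj (slice E' (T'.p b))" for x
    using functor_obj[OF S x] by (simp only: Sx[OF x])
  have "nat_trans (slice E' (T'.p b)) (slice E (T.p b')) ?S ?T (coh ?A g)"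
  proof (rule nat_transI[OF S T])
    show "coh ?A g \<in> extensional (Obj (slice E' (T'.p b)))"
      by (simp add: stack_mor_def hom_Arr[OF g] hom_Dom[OF g])
    show "coh ?A g x \<in> hom (slice E (T.p b')) (omap ?S x) (omap ?T x)"
      if x: "x \<in> Obj (slice E' (T'.p b))" for x
      unfolding Sx[OF x] Tx[OF x] stack_mor_coh[OF g x] by (rule sl.Idt_in[OF ob[OF x]])
    fix t x y assume t: "t \<in> hom (slice E' (T'.p b)) x y"
    from t obtain u where u: "t = (x, u, y)" by (rule hom_sliceE)
    have x: "x \<in> Obj (slice E' (T'.p b))" and y: "y \<in> Obj (slice E' (T'.p b))"
      using t by (simp_all add: u hom_slice_iff)
    note t' = t[unfolded u]
    have v: "(\<phi> b \<cdot>\<^bsub>E\<^esub> amap (lft a) x, amap (lft a) u, \<phi> b \<cdot>\<^bsub>E\<^esub> amap (lft a) y) \<in>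
        hom (slice E (T.p b)) (\<phi> b \<cdot>\<^bsub>E\<^esub> amap (lft a) x) (\<phi> b \<cdot>\<^bsub>E\<^esub> amap (lft a) y)"
      using functor_hom[OF is_functor_slice_lift[OF lft_functor phi_hom[OF b]] t'] x y
      by (simp add: amap_slice_lift[OF t'])
    note w = T'.E.postcomp_hom[OF T'.pa_hom[OF g] t']
    have St: "amap ?S t = (T.pa g \<cdot>\<^bsub>E\<^esub> (\<phi> b \<cdot>\<^bsub>E\<^esub> amap (lft a) x), amap (lft a) u,
        T.pa g \<cdot>\<^bsub>E\<^esub> (\<phi> b \<cdot>\<^bsub>E\<^esub> amap (lft a) y))"
      using hom_Arr[OF t'] by (simp add: u lft_b amap_slice_lift[OF t'] T.E.amap_postcomp[OF T.pa_hom[OF g] v])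
    have Tt: "amap ?T t = (T.pa g \<cdot>\<^bsub>E\<^esub> (\<phi> b \<cdot>\<^bsub>E\<^esub> amap (lft a) x), amap (lft a) u,
        T.pa g \<cdot>\<^bsub>E\<^esub> (\<phi> b \<cdot>\<^bsub>E\<^esub> amap (lft a) y))"
      using hom_Arr[OF t'] by (simp add: u lft_b' T'.E.amap_postcomp[OF T'.pa_hom[OF g] t'] amap_slice_lift[OF w]
          slice_lift_pa[OF g x] slice_lift_pa[OF g y])
    have St': "amap ?S t \<in> hom (slice E (T.p b')) (T.pa g \<cdot>\<^bsub>E\<^esub> (\<phi> b \<cdot>\<^bsub>E\<^esub> amap (lft a) x))
        (T.pa g \<cdot>\<^bsub>E\<^esub> (\<phi> b \<cdot>\<^bsub>E\<^esub> amap (lft a) y))"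
      using functor_hom[OF S t] by (simp only: Sx[OF x] Sx[OF y])
    have "amap ?T t = amap ?S t" by (simp only: St Tt)
    then show "coh ?A g y \<cdot>\<^bsub>slice E (T.p b')\<^esub> amap ?S t = amap ?T t \<cdot>\<^bsub>slice E (T.p b')\<^esub> coh ?A g x"
      by (simp only: stack_mor_coh[OF g x] stack_mor_coh[OF g y] sl.Cmp_Idt_left[OF St'] sl.Cmp_Idt_right[OF St'])
  qed
  then have "nat_iso (slice E' (T'.p b)) (slice E (T.p b')) ?S ?T (coh ?A g)"
    unfolding nat_iso_def using sl.iso_Idt[OF ob] by (simp add: stack_mor_coh[OF g] del: slice_simps)
  then show "nat_iso (Fib T'.S b) (Fib T.S b') ?S ?T (coh ?A g)" by simp
next
  let ?A = "stack_mor (a, \<phi>)"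
  fix b b' b'' g h x assume g: "g \<in> hom F b b'" and h: "h \<in> hom F b' b''" and "x \<in> Obj (Fib T'.S b)"
  then have x: "x \<in> Obj (slice E' (T'.p b))" by simp
  note b = T.F.hom_obj_dom[OF g]
  note gx = T'_slice_pa[OF g x]
  interpret sl: category "slice E (T.p b'')" by (rule T.E.category_slice)
  let ?z = "\<phi> b \<cdot>\<^bsub>E\<^esub> amap (lft a) x"
  note z = lift_obj[OF b x]
  note pz = T.E.postcomp_obj[OF T.pa_hom[OF g] z]
  note ppz = T.E.postcomp_obj[OF T.pa_hom[OF h] pz]
  have 1: "coh ?A (h \<cdot>\<^bsub>F\<^esub> g) x = Idt (slice E (T.p b'')) (T.pa h \<cdot>\<^bsub>E\<^esub> (T.pa g \<cdot>\<^bsub>E\<^esub> ?z))"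
    using T.E.Cmp_assoc[OF z[unfolded Obj_slice_hom] T.pa_hom[OF g] T.pa_hom[OF h]]
    by (simp only: stack_mor_coh[OF T.F.Cmp_in[OF g h] x] functor_Cmp[OF T.f g h])
  have 2: "coh ?A h (omap (Push T'.S g) x) = Idt (slice E (T.p b'')) (T.pa h \<cdot>\<^bsub>E\<^esub> (T.pa g \<cdot>\<^bsub>E\<^esub> ?z))"
    by (simp only: T'.Push_S T'.E.omap_postcomp[OF T'.pa_hom[OF g] x] stack_mor_coh[OF h gx] slice_lift_pa[OF g x])
  have 3: "amap (Push T.S h) (coh ?A g x) = Idt (slice E (T.p b'')) (T.pa h \<cdot>\<^bsub>E\<^esub> (T.pa g \<cdot>\<^bsub>E\<^esub> ?z))"
    by (simp only: T.Push_S stack_mor_coh[OF g x] functor_Idt[OF T.E.is_functor_postcomp[OF T.pa_hom[OF h]] pz]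
        T.E.omap_postcomp[OF T.pa_hom[OF h] pz])
  show "coh ?A (h \<cdot>\<^bsub>F\<^esub> g) x = coh ?A h (omap (Push T'.S g) x) \<cdot>\<^bsub>Fib T.S b''\<^esub> amap (Push T.S h) (coh ?A g x)"
    unfolding 1 2 3 T.Fib_S by (rule sl.Cmp_Idt_left[OF sl.Idt_in[OF ppz], symmetric])
qed

lemma omap_total_stack_mor:
  assumes b: "b \<in> Obj F" and x: "x \<in> Obj (slice E' (T'.p b))"
  shows "omap (total_functor F T'.S T.S (stack_mor (a, \<phi>))) (b, x) = (b, \<phi> b \<cdot>\<^bsub>E\<^esub> amap (lft a) x)"
  by (simp add: omap_total_functor b x stack_mor_lft[OF b])

end

lemma is_functor_total_mor:
  "opfib_term_morphism F T'.S T.S A \<Longrightarrow> is_functor T'.tot T.tot (total_functor F T'.S T.S A)"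
  by (rule is_functor_total[OF T'.split.split_opfibration_axioms T.split.split_opfibration_axioms])

lemma amap_total_tarr:
  assumes A: "opfib_term_morphism F T'.S T.S A"
    and t: "tarr E' f' b x g u b' y \<in> hom T'.tot (b, x) (b', y)"
  shows "amap (total_functor F T'.S T.S A) (tarr E' f' b x g u b' y) =
    tarr E f b (omap (lft (adjs A b)) x) g
      (und (amap (lft (adjs A b')) (T'.pa g \<cdot>\<^bsub>E'\<^esub> x, u, y)) \<cdot>\<^bsub>E\<^esub> und (coh A g x)) b' (omap (lft (adjs A b')) y)"
proof -
  from t have g: "g \<in> hom F b b'" and x: "x \<in> Obj (slice E' (T'.p b))" and y: "y \<in> Obj (slice E' (T'.p b'))"
    by (simp_all add: T'.hom_tarr)
  note b = T.F.hom_obj_dom[OF g] and b' = T.F.hom_obj_cod[OF g]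
  have "amap (total_functor F T'.S T.S A) (tarr E' f' b x g u b' y) \<in>
      hom T.tot (b, omap (lft (adjs A b)) x) (b', omap (lft (adjs A b')) y)"
    using functor_hom[OF is_functor_total_mor[OF A] t] b b' x y by (simp add: omap_total_functor)
  then obtain g' u' where e: "amap (total_functor F T'.S T.S A) (tarr E' f' b x g u b' y) =
      tarr E f b (omap (lft (adjs A b)) x) g' u' b' (omap (lft (adjs A b')) y)"
    by (rule T.hom_totE)
  have "amap (total_functor F T'.S T.S A) (tarr E' f' b x g u b' y) =
    ((b, omap (lft (adjs A b)) x), (g, amap (lft (adjs A b')) (T'.pa g \<cdot>\<^bsub>E'\<^esub> x, u, y) \<cdot>\<^bsub>slice E (T.p b')\<^esub> coh A g x),
     (b', omap (lft (adjs A b')) y))"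
    unfolding tarr_def amap_total_functor[OF t[unfolded tarr_def]] T.Fib_S ..
  with e have "g' = g" "(T.pa g' \<cdot>\<^bsub>E\<^esub> omap (lft (adjs A b)) x, u', omap (lft (adjs A b')) y) =
      amap (lft (adjs A b')) (T'.pa g \<cdot>\<^bsub>E'\<^esub> x, u, y) \<cdot>\<^bsub>slice E (T.p b')\<^esub> coh A g x"
    by (auto simp: tarr_def)
  then have "g' = g" "u' = und (amap (lft (adjs A b')) (T'.pa g \<cdot>\<^bsub>E'\<^esub> x, u, y)) \<cdot>\<^bsub>E\<^esub> und (coh A g x)"
    by (simp, metis und_Cmp und_simp)
  with e show ?thesis by simp
qed

lemma amap_total_stack_mor:
  assumes k: "(a, \<phi>) \<in> Obj W"
    and t: "tarr E' f' b x g u b' y \<in> hom T'.tot (b, x) (b', y)"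
  shows "amap (total_functor F T'.S T.S (stack_mor (a, \<phi>))) (tarr E' f' b x g u b' y) =
    tarr E f b (\<phi> b \<cdot>\<^bsub>E\<^esub> amap (lft a) x) g (amap (lft a) u) b' (\<phi> b' \<cdot>\<^bsub>E\<^esub> amap (lft a) y)"
proof -
  note lft_functor = lft_functor[OF k]
  from t have g: "g \<in> hom F b b'" and x: "x \<in> Obj (slice E' (T'.p b))" and y: "y \<in> Obj (slice E' (T'.p b'))"
    and u: "u \<in> hom E' (Dom E' x) (Dom E' y)" and yu: "y \<cdot>\<^bsub>E'\<^esub> u = T'.pa g \<cdot>\<^bsub>E'\<^esub> x"
    by (simp_all add: T'.hom_tarr)
  note b = T.F.hom_obj_dom[OF g] and b' = T.F.hom_obj_cod[OF g]
  have v: "(T'.pa g \<cdot>\<^bsub>E'\<^esub> x, u, y) \<in> hom (slice E' (T'.p b')) (T'.pa g \<cdot>\<^bsub>E'\<^esub> x) y"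
    using T'_slice_pa[OF g x] y u yu by (simp add: hom_slice_iff T'.E.Dom_postcomp[OF T'.pa_hom[OF g] x])
  have D: "Dom E (T.pa g \<cdot>\<^bsub>E\<^esub> (\<phi> b \<cdot>\<^bsub>E\<^esub> amap (lft a) x)) = omap (lft a) (Dom E' x)"
    using T.E.Dom_postcomp[OF T.pa_hom[OF g] lift_obj[OF k b x]] Dom_lift[OF k b x] by simp
  show ?thesis
    by (simp add: amap_total_tarr[OF opfib_term_morphism_stack_mor[OF k] t] stack_mor_lft[OF k] b b' x y
        amap_slice_lift[OF v] stack_mor_coh[OF k g x] D T.E.Cmp_Idt_right[OF functor_hom[OF lft_functor u]])
qed

text \<open>
  All components of the transformation induced by \<open>\<theta>\<close> have underlying arrows among those of \<open>\<theta>\<close>; that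
  they lie over \<open>f\<^sup>* b\<close> is the compatibility of \<open>\<theta>\<close> with \<open>\<phi>\<close> and \<open>\<psi>\<close>.
\<close>

definition stack_trans ::
  "('oe', 'me', 'oe, 'me) adj \<times> ('of \<Rightarrow> 'me) \<Rightarrow> ('oe' \<Rightarrow> 'me) \<Rightarrow>
   ('oe', 'me', 'oe, 'me) adj \<times> ('of \<Rightarrow> 'me) \<Rightarrow>
   'of \<times> 'me' \<Rightarrow> ('of \<times> 'me) \<times> ('mf \<times> 'me \<times> 'me \<times> 'me) \<times> ('of \<times> 'me)" where
  "stack_trans = (\<lambda>(a, \<phi>) \<theta> (c, \<psi>). \<lambda>(b, x) \<in> Obj T'.tot.
     tarr E f b (\<phi> b \<cdot>\<^bsub>E\<^esub> amap (lft a) x) (Idt F b) (\<theta> (Dom E' x)) b (\<psi> b \<cdot>\<^bsub>E\<^esub> amap (lft c) x))"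

lemma stack_trans_at:
  "b \<in> Obj F \<Longrightarrow> x \<in> Obj (slice E' (T'.p b)) \<Longrightarrow> stack_trans (a, \<phi>) \<theta> (c, \<psi>) (b, x) =
    tarr E f b (\<phi> b \<cdot>\<^bsub>E\<^esub> amap (lft a) x) (Idt F b) (\<theta> (Dom E' x)) b (\<psi> b \<cdot>\<^bsub>E\<^esub> amap (lft c) x)"
  by (simp add: stack_trans_def T'.Obj_tot)

context
  fixes a \<phi> c \<psi> \<theta>
  assumes t: "((a, \<phi>), \<theta>, (c, \<psi>)) \<in> hom W (a, \<phi>) (c, \<psi>)"
begin

lemma weak_trans_objs: "(a, \<phi>) \<in> Obj W" "(c, \<psi>) \<in> Obj W"
  and theta_nat_trans: "nat_trans E' E (lft a) (lft c) \<theta>"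
  and theta_over: "b \<in> Obj F \<Longrightarrow> \<psi> b \<cdot>\<^bsub>E\<^esub> \<theta> (T'.p b) = \<phi> b"
  using t by (simp_all add: hom_W)

lemma stack_trans_hom:
  assumes b: "b \<in> Obj F" and x: "x \<in> Obj (slice E' (T'.p b))"
  shows "tarr E f b (\<phi> b \<cdot>\<^bsub>E\<^esub> amap (lft a) x) (Idt F b) (\<theta> (Dom E' x)) b (\<psi> b \<cdot>\<^bsub>E\<^esub> amap (lft c) x)
    \<in> hom T.tot (b, \<phi> b \<cdot>\<^bsub>E\<^esub> amap (lft a) x) (b, \<psi> b \<cdot>\<^bsub>E\<^esub> amap (lft c) x)"
proof -
  note xh = x[unfolded Obj_slice_hom] note X = T'.E.hom_obj_dom[OF xh] and pb = functor_obj[OF T'.f b]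
  note La = lft_functor[OF weak_trans_objs(1)] and Lc = lft_functor[OF weak_trans_objs(2)]
  note h = nat_trans_hom[OF theta_nat_trans X] nat_trans_hom[OF theta_nat_trans pb]
  have "(\<psi> b \<cdot>\<^bsub>E\<^esub> amap (lft c) x) \<cdot>\<^bsub>E\<^esub> \<theta> (Dom E' x) = \<phi> b \<cdot>\<^bsub>E\<^esub> amap (lft a) x"
    using T.E.Cmp_assoc[OF h(1) functor_hom[OF Lc xh] phi_hom[OF weak_trans_objs(2) b]]
      T.E.Cmp_assoc[OF functor_hom[OF La xh] h(2) phi_hom[OF weak_trans_objs(2) b]]
    by (simp add: nat_trans_natural[OF theta_nat_trans xh, symmetric] theta_over[OF b])
  then show ?thesis
    using T.F.Idt_in[OF b] lift_obj[OF weak_trans_objs(1) b x] lift_obj[OF weak_trans_objs(2) b x] h(1)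
      T.pa_Idt_Cmp[OF b lift_obj[OF weak_trans_objs(1) b x, unfolded Obj_slice_hom]]
    by (simp add: T.hom_tarr Dom_lift[OF weak_trans_objs(1) b x] Dom_lift[OF weak_trans_objs(2) b x])
qed

lemma stack_trans_in: "(stack_mor (a, \<phi>), stack_trans (a, \<phi>) \<theta> (c, \<psi>), stack_mor (c, \<psi>))
    \<in> hom Opf (stack_mor (a, \<phi>)) (stack_mor (c, \<psi>))"
proof -
  let ?S = "total_functor F T'.S T.S (stack_mor (a, \<phi>))" and ?T = "total_functor F T'.S T.S (stack_mor (c, \<psi>))"
  let ?t = "stack_trans (a, \<phi>) \<theta> (c, \<psi>)"
  note A = opfib_term_morphism_stack_mor[OF weak_trans_objs(1)] and C = opfib_term_morphism_stack_mor[OF weak_trans_objs(2)]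
  have "nat_trans T'.tot T.tot ?S ?T ?t"
  proof (rule nat_transI[OF is_functor_total_mor[OF A] is_functor_total_mor[OF C]])
    show "?t \<in> extensional (Obj T'.tot)" by (simp add: stack_trans_def)
    fix q assume q: "q \<in> Obj T'.tot"
    obtain b x where bx: "q = (b, x)" by fastforce
    from q have b: "b \<in> Obj F" and x: "x \<in> Obj (slice E' (T'.p b))" by (simp_all add: bx T'.Obj_tot)
    show "?t q \<in> hom T.tot (omap ?S q) (omap ?T q)"
      using stack_trans_hom[OF b x]
      by (simp add: bx stack_trans_at[OF b x] omap_total_stack_mor[OF weak_trans_objs(1) b x] omap_total_stack_mor[OF weak_trans_objs(2) b x])
  next
    fix s q r assume s: "s \<in> hom T'.tot q r"
    obtain b x b' y where qr: "q = (b, x)" "r = (b', y)" by (metis surj_pair)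
    from s[unfolded qr] obtain g u where gu: "s = tarr E' f' b x g u b' y" by (rule T'.hom_totE)
    note s' = s[unfolded qr gu]
    from s' have g: "g \<in> hom F b b'" and x: "x \<in> Obj (slice E' (T'.p b))" and y: "y \<in> Obj (slice E' (T'.p b'))"
      and u: "u \<in> hom E' (Dom E' x) (Dom E' y)"
      by (simp_all add: T'.hom_tarr)
    note b = T.F.hom_obj_dom[OF g] and b' = T.F.hom_obj_cod[OF g]
    have Ss: "tarr E f b (\<phi> b \<cdot>\<^bsub>E\<^esub> amap (lft a) x) g (amap (lft a) u) b' (\<phi> b' \<cdot>\<^bsub>E\<^esub> amap (lft a) y) \<in>
        hom T.tot (b, \<phi> b \<cdot>\<^bsub>E\<^esub> amap (lft a) x) (b', \<phi> b' \<cdot>\<^bsub>E\<^esub> amap (lft a) y)"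
      using functor_hom[OF is_functor_total_mor[OF A] s']
      by (simp add: amap_total_stack_mor[OF weak_trans_objs(1) s'] omap_total_stack_mor[OF weak_trans_objs(1)] b b' x y)
    have Ts: "tarr E f b (\<psi> b \<cdot>\<^bsub>E\<^esub> amap (lft c) x) g (amap (lft c) u) b' (\<psi> b' \<cdot>\<^bsub>E\<^esub> amap (lft c) y) \<in>
        hom T.tot (b, \<psi> b \<cdot>\<^bsub>E\<^esub> amap (lft c) x) (b', \<psi> b' \<cdot>\<^bsub>E\<^esub> amap (lft c) y)"
      using functor_hom[OF is_functor_total_mor[OF C] s']
      by (simp add: amap_total_stack_mor[OF weak_trans_objs(2) s'] omap_total_stack_mor[OF weak_trans_objs(2)] b b' x y)
    show "?t r \<cdot>\<^bsub>T.tot\<^esub> amap ?S s = amap ?T s \<cdot>\<^bsub>T.tot\<^esub> ?t q"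
      unfolding qr gu amap_total_stack_mor[OF weak_trans_objs(1) s'] amap_total_stack_mor[OF weak_trans_objs(2) s']
        stack_trans_at[OF b x] stack_trans_at[OF b' y]
        T.Cmp_tarr[OF Ss stack_trans_hom[OF b' y]] T.Cmp_tarr[OF stack_trans_hom[OF b x] Ts]
      by (simp add: T.F.Cmp_Idt_left[OF g] T.F.Cmp_Idt_right[OF g] nat_trans_natural[OF theta_nat_trans u])
  qed
  moreover have "\<forall>q \<in> Obj T'.tot. vertical F T.S (?t q)"
  proof
    fix q assume q: "q \<in> Obj T'.tot"
    obtain b x where bx: "q = (b, x)" by fastforce
    from q have b: "b \<in> Obj F" and x: "x \<in> Obj (slice E' (T'.p b))" by (simp_all add: bx T'.Obj_tot)
    show "vertical F T.S (?t q)"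
      by (simp add: bx stack_trans_at[OF b x] T.vertical_tarr[OF stack_trans_hom[OF b x]])
  qed
  ultimately show ?thesis using A C by (simp add: hom_O Obj_O)
qed

end

definition stack_functor where
  "stack_functor = \<lparr>omap = (\<lambda>k \<in> Obj W. stack_mor k),
     amap = (\<lambda>(k, \<theta>, l) \<in> Arr W. (stack_mor k, stack_trans k \<theta> l, stack_mor l))\<rparr>"

lemma omap_stack_functor: "k \<in> Obj W \<Longrightarrow> omap stack_functor k = stack_mor k"
  and amap_stack_functor: "(k, \<theta>, l) \<in> Arr W \<Longrightarrow>
    amap stack_functor (k, \<theta>, l) = (stack_mor k, stack_trans k \<theta> l, stack_mor l)"
  by (simp_all add: stack_functor_def)

lemma stack_trans_ext: "stack_trans k \<theta> l \<in> extensional (Obj T'.tot)"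
  by (cases k; cases l) (simp add: stack_trans_def)

lemma tot'_cases:
  assumes "q \<in> Obj T'.tot"
  obtains b x where "q = (b, x)" "b \<in> Obj F" "x \<in> Obj (slice E' (T'.p b))"
  using assms by (cases q) (simp add: T'.Obj_tot)

lemma is_functor_stack_functor: "is_functor W Opf stack_functor"
proof (rule is_functorI)
  interpret W: category W by (rule category_W)
  show "category W" "category Opf" by (rule category_W, rule category_O)
  show "omap stack_functor \<in> extensional (Obj W)" "amap stack_functor \<in> extensional (Arr W)"
    by (simp_all add: stack_functor_def)
  show "omap stack_functor k \<in> Obj Opf" if "k \<in> Obj W" for k
    using that by (cases k) (simp add: omap_stack_functor Obj_O opfib_term_morphism_stack_mor)
  fix k l s assume s: "s \<in> hom W k l"
  obtain a \<phi> c \<psi> where kl: "k = (a, \<phi>)" "l = (c, \<psi>)" by fastforce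
  from s[unfolded kl] obtain \<theta> where th: "s = ((a, \<phi>), \<theta>, (c, \<psi>))" by (auto simp: hom_W)
  note s' = s[unfolded th kl]
  show "amap stack_functor s \<in> hom Opf (omap stack_functor k) (omap stack_functor l)"
    using stack_trans_in[OF s'] W.hom_obj_dom[OF s] W.hom_obj_cod[OF s]
    by (simp add: amap_stack_functor[OF hom_Arr[OF s']] th kl omap_stack_functor)
  fix r m assume r: "r \<in> hom W l m"
  obtain d \<chi> where m: "m = (d, \<chi>)" by fastforce
  from r[unfolded kl m] obtain \<eta> where eta: "r = ((c, \<psi>), \<eta>, (d, \<chi>))" by (auto simp: hom_W)
  note r' = r[unfolded eta kl m]
  let ?c = "\<lambda>x \<in> Obj E'. \<eta> x \<cdot>\<^bsub>E\<^esub> \<theta> x"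
  have rs: "r \<cdot>\<^bsub>W\<^esub> s = ((a, \<phi>), ?c, (d, \<chi>))" by (simp add: th eta Wmor_over_def)
  note rs' = W.Cmp_in[OF s r, unfolded rs kl m]
  have "stack_trans (a, \<phi>) ?c (d, \<chi>) =
      (\<lambda>q \<in> Obj T'.tot. stack_trans (c, \<psi>) \<eta> (d, \<chi>) q \<cdot>\<^bsub>T.tot\<^esub> stack_trans (a, \<phi>) \<theta> (c, \<psi>) q)"
  proof (rule extensionalityI[OF stack_trans_ext])
    fix q assume q: "q \<in> Obj T'.tot"
    then obtain b x where bx: "q = (b, x)" and b: "b \<in> Obj F" and x: "x \<in> Obj (slice E' (T'.p b))"
      by (rule tot'_cases)
    note X = T'.E.hom_obj_dom[OF x[unfolded Obj_slice_hom]]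
    have "stack_trans (c, \<psi>) \<eta> (d, \<chi>) (b, x) \<cdot>\<^bsub>T.tot\<^esub> stack_trans (a, \<phi>) \<theta> (c, \<psi>) (b, x) =
        stack_trans (a, \<phi>) ?c (d, \<chi>) (b, x)"
      unfolding stack_trans_at[OF b x] T.Cmp_tarr[OF stack_trans_hom[OF s' b x] stack_trans_hom[OF r' b x]]
      using X by (simp add: T.F.Cmp_Idt_left[OF T.F.Idt_in[OF b]])
    then show "stack_trans (a, \<phi>) ?c (d, \<chi>) q =
        (\<lambda>q \<in> Obj T'.tot. stack_trans (c, \<psi>) \<eta> (d, \<chi>) q \<cdot>\<^bsub>T.tot\<^esub> stack_trans (a, \<phi>) \<theta> (c, \<psi>) q) q"
      using q by (simp add: bx)
  qed simp
  then show "amap stack_functor (r \<cdot>\<^bsub>W\<^esub> s) = amap stack_functor r \<cdot>\<^bsub>Opf\<^esub> amap stack_functor s"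
    unfolding rs amap_stack_functor[OF hom_Arr[OF rs']]
    by (simp add: th eta amap_stack_functor[OF hom_Arr[OF s']] amap_stack_functor[OF hom_Arr[OF r']]
        OpfibTerm_def)
next
  interpret W: category W by (rule category_W)
  fix k assume k: "k \<in> Obj W"
  obtain a \<phi> where a: "k = (a, \<phi>)" by fastforce
  note k' = k[unfolded a]
  let ?i = "\<lambda>x \<in> Obj E'. Idt E (omap (lft a) x)"
  have i: "Idt W k = ((a, \<phi>), ?i, (a, \<phi>))" by (simp add: a Wmor_over_def)
  have "((a, \<phi>), ?i, (a, \<phi>)) \<in> hom W k k" using W.Idt_in[OF k] unfolding i .
  note ih = this[unfolded a]
  have "stack_trans (a, \<phi>) ?i (a, \<phi>) =
      (\<lambda>q \<in> Obj T'.tot. Idt T.tot (omap (total_functor F T'.S T.S (stack_mor (a, \<phi>))) q))"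
  proof (rule extensionalityI[OF stack_trans_ext])
    fix q assume q: "q \<in> Obj T'.tot"
    then obtain b x where bx: "q = (b, x)" and b: "b \<in> Obj F" and x: "x \<in> Obj (slice E' (T'.p b))"
      by (rule tot'_cases)
    note X = T'.E.hom_obj_dom[OF x[unfolded Obj_slice_hom]]
    have "Idt T.tot (b, \<phi> b \<cdot>\<^bsub>E\<^esub> amap (lft a) x) = stack_trans (a, \<phi>) ?i (a, \<phi>) (b, x)"
      using T.Idt_tarr[of b "\<phi> b \<cdot>\<^bsub>E\<^esub> amap (lft a) x"] lift_obj[OF k' b x] b X
      by (simp add: T.Obj_tot stack_trans_at[OF b x] Dom_lift[OF k' b x] del: total_cat_simps)
    then show "stack_trans (a, \<phi>) ?i (a, \<phi>) q =
        (\<lambda>q \<in> Obj T'.tot. Idt T.tot (omap (total_functor F T'.S T.S (stack_mor (a, \<phi>))) q)) q"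
      using q by (simp add: bx omap_total_stack_mor[OF k' b x] del: total_cat_simps)
  qed simp
  then show "amap stack_functor (Idt W k) = Idt Opf (omap stack_functor k)"
    unfolding i amap_stack_functor[OF hom_Arr[OF ih]] omap_stack_functor[OF k]
    by (simp add: a OpfibTerm_def)
qed

definition bang :: "'oe' \<Rightarrow> 'me'" where
  "bang X = (SOME u. u \<in> hom E' X (T'.p one))"

lemma bang_hom: "X \<in> Obj E' \<Longrightarrow> bang X \<in> hom E' X (T'.p one)"
  unfolding bang_def by (rule someI_ex[OF terminal_ex[OF one_E']])

lemma one_obj: "one \<in> Obj F"
  by (rule terminal_obj[OF one])

lemma bang_obj: "X \<in> Obj E' \<Longrightarrow> bang X \<in> Obj (slice E' (T'.p one))"
  using bang_hom[of X] by (simp add: Obj_slice hom_def)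

lemma Dom_bang: "X \<in> Obj E' \<Longrightarrow> Dom E' (bang X) = X"
  by (rule hom_Dom[OF bang_hom])

lemma bang_unique: "v \<in> hom E' X (T'.p one) \<Longrightarrow> v = bang X"
  by (rule T'.E.terminal_eq[OF one_E' _ bang_hom[OF T'.E.hom_obj_dom]])

lemma bang_slice:
  assumes u: "u \<in> hom E' X Y"
  shows "(bang X, u, bang Y) \<in> hom (slice E' (T'.p one)) (bang X) (bang Y)"
proof -
  note X = T'.E.hom_obj_dom[OF u] and Y = T'.E.hom_obj_cod[OF u]
  show ?thesis
    using u bang_unique[OF T'.E.Cmp_in[OF u bang_hom[OF Y]]]
    by (simp add: hom_slice_iff bang_obj X Y Dom_bang)
qed

definition to_one :: "'of \<Rightarrow> 'mf" where
  "to_one b = (SOME g. g \<in> hom F b one)"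

lemma to_one_hom: "b \<in> Obj F \<Longrightarrow> to_one b \<in> hom F b one"
  unfolding to_one_def by (rule someI_ex[OF terminal_ex[OF one]])

lemma to_one_unique: "g \<in> hom F b one \<Longrightarrow> g = to_one b"
  by (rule T.F.terminal_eq[OF one _ to_one_hom[OF T.F.hom_obj_dom]])

lemma pa_to_one:
  assumes b: "b \<in> Obj F" and x: "x \<in> Obj (slice E' (T'.p b))"
  shows "T'.pa (to_one b) \<cdot>\<^bsub>E'\<^esub> x = bang (Dom E' x)"
  by (rule bang_unique[OF T'.E.Cmp_in[OF x[unfolded Obj_slice_hom] T'.pa_hom[OF to_one_hom[OF b]]]])

text \<open>
  A transformation between the functors of total categories is determined by its components over
  the terminal object: the cocartesian arrow from \<open>x : X \<rightarrow> f'\<^sup>* b\<close> to \<open>X \<rightarrow> f'\<^sup>* 1\<close> has identity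
  underlying arrow, so naturality identifies the two components.
\<close>

lemma fully_faithful_stack_functor: "fully_faithful W Opf stack_functor"
proof (rule fully_faithfulI[OF is_functor_stack_functor])
  fix k l s r assume s: "s \<in> hom W k l" and r: "r \<in> hom W k l" and eq: "amap stack_functor s = amap stack_functor r"
  obtain a \<phi> c \<psi> where kl: "k = (a, \<phi>)" "l = (c, \<psi>)" by fastforce
  from s[unfolded kl] obtain \<theta> where th: "s = ((a, \<phi>), \<theta>, (c, \<psi>))" by (auto simp: hom_W)
  from r[unfolded kl] obtain \<eta> where eta: "r = ((a, \<phi>), \<eta>, (c, \<psi>))" by (auto simp: hom_W)
  note s' = s[unfolded th kl] and r' = r[unfolded eta kl]
  have st: "stack_trans (a, \<phi>) \<theta> (c, \<psi>) = stack_trans (a, \<phi>) \<eta> (c, \<psi>)"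
    using eq unfolding th eta amap_stack_functor[OF hom_Arr[OF s']] amap_stack_functor[OF hom_Arr[OF r']]
    by simp
  have "\<theta> = \<eta>"
  proof (rule extensionalityI[OF nat_trans_ext[OF theta_nat_trans[OF s']] nat_trans_ext[OF theta_nat_trans[OF r']]])
    fix X assume X: "X \<in> Obj E'"
    from st have "stack_trans (a, \<phi>) \<theta> (c, \<psi>) (one, bang X) = stack_trans (a, \<phi>) \<eta> (c, \<psi>) (one, bang X)"
      by simp
    then show "\<theta> X = \<eta> X" unfolding stack_trans_at[OF one_obj bang_obj[OF X]] Dom_bang[OF X] by simp
  qed
  then show "s = r" by (simp add: th eta)
next
  fix k l h assume k: "k \<in> Obj W" and l: "l \<in> Obj W"
    and h: "h \<in> hom Opf (omap stack_functor k) (omap stack_functor l)"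
  obtain a \<phi> c \<psi> where kl: "k = (a, \<phi>)" "l = (c, \<psi>)" by fastforce
  note k' = k[unfolded kl] and l' = l[unfolded kl]
  let ?S = "total_functor F T'.S T.S (stack_mor (a, \<phi>))" and ?T = "total_functor F T'.S T.S (stack_mor (c, \<psi>))"
  from h[unfolded kl omap_stack_functor[OF k'] omap_stack_functor[OF l'] hom_O]
  obtain \<Theta> where hT: "h = (stack_mor (a, \<phi>), \<Theta>, stack_mor (c, \<psi>))"
    and Th: "nat_trans T'.tot T.tot ?S ?T \<Theta>"
    and vert: "\<And>q. q \<in> Obj T'.tot \<Longrightarrow> vertical F T.S (\<Theta> q)"
    by blast
  let ?a = "\<lambda>b x. \<phi> b \<cdot>\<^bsub>E\<^esub> amap (lft a) x" and ?c = "\<lambda>b x. \<psi> b \<cdot>\<^bsub>E\<^esub> amap (lft c) x"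
  have "\<exists>u. \<Theta> (b, x) = tarr E f b (?a b x) (Idt F b) u b (?c b x) \<and>
      \<Theta> (b, x) \<in> hom T.tot (b, ?a b x) (b, ?c b x)"
    if b: "b \<in> Obj F" and x: "x \<in> Obj (slice E' (T'.p b))" for b x
  proof -
    have bx: "(b, x) \<in> Obj T'.tot" using b x by (simp add: T'.Obj_tot)
    have hm: "\<Theta> (b, x) \<in> hom T.tot (b, ?a b x) (b, ?c b x)"
      using nat_trans_hom[OF Th bx]
      by (simp only: omap_total_stack_mor[OF k' b x] omap_total_stack_mor[OF l' b x])
    from hm obtain g u where e: "\<Theta> (b, x) = tarr E f b (?a b x) g u b (?c b x)" by (rule T.hom_totE)
    have "g = Idt F b" using vert[OF bx] T.vertical_tarr[OF hm[unfolded e]] by (simp add: e)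
    with e hm show ?thesis by blast
  qed
  then obtain \<upsilon> where Te: "\<And>b x. b \<in> Obj F \<Longrightarrow> x \<in> Obj (slice E' (T'.p b)) \<Longrightarrow>
      \<Theta> (b, x) = tarr E f b (?a b x) (Idt F b) (\<upsilon> b x) b (?c b x)"
    and Tin: "\<And>b x. b \<in> Obj F \<Longrightarrow> x \<in> Obj (slice E' (T'.p b)) \<Longrightarrow>
      \<Theta> (b, x) \<in> hom T.tot (b, ?a b x) (b, ?c b x)"
    by metis
  note Th_hom = Tin[unfolded Te]
  have ups_hom: "\<upsilon> b x \<in> hom E (omap (lft a) (Dom E' x)) (omap (lft c) (Dom E' x))"
    and ups_over: "?c b x \<cdot>\<^bsub>E\<^esub> \<upsilon> b x = T.pa (Idt F b) \<cdot>\<^bsub>E\<^esub> ?a b x"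
    if b: "b \<in> Obj F" and x: "x \<in> Obj (slice E' (T'.p b))" for b x
    using Tin[OF b x] unfolding Te[OF b x] T.hom_tarr Dom_lift[OF k' b x] Dom_lift[OF l' b x] by simp_all
  have nat: "\<upsilon> b' y \<cdot>\<^bsub>E\<^esub> amap (lft a) u = amap (lft c) u \<cdot>\<^bsub>E\<^esub> \<upsilon> b x"
    if s: "tarr E' f' b x g u b' y \<in> hom T'.tot (b, x) (b', y)" for b x g u b' y
  proof -
    from s have g: "g \<in> hom F b b'" and x: "x \<in> Obj (slice E' (T'.p b))" and y: "y \<in> Obj (slice E' (T'.p b'))"
      by (simp_all add: T'.hom_tarr)
    note b = T.F.hom_obj_dom[OF g] and b' = T.F.hom_obj_cod[OF g]
    note Ss = functor_hom[OF nat_trans_dom[OF Th] s, unfolded amap_total_stack_mor[OF k' s]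
        omap_total_stack_mor[OF k' b x] omap_total_stack_mor[OF k' b' y]]
    note Ts = functor_hom[OF nat_trans_cod[OF Th] s, unfolded amap_total_stack_mor[OF l' s]
        omap_total_stack_mor[OF l' b x] omap_total_stack_mor[OF l' b' y]]
    from nat_trans_natural[OF Th s]
    have "tarr E f b (?a b x) (Idt F b' \<cdot>\<^bsub>F\<^esub> g) (\<upsilon> b' y \<cdot>\<^bsub>E\<^esub> amap (lft a) u) b' (?c b' y) =
        tarr E f b (?a b x) (g \<cdot>\<^bsub>F\<^esub> Idt F b) (amap (lft c) u \<cdot>\<^bsub>E\<^esub> \<upsilon> b x) b' (?c b' y)"
      unfolding amap_total_stack_mor[OF k' s] amap_total_stack_mor[OF l' s] Te[OF b x] Te[OF b' y]
        T.Cmp_tarr[OF Ss Tin[OF b' y, unfolded Te[OF b' y]]] T.Cmp_tarr[OF Tin[OF b x, unfolded Te[OF b x]] Ts] .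
    then show ?thesis by simp
  qed
  define \<theta> where "\<theta> = (\<lambda>X \<in> Obj E'. \<upsilon> one (bang X))"
  have ups: "\<upsilon> b x = \<theta> (Dom E' x)" if b: "b \<in> Obj F" and x: "x \<in> Obj (slice E' (T'.p b))" for b x
  proof -
    note X = T'.E.hom_obj_dom[OF x[unfolded Obj_slice_hom]]
    have "tarr E' f' b x (to_one b) (Idt E' (Dom E' x)) one (bang (Dom E' x)) \<in> hom T'.tot (b, x) (one, bang (Dom E' x))"
      using to_one_hom[OF b] x bang_obj[OF X] T'.E.Idt_in[OF X] T'.E.Cmp_Idt_right[OF bang_hom[OF X]]
      by (simp add: T'.hom_tarr Dom_bang[OF X] pa_to_one[OF b x])
    from nat[OF this] have "\<upsilon> one (bang (Dom E' x)) = \<upsilon> b x"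
      using T.E.Cmp_Idt_right[OF ups_hom[OF one_obj bang_obj[OF X]]] T.E.Cmp_Idt_left[OF ups_hom[OF b x]]
      by (simp add: functor_Idt[OF lft_functor[OF k'] X] functor_Idt[OF lft_functor[OF l'] X] Dom_bang[OF X])
    then show ?thesis using X by (simp add: \<theta>_def)
  qed
  have theta_nat_trans: "nat_trans E' E (lft a) (lft c) \<theta>"
  proof (rule nat_transI[OF lft_functor[OF k'] lft_functor[OF l']])
    show "\<theta> \<in> extensional (Obj E')" by (simp add: \<theta>_def)
    show "\<theta> X \<in> hom E (omap (lft a) X) (omap (lft c) X)" if X: "X \<in> Obj E'" for X
      using ups_hom[OF one_obj bang_obj[OF X]] X by (simp add: \<theta>_def Dom_bang)
    fix u X Y assume u: "u \<in> hom E' X Y"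
    note X = T'.E.hom_obj_dom[OF u] and Y = T'.E.hom_obj_cod[OF u]
    have "tarr E' f' one (bang X) (Idt F one) u one (bang Y) \<in> hom T'.tot (one, bang X) (one, bang Y)"
      using bang_obj[OF X] bang_obj[OF Y] u T.F.Idt_in[OF one_obj] bang_unique[OF T'.E.Cmp_in[OF u bang_hom[OF Y]]]
        T'.pa_Idt_Cmp[OF one_obj bang_hom[OF X]]
      by (simp add: T'.hom_tarr Dom_bang X Y)
    from nat[OF this] show "\<theta> Y \<cdot>\<^bsub>E\<^esub> amap (lft a) u = amap (lft c) u \<cdot>\<^bsub>E\<^esub> \<theta> X"
      using X Y by (simp add: \<theta>_def)
  qed
  have over: "\<psi> b \<cdot>\<^bsub>E\<^esub> \<theta> (T'.p b) = \<phi> b" if b: "b \<in> Obj F" for b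
  proof -
    note pb = functor_obj[OF T'.f b]
    note i = T'.E.Idt_in[OF pb]
    have io: "Idt E' (T'.p b) \<in> Obj (slice E' (T'.p b))" using i by (simp add: Obj_slice hom_def)
    have 1: "?a b (Idt E' (T'.p b)) = \<phi> b" "?c b (Idt E' (T'.p b)) = \<psi> b"
      using T.E.Cmp_Idt_right[OF phi_hom[OF k' b]] T.E.Cmp_Idt_right[OF phi_hom[OF l' b]]
      by (simp_all add: functor_Idt[OF lft_functor[OF k'] pb] functor_Idt[OF lft_functor[OF l'] pb])
    show ?thesis
      using ups_over[OF b io] ups[OF b io] T.pa_Idt_Cmp[OF b phi_hom[OF k' b]]
      by (simp add: 1 hom_Dom[OF i])
  qed
  have s: "((a, \<phi>), \<theta>, (c, \<psi>)) \<in> hom W (a, \<phi>) (c, \<psi>)"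
    using k' l' theta_nat_trans over by (simp add: hom_W)
  have "stack_trans (a, \<phi>) \<theta> (c, \<psi>) = \<Theta>"
  proof (rule extensionalityI[OF stack_trans_ext nat_trans_ext[OF Th]])
    fix q assume "q \<in> Obj T'.tot"
    then obtain b x where bx: "q = (b, x)" and b: "b \<in> Obj F" and x: "x \<in> Obj (slice E' (T'.p b))"
      by (rule tot'_cases)
    show "stack_trans (a, \<phi>) \<theta> (c, \<psi>) q = \<Theta> q"
      unfolding bx stack_trans_at[OF b x] Te[OF b x] ups[OF b x] ..
  qed
  then have "amap stack_functor ((a, \<phi>), \<theta>, (c, \<psi>)) = h"
    by (simp add: amap_stack_functor[OF hom_Arr[OF s]] hT)
  with s show "\<exists>u \<in> hom W k l. amap stack_functor u = h" unfolding kl by blast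
qed

end

section \<open>Recovering the weak morphism from a morphism of stacks\<close>

context relative_topos_pair
begin

context
  fixes A
  assumes A: "opfib_term_morphism F T'.S T.S A"
begin

abbreviation fib where "fib b \<equiv> lft (adjs A b)"

abbreviation fo where "fo b x \<equiv> omap (fib b) x"

lemma fib_functor: "b \<in> Obj F \<Longrightarrow> is_functor (slice E' (T'.p b)) (slice E (T.p b)) (fib b)"
  using opfib_mor_lft[OF A, of b] by simp

lemma fo_obj: "b \<in> Obj F \<Longrightarrow> x \<in> Obj (slice E' (T'.p b)) \<Longrightarrow> fo b x \<in> Obj (slice E (T.p b))"
  by (rule functor_obj[OF fib_functor])

text \<open>
  Since \<open>f'\<^sup>* 1\<close> and \<open>f\<^sup>* 1\<close> are terminal, the slices over them are copies of \<open>E'\<close> and \<open>E\<close>.  The functor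
  given by \<open>A\<close> over the terminal object of \<open>F\<close> thus becomes a functor from \<open>E'\<close> to \<open>E\<close>, which is the inverse
  image of the weak morphism that corresponds to \<open>A\<close>.
\<close>

definition fiber_one :: "('oe', 'me', 'oe, 'me) ftor" where
  "fiber_one = \<lparr>omap = (\<lambda>X \<in> Obj E'. Dom E (fo one (bang X))),
     amap = (\<lambda>u \<in> Arr E'. und (amap (fib one) (bang (Dom E' u), u, bang (Cod E' u))))\<rparr>"

lemma omap_fiber_one: "X \<in> Obj E' \<Longrightarrow> omap fiber_one X = Dom E (fo one (bang X))"
  by (simp add: fiber_one_def)

lemma amap_fiber_one: "u \<in> hom E' X Y \<Longrightarrow> amap fiber_one u = und (amap (fib one) (bang X, u, bang Y))"
  by (simp add: fiber_one_def hom_Arr hom_Dom hom_Cod)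

lemma fib_one_bang: "u \<in> hom E' X Y \<Longrightarrow>
    amap (fib one) (bang X, u, bang Y) \<in> hom (slice E (T.p one)) (fo one (bang X)) (fo one (bang Y))"
  by (rule functor_hom[OF fib_functor[OF one_obj] bang_slice])

lemma is_functor_fiber_one: "is_functor E' E fiber_one"
proof (rule is_functorI)
  show "category E'" "category E" by (rule T'.E.category_axioms, rule T.E.category_axioms)
  show "omap fiber_one \<in> extensional (Obj E')" "amap fiber_one \<in> extensional (Arr E')"
    by (simp_all add: fiber_one_def)
  fix X assume X: "X \<in> Obj E'"
  note o = fo_obj[OF one_obj bang_obj[OF X]]
  show "omap fiber_one X \<in> Obj E"
    using T.E.hom_obj_dom[OF o[unfolded Obj_slice_hom]] by (simp add: omap_fiber_one[OF X])
  show "amap fiber_one (Idt E' X) = Idt E (omap fiber_one X)"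
    using functor_Idt[OF fib_functor[OF one_obj] bang_obj[OF X]]
    by (simp add: amap_fiber_one[OF T'.E.Idt_in[OF X]] omap_fiber_one[OF X] Dom_bang[OF X])
next
  fix u X Y assume u: "u \<in> hom E' X Y"
  show "amap fiber_one u \<in> hom E (omap fiber_one X) (omap fiber_one Y)"
    using und_hom[OF fib_one_bang[OF u]] T'.E.hom_obj_dom[OF u] T'.E.hom_obj_cod[OF u]
    by (simp add: amap_fiber_one[OF u] omap_fiber_one)
  fix v Z assume v: "v \<in> hom E' Y Z"
  show "amap fiber_one (v \<cdot>\<^bsub>E'\<^esub> u) = amap fiber_one v \<cdot>\<^bsub>E\<^esub> amap fiber_one u"
    using functor_Cmp[OF fib_functor[OF one_obj] bang_slice[OF u] bang_slice[OF v]]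
    by (simp add: amap_fiber_one[OF u] amap_fiber_one[OF v] amap_fiber_one[OF T'.E.Cmp_in[OF u v]])
qed

text \<open>
  Couniversal arrows are carried along the two identifications of a slice over a terminal object with
  the whole category.
\<close>

lemma fiber_one_couniversal:
  assumes Y: "Y \<in> Obj E"
  shows "\<exists>r e. couniversal E' E fiber_one Y r e"
proof -
  obtain y where y: "y \<in> hom E Y (T.p one)" using terminal_ex[OF one_E Y] by blast
  have Dy: "Dom E y = Y" by (rule hom_Dom[OF y])
  have yo: "y \<in> Obj (slice E (T.p one))" using y by (simp add: Obj_slice_hom Dy)
  have "adjunction (slice E' (T'.p one)) (slice E (T.p one)) (adjs A one)"
    using opfib_mor_adj[OF A one_obj] by simp
  from adjunction_couniversal[OF this yo] obtain r e
    where co: "couniversal (slice E' (T'.p one)) (slice E (T.p one)) (fib one) y r e" by blast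
  then have r: "r \<in> Obj (slice E' (T'.p one))" and e: "e \<in> hom (slice E (T.p one)) (fo one r) y"
    by (simp_all add: couniversal_def)
  define R where "R = Dom E' r"
  have rR: "r = bang R" using bang_unique[OF r[unfolded Obj_slice_hom]] by (simp add: R_def)
  have R: "R \<in> Obj E'" using T'.E.hom_obj_dom[OF r[unfolded Obj_slice_hom]] by (simp add: R_def)
  have "couniversal E' E fiber_one Y R (und e)"
    unfolding couniversal_def
  proof (intro conjI ballI)
    show "R \<in> Obj E'" by (rule R)
    show "und e \<in> hom E (omap fiber_one R) Y"
      using und_hom[OF e] by (simp add: omap_fiber_one[OF R] rR Dy)
    fix X h assume X: "X \<in> Obj E'" and h: "h \<in> hom E (omap fiber_one X) Y"
    note o = fo_obj[OF one_obj bang_obj[OF X]]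
    note h' = h[unfolded omap_fiber_one[OF X]]
    \<comment> \<open>The codomain of \<open>y\<close> is terminal, so \<open>h\<close> lives over it.\<close>
    have "y \<cdot>\<^bsub>E\<^esub> h = fo one (bang X)"
      by (rule T.E.terminal_eq[OF one_E T.E.Cmp_in[OF h' y] o[unfolded Obj_slice_hom]])
    then have hs: "(fo one (bang X), h, y) \<in> hom (slice E (T.p one)) (fo one (bang X)) y"
      using o yo h' by (simp add: hom_slice_iff Dy)
    have eq: "e \<cdot>\<^bsub>slice E (T.p one)\<^esub> amap (fib one) (bang X, k, bang R) = (fo one (bang X), h, y) \<longleftrightarrow>
        und e \<cdot>\<^bsub>E\<^esub> amap fiber_one k = h" if k: "k \<in> hom E' X R" for k
    proof -
      note c = category.Cmp_in[OF T.E.category_slice fib_one_bang[OF k] e[unfolded rR]]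
      show ?thesis
        by (subst und_eq[OF c]) (simp add: amap_fiber_one[OF k])
    qed
    show "\<exists>!k. k \<in> hom E' X R \<and> und e \<cdot>\<^bsub>E\<^esub> amap fiber_one k = h"
    proof (rule ex_ex1I)
      from couniversal_ex[OF co bang_obj[OF X] hs] obtain q
        where q: "q \<in> hom (slice E' (T'.p one)) (bang X) (bang R)"
          "e \<cdot>\<^bsub>slice E (T.p one)\<^esub> amap (fib one) q = (fo one (bang X), h, y)"
        unfolding rR by blast
      have k: "und q \<in> hom E' X R" using und_hom[OF q(1)] by (simp add: Dom_bang X R)
      have "e \<cdot>\<^bsub>slice E (T.p one)\<^esub> amap (fib one) (bang X, und q, bang R) = (fo one (bang X), h, y)"
        using q(2) und_eq[OF q(1)] by simp
      with k eq[OF k] show "\<exists>k. k \<in> hom E' X R \<and> und e \<cdot>\<^bsub>E\<^esub> amap fiber_one k = h" by blast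
      fix k l assume k: "k \<in> hom E' X R \<and> und e \<cdot>\<^bsub>E\<^esub> amap fiber_one k = h"
        and l: "l \<in> hom E' X R \<and> und e \<cdot>\<^bsub>E\<^esub> amap fiber_one l = h"
      note kh = conjunct1[OF k] and lh = conjunct1[OF l]
      have "(bang X, k, bang R) = (bang X, l, bang R)"
      proof (rule couniversal_eq[OF co[unfolded rR] fib_functor[OF one_obj] bang_slice[OF kh] bang_slice[OF lh]])
        show "e \<cdot>\<^bsub>slice E (T.p one)\<^esub> amap (fib one) (bang X, k, bang R) =
            e \<cdot>\<^bsub>slice E (T.p one)\<^esub> amap (fib one) (bang X, l, bang R)"
          using eq[OF kh] eq[OF lh] k l by simp
      qed
      then show "k = l" by simp
    qed
  qed
  then show ?thesis by blast
qed

abbreviation cell :: "'mf \<Rightarrow> 'me' \<Rightarrow> 'me" where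
  "cell g x \<equiv> und (coh A g x)"

lemma coh_hom:
  assumes g: "g \<in> hom F b b'" and x: "x \<in> Obj (slice E' (T'.p b))"
  shows "coh A g x \<in> hom (slice E (T.p b')) (T.pa g \<cdot>\<^bsub>E\<^esub> fo b x) (fo b' (T'.pa g \<cdot>\<^bsub>E'\<^esub> x))"
  using opfib_mor_coh_hom[OF A g, of x] x fo_obj[OF T.F.hom_obj_dom[OF g] x]
  by (simp add: T.E.omap_postcomp[OF T.pa_hom[OF g]] T'.E.omap_postcomp[OF T'.pa_hom[OF g]])

lemma cell_hom:
  assumes g: "g \<in> hom F b b'" and x: "x \<in> Obj (slice E' (T'.p b))"
  shows "cell g x \<in> hom E (Dom E (fo b x)) (Dom E (fo b' (T'.pa g \<cdot>\<^bsub>E'\<^esub> x)))"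
  using und_hom[OF coh_hom[OF g x]] T.E.Dom_postcomp[OF T.pa_hom[OF g] fo_obj[OF T.F.hom_obj_dom[OF g] x]]
  by simp

lemma cell_over:
  assumes g: "g \<in> hom F b b'" and x: "x \<in> Obj (slice E' (T'.p b))"
  shows "fo b' (T'.pa g \<cdot>\<^bsub>E'\<^esub> x) \<cdot>\<^bsub>E\<^esub> cell g x = T.pa g \<cdot>\<^bsub>E\<^esub> fo b x"
  by (rule und_over[OF coh_hom[OF g x]])

lemma cell_iso:
  assumes g: "g \<in> hom F b b'" and x: "x \<in> Obj (slice E' (T'.p b))"
  shows "iso_arr E (cell g x)"
proof -
  have "iso_arr (slice E (T.p b')) (coh A g x)"
    using nat_iso_iso[OF opfib_mor_coh[OF A g]] x by simp
  then show ?thesis by (rule T.E.iso_sliceD[OF coh_hom[OF g x]])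
qed

lemma cell_natural:
  assumes g: "g \<in> hom F b b'" and v: "(x, u, y) \<in> hom (slice E' (T'.p b)) x y"
  shows "cell g y \<cdot>\<^bsub>E\<^esub> und (amap (fib b) (x, u, y)) =
    und (amap (fib b') (T'.pa g \<cdot>\<^bsub>E'\<^esub> x, u, T'.pa g \<cdot>\<^bsub>E'\<^esub> y)) \<cdot>\<^bsub>E\<^esub> cell g x"
proof -
  note Av = functor_hom[OF fib_functor[OF T.F.hom_obj_dom[OF g]] v]
  note P = T.E.und_postcomp[OF T.pa_hom[OF g] Av]
  have "coh A g y \<cdot>\<^bsub>slice E (T.p b')\<^esub> amap (postcomp E (T.pa g)) (amap (fib b) (x, u, y)) =
      amap (fib b') (T'.pa g \<cdot>\<^bsub>E'\<^esub> x, u, T'.pa g \<cdot>\<^bsub>E'\<^esub> y) \<cdot>\<^bsub>slice E (T.p b')\<^esub> coh A g x"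
    using opfib_mor_coh_natural[OF A g, of "(x, u, y)" x y] v
    by (simp add: T'.E.amap_postcomp[OF T'.pa_hom[OF g] v])
  then have "und (coh A g y \<cdot>\<^bsub>slice E (T.p b')\<^esub> amap (postcomp E (T.pa g)) (amap (fib b) (x, u, y))) =
      und (amap (fib b') (T'.pa g \<cdot>\<^bsub>E'\<^esub> x, u, T'.pa g \<cdot>\<^bsub>E'\<^esub> y) \<cdot>\<^bsub>slice E (T.p b')\<^esub> coh A g x)"
    by simp
  then show ?thesis by (simp only: und_Cmp P)
qed

lemma cell_Cmp:
  assumes g: "g \<in> hom F b b'" and h: "h \<in> hom F b' b''" and x: "x \<in> Obj (slice E' (T'.p b))"
  shows "cell (h \<cdot>\<^bsub>F\<^esub> g) x = cell h (T'.pa g \<cdot>\<^bsub>E'\<^esub> x) \<cdot>\<^bsub>E\<^esub> cell g x"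
proof -
  note P = T.E.und_postcomp[OF T.pa_hom[OF h] coh_hom[OF g x]]
  have "coh A (h \<cdot>\<^bsub>F\<^esub> g) x = coh A h (T'.pa g \<cdot>\<^bsub>E'\<^esub> x) \<cdot>\<^bsub>slice E (T.p b'')\<^esub> amap (postcomp E (T.pa h)) (coh A g x)"
    using opfib_mor_coh_Cmp[OF A g h, of x] x by (simp add: T'.E.omap_postcomp[OF T'.pa_hom[OF g]])
  then show ?thesis by (simp only: und_Cmp P)
qed

text \<open>
  \<open>at_one b x\<close> compares \<open>A\<close> over \<open>b\<close> with \<open>A\<close> over the terminal object, hence with \<open>fiber_one\<close>.
\<close>

abbreviation at_one :: "'of \<Rightarrow> 'me' \<Rightarrow> 'me" where
  "at_one b x \<equiv> cell (to_one b) x"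

lemma at_one_hom:
  assumes b: "b \<in> Obj F" and x: "x \<in> Obj (slice E' (T'.p b))"
  shows "at_one b x \<in> hom E (Dom E (fo b x)) (omap fiber_one (Dom E' x))"
  using cell_hom[OF to_one_hom[OF b] x] T'.E.hom_obj_dom[OF x[unfolded Obj_slice_hom]]
  by (simp add: pa_to_one[OF b x] omap_fiber_one)

lemma at_one_natural:
  assumes b: "b \<in> Obj F" and v: "(x, u, y) \<in> hom (slice E' (T'.p b)) x y"
  shows "at_one b y \<cdot>\<^bsub>E\<^esub> und (amap (fib b) (x, u, y)) = amap fiber_one u \<cdot>\<^bsub>E\<^esub> at_one b x"
proof -
  from v have x: "x \<in> Obj (slice E' (T'.p b))" and y: "y \<in> Obj (slice E' (T'.p b))"
    and u: "u \<in> hom E' (Dom E' x) (Dom E' y)"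
    by (simp_all add: hom_slice_iff)
  show ?thesis
    using cell_natural[OF to_one_hom[OF b] v] by (simp add: pa_to_one[OF b x] pa_to_one[OF b y] amap_fiber_one[OF u])
qed

lemma at_one_pa:
  assumes g: "g \<in> hom F b b'" and x: "x \<in> Obj (slice E' (T'.p b))"
  shows "at_one b x = at_one b' (T'.pa g \<cdot>\<^bsub>E'\<^esub> x) \<cdot>\<^bsub>E\<^esub> cell g x"
proof -
  note t = to_one_hom[OF T.F.hom_obj_cod[OF g]]
  have "to_one b = to_one b' \<cdot>\<^bsub>F\<^esub> g" using to_one_unique[OF T.F.Cmp_in[OF g t]] by simp
  then show ?thesis using cell_Cmp[OF g t x] by simp
qed

abbreviation idp :: "'of \<Rightarrow> 'me'" where "idp b \<equiv> Idt E' (T'.p b)"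

lemma idp_obj: "b \<in> Obj F \<Longrightarrow> idp b \<in> Obj (slice E' (T'.p b))"
  using T'.E.Idt_in[OF functor_obj[OF T'.f]] by (simp add: Obj_slice hom_def)

lemma Dom_idp: "b \<in> Obj F \<Longrightarrow> Dom E' (idp b) = T'.p b"
  using T'.E.Idt_in[OF functor_obj[OF T'.f]] by (simp add: hom_def)

lemma to_idp:
  assumes b: "b \<in> Obj F" and x: "x \<in> Obj (slice E' (T'.p b))"
  shows "(x, x, idp b) \<in> hom (slice E' (T'.p b)) x (idp b)"
  using x T'.E.Cmp_Idt_left[OF x[unfolded Obj_slice_hom]] idp_obj[OF b]
  by (simp add: hom_slice_iff Dom_idp[OF b] Obj_slice_hom[symmetric])

text \<open>
  The isomorphism \<open>\<phi> b\<close> from \<open>a\<^sup>* (f'\<^sup>* b)\<close> to \<open>f\<^sup>* b\<close> of the weak morphism that corresponds to \<open>A\<close>: the value of \<open>A\<close> at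
  the identity of \<open>f'\<^sup>* b\<close>, corrected by the comparison cell.  It is invertible because the identity is
  terminal in its slice and \<open>A\<close> preserves terminal objects.
\<close>

definition struct :: "'of \<Rightarrow> 'me" where
  "struct = (\<lambda>b \<in> Obj F. fo b (idp b) \<cdot>\<^bsub>E\<^esub> inv_arr E (at_one b (idp b)))"

lemma at_one_idp:
  assumes b: "b \<in> Obj F"
  shows at_one_idp_hom: "at_one b (idp b) \<in> hom E (Dom E (fo b (idp b))) (omap fiber_one (T'.p b))"
    and at_one_idp_iso: "iso_arr E (at_one b (idp b))"
    and fo_idp_hom: "fo b (idp b) \<in> hom E (Dom E (fo b (idp b))) (T.p b)"
  using at_one_hom[OF b idp_obj[OF b]] cell_iso[OF to_one_hom[OF b] idp_obj[OF b]]
    fo_obj[OF b idp_obj[OF b]]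
  by (simp_all add: Dom_idp[OF b] Obj_slice_hom)

lemma struct_hom: "b \<in> Obj F \<Longrightarrow> struct b \<in> hom E (omap fiber_one (T'.p b)) (T.p b)"
  using T.E.Cmp_in[OF inv_arr_hom[OF at_one_idp_iso at_one_idp_hom] fo_idp_hom]
  by (simp add: struct_def)

lemma struct_at_one: "b \<in> Obj F \<Longrightarrow> struct b \<cdot>\<^bsub>E\<^esub> at_one b (idp b) = fo b (idp b)"
  using T.E.cancel_inv_right'[OF at_one_idp_iso at_one_idp_hom fo_idp_hom] by (simp add: struct_def)

lemma struct_iso:
  assumes b: "b \<in> Obj F"
  shows "iso_arr E (struct b)"
proof -
  have "terminal (slice E' (T'.p b)) (idp b)"
    using T'.E.terminal_slice_iso[OF functor_obj[OF T'.f b]] idp_obj[OF b]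
      T'.E.iso_Idt[OF functor_obj[OF T'.f b]] by simp
  then have "terminal (slice E (T.p b)) (fo b (idp b))"
    using opfib_mor_terminal[OF A b] by (simp add: preserves_terminal_def)
  then have "iso_arr E (fo b (idp b))"
    using T.E.terminal_slice_iso[OF functor_obj[OF T.f b]] by simp
  then show ?thesis
    using T.E.iso_Cmp[OF T.E.iso_inv_arr[OF at_one_idp_iso[OF b] at_one_idp_hom[OF b]]
        inv_arr_hom[OF at_one_idp_iso[OF b] at_one_idp_hom[OF b]] _ fo_idp_hom[OF b]] b
    by (simp add: struct_def)
qed

text \<open>
  Every \<open>x : X \<rightarrow> f'\<^sup>* b\<close> is an arrow of the slice from \<open>x\<close> to the identity; naturality of the
  comparison cells at this arrow determines \<open>A\<close> over \<open>b\<close> by its value at the identity.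
\<close>

lemma fo_factor:
  assumes b: "b \<in> Obj F" and x: "x \<in> Obj (slice E' (T'.p b))"
  shows "(struct b \<cdot>\<^bsub>E\<^esub> amap fiber_one x) \<cdot>\<^bsub>E\<^esub> at_one b x = fo b x"
proof -
  note xh = x[unfolded Obj_slice_hom]
  note v = to_idp[OF b x]
  note Av = functor_hom[OF fib_functor[OF b] v]
  note dx = functor_hom[OF is_functor_fiber_one xh]
  have "(struct b \<cdot>\<^bsub>E\<^esub> amap fiber_one x) \<cdot>\<^bsub>E\<^esub> at_one b x =
      struct b \<cdot>\<^bsub>E\<^esub> (at_one b (idp b) \<cdot>\<^bsub>E\<^esub> und (amap (fib b) (x, x, idp b)))"
    by (simp add: T.E.Cmp_assoc[OF at_one_hom[OF b x] dx struct_hom[OF b], symmetric] at_one_natural[OF b v])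
  also have "\<dots> = fo b (idp b) \<cdot>\<^bsub>E\<^esub> und (amap (fib b) (x, x, idp b))"
    by (simp add: T.E.Cmp_assoc[OF und_hom[OF Av] at_one_idp_hom[OF b] struct_hom[OF b]] struct_at_one[OF b])
  also have "\<dots> = fo b x" by (rule und_over[OF Av])
  finally show ?thesis .
qed

text \<open>
  Both sides become \<open>f\<^sup>* g \<circ> A (id)\<close> after composition with the invertible arrow \<open>at_one b (idp b)\<close>: the
  left one by the cocycle condition for \<open>b \<rightarrow> b' \<rightarrow> 1\<close> and the factorization over \<open>b'\<close>.
\<close>

lemma struct_natural:
  assumes g: "g \<in> hom F b b'"
  shows "struct b' \<cdot>\<^bsub>E\<^esub> amap fiber_one (T'.pa g) = T.pa g \<cdot>\<^bsub>E\<^esub> struct b"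
proof -
  note b = T.F.hom_obj_dom[OF g] and b' = T.F.hom_obj_cod[OF g]
  note pg = T'.pa_hom[OF g]
  note i = idp_obj[OF b]
  have gi: "T'.pa g \<cdot>\<^bsub>E'\<^esub> idp b = T'.pa g" by (rule T'.E.Cmp_Idt_right[OF pg])
  have go: "T'.pa g \<in> Obj (slice E' (T'.p b'))" using pg by (simp add: Obj_slice hom_def)
  have Dg: "Dom E' (T'.pa g) = T'.p b" by (rule hom_Dom[OF pg])
  note c = cell_hom[OF g i, unfolded gi]
  note o = at_one_hom[OF b' go, unfolded Dg]
  note dg = functor_hom[OF is_functor_fiber_one pg]
  show ?thesis
  proof (rule T.E.iso_epic[OF at_one_idp_iso[OF b] at_one_idp_hom[OF b]])
    show "struct b' \<cdot>\<^bsub>E\<^esub> amap fiber_one (T'.pa g) \<in> hom E (omap fiber_one (T'.p b)) (T.p b')"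
      by (rule T.E.Cmp_in[OF dg struct_hom[OF b']])
    show "T.pa g \<cdot>\<^bsub>E\<^esub> struct b \<in> hom E (omap fiber_one (T'.p b)) (T.p b')"
      by (rule T.E.Cmp_in[OF struct_hom[OF b] T.pa_hom[OF g]])
    have "(struct b' \<cdot>\<^bsub>E\<^esub> amap fiber_one (T'.pa g)) \<cdot>\<^bsub>E\<^esub> at_one b (idp b) =
        ((struct b' \<cdot>\<^bsub>E\<^esub> amap fiber_one (T'.pa g)) \<cdot>\<^bsub>E\<^esub> at_one b' (T'.pa g)) \<cdot>\<^bsub>E\<^esub> cell g (idp b)"
      using T.E.Cmp_assoc[OF c o T.E.Cmp_in[OF dg struct_hom[OF b']]] at_one_pa[OF g i] by (simp add: gi)
    also have "\<dots> = T.pa g \<cdot>\<^bsub>E\<^esub> fo b (idp b)"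
      using cell_over[OF g i] by (simp add: fo_factor[OF b' go] gi)
    also have "\<dots> = (T.pa g \<cdot>\<^bsub>E\<^esub> struct b) \<cdot>\<^bsub>E\<^esub> at_one b (idp b)"
      using T.E.Cmp_assoc[OF at_one_idp_hom[OF b] struct_hom[OF b] T.pa_hom[OF g]]
      by (simp add: struct_at_one[OF b])
    finally show "(struct b' \<cdot>\<^bsub>E\<^esub> amap fiber_one (T'.pa g)) \<cdot>\<^bsub>E\<^esub> at_one b (idp b) =
        (T.pa g \<cdot>\<^bsub>E\<^esub> struct b) \<cdot>\<^bsub>E\<^esub> at_one b (idp b)" .
  qed
qed

text \<open>
  The isomorphism has the components \<open>at_one b x\<close>.  They lie over \<open>f\<^sup>* b\<close> by the factorization above, and
  their naturality along \<open>(g, u)\<close> combines naturality of the cell of \<open>b' \<rightarrow> 1\<close> at \<open>u\<close> with the cocycle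
  condition for \<open>b \<rightarrow> b' \<rightarrow> 1\<close>.
\<close>

lemma opfib_term_morphism_iso_stack_mor: "\<exists>k \<in> Obj W. \<exists>i \<in> hom Opf A (stack_mor k). iso_arr Opf i"
proof -
  obtain a where a: "adjunction E' E a" and la: "lft a = fiber_one"
    using adjunction_of_couniversal[OF is_functor_fiber_one fiber_one_couniversal] by blast
  have "nat_trans F E (comp_functor F fiber_one (lft f')) (lft f) struct"
  proof (rule nat_transI[OF is_functor_comp[OF T'.f is_functor_fiber_one] T.f])
    show "struct \<in> extensional (Obj F)" by (simp add: struct_def)
    show "struct b \<in> hom E (omap (comp_functor F fiber_one (lft f')) b) (T.p b)" if "b \<in> Obj F" for b
      using struct_hom[OF that] that by simp
    show "struct b' \<cdot>\<^bsub>E\<^esub> amap (comp_functor F fiber_one (lft f')) g = T.pa g \<cdot>\<^bsub>E\<^esub> struct b"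
      if "g \<in> hom F b b'" for g b b'
      using struct_natural[OF that] hom_Arr[OF that] by simp
  qed
  then have k: "(a, struct) \<in> Obj W"
    using a struct_iso by (simp add: Obj_W la nat_iso_def)
  let ?B = "stack_mor (a, struct)"
  note B = opfib_term_morphism_stack_mor[OF k]
  let ?S = "total_functor F T'.S T.S A" and ?T = "total_functor F T'.S T.S ?B"
  define \<Theta> where "\<Theta> = (\<lambda>(b, x) \<in> Obj T'.tot.
    tarr E f b (fo b x) (Idt F b) (at_one b x) b (struct b \<cdot>\<^bsub>E\<^esub> amap fiber_one x))"
  have Te: "\<Theta> (b, x) = tarr E f b (fo b x) (Idt F b) (at_one b x) b (struct b \<cdot>\<^bsub>E\<^esub> amap fiber_one x)"
    if "b \<in> Obj F" "x \<in> Obj (slice E' (T'.p b))" for b x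
    using that by (simp add: \<Theta>_def T'.Obj_tot)
  have Th: "tarr E f b (fo b x) (Idt F b) (at_one b x) b (struct b \<cdot>\<^bsub>E\<^esub> amap fiber_one x) \<in>
      hom T.tot (b, fo b x) (b, struct b \<cdot>\<^bsub>E\<^esub> amap fiber_one x)"
    if b: "b \<in> Obj F" and x: "x \<in> Obj (slice E' (T'.p b))" for b x
    using T.F.Idt_in[OF b] fo_obj[OF b x] lift_obj[OF k b x] Dom_lift[OF k b x] at_one_hom[OF b x]
      fo_factor[OF b x] T.pa_Idt_Cmp[OF b fo_obj[OF b x, unfolded Obj_slice_hom]]
    by (simp add: T.hom_tarr la)
  have So: "omap ?S (b, x) = (b, fo b x)" and To: "omap ?T (b, x) = (b, struct b \<cdot>\<^bsub>E\<^esub> amap fiber_one x)"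
    if "b \<in> Obj F" "x \<in> Obj (slice E' (T'.p b))" for b x
    using that omap_total_stack_mor[OF k that] by (simp_all add: omap_total_functor la)
  have nt: "nat_trans T'.tot T.tot ?S ?T \<Theta>"
  proof (rule nat_transI[OF is_functor_total_mor[OF A] is_functor_total_mor[OF B]])
    show "\<Theta> \<in> extensional (Obj T'.tot)" by (simp add: \<Theta>_def)
    fix q assume "q \<in> Obj T'.tot"
    then obtain b x where bx: "q = (b, x)" and b: "b \<in> Obj F" and x: "x \<in> Obj (slice E' (T'.p b))"
      by (rule tot'_cases)
    show "\<Theta> q \<in> hom T.tot (omap ?S q) (omap ?T q)"
      unfolding bx Te[OF b x] So[OF b x] To[OF b x] by (rule Th[OF b x])
  next
    fix s q r assume s: "s \<in> hom T'.tot q r"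
    obtain b x b' y where qr: "q = (b, x)" "r = (b', y)" by (metis surj_pair)
    from s[unfolded qr] obtain g u where gu: "s = tarr E' f' b x g u b' y" by (rule T'.hom_totE)
    note s' = s[unfolded qr gu]
    from s' have g: "g \<in> hom F b b'" and x: "x \<in> Obj (slice E' (T'.p b))" and y: "y \<in> Obj (slice E' (T'.p b'))"
      and u: "u \<in> hom E' (Dom E' x) (Dom E' y)" and yu: "y \<cdot>\<^bsub>E'\<^esub> u = T'.pa g \<cdot>\<^bsub>E'\<^esub> x"
      by (simp_all add: T'.hom_tarr)
    note b = T.F.hom_obj_dom[OF g] and b' = T.F.hom_obj_cod[OF g]
    note gx = T'_slice_pa[OF g x]
    have Dgx: "Dom E' (T'.pa g \<cdot>\<^bsub>E'\<^esub> x) = Dom E' x" by (rule T'.E.Dom_postcomp[OF T'.pa_hom[OF g] x])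
    have v: "(T'.pa g \<cdot>\<^bsub>E'\<^esub> x, u, y) \<in> hom (slice E' (T'.p b')) (T'.pa g \<cdot>\<^bsub>E'\<^esub> x) y"
      using gx y u yu by (simp add: hom_slice_iff Dgx)
    let ?v = "und (amap (fib b') (T'.pa g \<cdot>\<^bsub>E'\<^esub> x, u, y))"
    note Ss = functor_hom[OF is_functor_total_mor[OF A] s', unfolded amap_total_tarr[OF A s'] So[OF b x] So[OF b' y]]
    note Ts = functor_hom[OF is_functor_total_mor[OF B] s',
        unfolded amap_total_stack_mor[OF k s'] To[OF b x] To[OF b' y] la]
    have "at_one b' y \<cdot>\<^bsub>E\<^esub> (?v \<cdot>\<^bsub>E\<^esub> cell g x) = amap fiber_one u \<cdot>\<^bsub>E\<^esub> at_one b x"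
    proof -
      note c = cell_hom[OF g x]
      note w = und_hom[OF functor_hom[OF fib_functor[OF b'] v]]
      note o = at_one_hom[OF b' gx, unfolded Dgx]
      show ?thesis
        by (simp add: T.E.Cmp_assoc[OF c w at_one_hom[OF b' y]] at_one_natural[OF b' v] at_one_pa[OF g x]
            T.E.Cmp_assoc[OF c o functor_hom[OF is_functor_fiber_one u]])
    qed
    then show "\<Theta> r \<cdot>\<^bsub>T.tot\<^esub> amap ?S s = amap ?T s \<cdot>\<^bsub>T.tot\<^esub> \<Theta> q"
      unfolding qr gu amap_total_tarr[OF A s'] amap_total_stack_mor[OF k s'] la Te[OF b x] Te[OF b' y]
        T.Cmp_tarr[OF Ss Th[OF b' y]] T.Cmp_tarr[OF Th[OF b x] Ts]
      by (simp add: T.F.Cmp_Idt_left[OF g] T.F.Cmp_Idt_right[OF g])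
  qed
  have iso: "iso_arr T.tot (\<Theta> q)" and vert: "vertical F T.S (\<Theta> q)"
    and vert': "vertical F T.S (inv_arr T.tot (\<Theta> q))" if "q \<in> Obj T'.tot" for q
  proof -
    from that obtain b x where bx: "q = (b, x)" and b: "b \<in> Obj F" and x: "x \<in> Obj (slice E' (T'.p b))"
      by (rule tot'_cases)
    show i: "iso_arr T.tot (\<Theta> q)"
      unfolding bx Te[OF b x] by (rule T.iso_tarr[OF Th[OF b x] cell_iso[OF to_one_hom[OF b] x]])
    show vq: "vertical F T.S (\<Theta> q)"
      unfolding bx Te[OF b x] T.vertical_tarr[OF Th[OF b x]] ..
    show "vertical F T.S (inv_arr T.tot (\<Theta> q))"
      using T.split.vertical_inv_arr[OF Th[OF b x]] i vq unfolding bx Te[OF b x] .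
  qed
  have "(A, \<Theta>, ?B) \<in> hom Opf A ?B"
    using A B nt vert by (simp add: hom_O Obj_O)
  moreover have "iso_arr Opf (A, \<Theta>, ?B)"
    unfolding OpfibTerm_def
    by (rule iso_transformation_cat) (use A B nt iso vert vert' in simp_all)
  ultimately show ?thesis using k by blast
qed

end

lemma essentially_surjective_stack_functor: "essentially_surjective W Opf stack_functor"
  unfolding essentially_surjective_def
proof
  fix A assume "A \<in> Obj Opf"
  then have "opfib_term_morphism F T'.S T.S A" by (simp add: Obj_O)
  from opfib_term_morphism_iso_stack_mor[OF this] obtain k i where k: "k \<in> Obj W" and i: "i \<in> hom Opf A (stack_mor k)" "iso_arr Opf i"
    by blast
  from i k show "\<exists>k \<in> Obj W. \<exists>i \<in> hom Opf A (omap stack_functor k). iso_arr Opf i"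
    by (intro bexI[of _ k] bexI[of _ i]) (simp_all add: omap_stack_functor)
qed

lemma equivalent_OpfibTerm_Wmor: "equivalent_categories Opf W"
  by (rule equivalent_categories_ff_es[OF is_functor_stack_functor fully_faithful_stack_functor
        essentially_surjective_stack_functor])

end

section \<open>The equivalence\<close>

theorem proposition6p2p5:
  fixes E :: "('oe, 'me) cat" and E' :: "('oe', 'me') cat" and F :: "('of, 'mf) cat"
    and f :: "('of, 'mf, 'oe, 'me) adj" and f' :: "('of, 'mf, 'oe', 'me') adj"
  assumes "inaccessible_universe TYPE('u)"
    and "grothendieck_topos TYPE('u) E"
    and "grothendieck_topos TYPE('u) E'"
    and "grothendieck_topos TYPE('u) F"
    and "geometric_morphism E F f"
    and "geometric_morphism E' F f'"
  shows "equivalent_categories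
           (OpfibTerm F (canonical_stack E' f') (canonical_stack E f))
           (Wmor_over E E' F f f')"
proof -
  have F: "category F" by (rule topos_category[OF assms(4)])
  from topos_has_terminal[OF assms(1,4)] obtain one where one: "terminal F one" by blast
  have f: "is_functor F E (lft f)" and f': "is_functor F E' (lft f')"
    using assms(5,6) by (simp_all add: geometric_morphism_def adjunction_lft)
  have "terminal E (omap (lft f) one)" "terminal E' (omap (lft f') one)"
    using assms(5,6) preserves_finite_limits_terminal[OF F f _ one] preserves_finite_limits_terminal[OF F f' _ one]
    by (simp_all add: geometric_morphism_def)
  then interpret relative_topos_pair E E' F f f' one
    using f f' one topos_has_pullbacks[OF assms(1,3)]
    by (simp add: relative_topos_pair_def relative_topos_pair_axioms_def canonical_def)
  show ?thesis by (rule equivalent_OpfibTerm_Wmor)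
qed

end
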